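(* Let $\bm U_h^I\in\mathbb V_h^{I,k}$ and $\bm U_h^J\in\mathbb V_h^{J,k}$, with $\overline{\bm U}_{ij}^I\in\mathcal G$ and $\overline{\bm U}_{i+\frac12,j+\frac12}^J\in\mathcal G$ for all $i,j$. Let $\alpha_1=\max\{1,\beta_1\}$, $\alpha_2=\max\{1,\beta_2\}$ with $$\beta_1=\max_{i,j,\mu}\max_{m=\pm1}\left\{\frac{\big|[\![B_{1,h}^J(x_i,y_{j+\frac m4}^\mu)]\!]\big|}{2\sqrt{\{\!\{(\rho h)^J(x_i,y_{j+\frac m4}^\mu)\}\!\}}},\ \frac{\big|[\![B_{1,h}^I(x_{i+\frac12},y_{j+\frac12+\frac m4}^\mu)]\!]\big|}{2\sqrt{\{\!\{(\rho h)^I(x_{i+\frac12},y_{j+\frac12+\frac m4}^\mu)\}\!\}}}\right\},$$ $$\beta_2=\max_{i,j,\mu}\max_{m=\pm1}\left\{\frac{\big|[\![B_{2,h}^J(x_{i+\frac m4}^\mu,y_j)]\!]\big|}{2\sqrt{\{\!\{(\rho h)^J(x_{i+\frac m4}^\mu,y_j)\}\!\}}},\ \frac{\big|[\![B_{2,h}^I(x_{i+\frac12+\frac m4}^\mu,y_{j+\frac12})]\!]\big|}{2\sqrt{\{\!\{(\rho h)^I(x_{i+\frac12+\frac m4}^\mu,y_{j+\frac12})\}\!\}}}\right\},$$ where $\{\!\{(\rho h)^\bullet\}\!\}$ is the arithmetic average of the two one-sided values of $\rho h$ at the interface. Consider a feasible 2D symmetric cell average decomposition for $\mathbb P^k$ with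 $\lambda_1=\frac{\alpha_1}{\Delta x}$, $\lambda_2=\frac{\alpha_2}{\Delta y}$ and boundary weight $\bar\omega$, and let $\mathcal Q_{ij}$ be the associated node sets. If $$\bm U_h^I(x,y)\in\mathcal G,\qquad \bm U_h^J(x,y)\in\mathcal G\qquad\forall (x,y)\in\mathcal Q_{ij},\ \forall i,j,$$ then $$\overline{\bm U}_{ij}^I+\Delta t\,\mathcal L_{ij}^I(\bm U_h^I,\bm U_h^J)\in\mathcal G,\qquad \overline{\bm U}_{i+\frac12,j+\frac12}^J+\Delta t\,\mathcal L_{i+\frac12,j+\frac12}^J(\bm U_h^J,\bm U_h^I)\in\mathcal G\qquad\forall i,j$$ under the CFL condition $$0<\Delta t\left(\frac{\alpha_1}{\Delta x}+\frac{\alpha_2}{\Delta y}\right)\le\frac{\theta\bar\omega}{2},\qquad\theta=\frac{\Delta t}{\tau_{\max}}\in(0,1].$$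
   Context: **RMHD.** States are $\bm U=(D,\bm m,\bm B,E)^\top\in\mathbb R^8$ with $\bm m=(m_1,m_2,m_3)$, $\bm B=(B_1,B_2,B_3)$. They are related to primitive variables $(\rho,\bm v,\bm B,p)$, $\bm v=(v_1,v_2,v_3)$, by $D=\rho W$, $m_i=\rho hW^2v_i+|\bm B|^2v_i-(\bm v\cdot\bm B)B_i$, $E=\rho hW^2-p_{tot}+|\bm B|^2$, where $W=(1-|\bm v|^2)^{-1/2}$, $p_{tot}=p+p_m$, $p_m=\frac12\big((1-|\bm v|^2)|\bm B|^2+(\bm v\cdot\bm B)^2\big)$ (speed of light $=1$). The specific enthalpy $h=h(p,\rho)=1+e(p,\rho)+p/\rho$ is a given differentiable equation of state ($e$ the specific internal energy) with $h(p,\rho)\ge\sqrt{1+p^2/\rho^2}+p/\rho$ and $h\big(\frac1\rho-\frac{\partial h}{\partial p}\big)<\frac{\partial h}{\partial\rho}<0$. Fluxes: $\bm F_i(\bm U)=\big(Dv_i,\ v_i\bm m-B_i(W^{-2}\bm B+(\bm v\cdot\bm B)\bm v)+p_{tot}\bm e_i,\ v_i\bm B-B_i\bm v,\ m_i\big)^\top$, with $\bm e_i$ the $i$th row of the $3\times3$ identity. Source vector: $\bm S(\bm U)=\big(0,\ (1-|\bm v|^2)\bm B+(\bm v\cdot\bm B)\bm v,\ \bm v,\ \bm v\cdot\bm B\big)^\top$. The admissible set is $\mathcal G=\{\bm U: D>0,\ p(\bm U)>0,\ |\bm v(\bm U)|<1\}$, where $p(\bm U),\bm v(\bm U)$ are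 the primitive quantities determined implicitly by $\bm U$; i.e. $\mathcal G$ consists of the $\bm U$ arising from primitive variables with $\rho>0$, $p>0$, $|\bm v|<1$ (these are then unique). $\mathcal G$ is convex. **Overlapping meshes.** Primal cells $I_{ij}=(x_{i-\frac12},x_{i+\frac12})\times(y_{j-\frac12},y_{j+\frac12})$, uniform with sizes $\Delta x,\Delta y$ and centers $(x_i,y_j)$; dual cells $J_{i+\frac12,j+\frac12}=(x_i,x_{i+1})\times(y_j,y_{j+1})$. Boundary issues are disregarded (all referenced cells exist). $x_{i\pm\frac14}=x_i\pm\frac14\Delta x$, $y_{j\pm\frac14}=y_j\pm\frac14\Delta y$ (likewise with half-integer base indices). $Q=k+1$; $\{x_{i\pm\frac14}^\mu\}_{\mu=1}^Q$ and $\{y_{j\pm\frac14}^\mu\}_{\mu=1}^Q$ are the $Q$-point Gauss nodes in $[x_{i\pm\frac14}-\frac{\Delta x}4,x_{i\pm\frac14}+\frac{\Delta x}4]$ and $[y_{j\pm\frac14}-\frac{\Delta y}4,y_{j\pm\frac14}+\frac{\Delta y}4]$, with weights $\omega_\mu$, $\sum_\mu\omega_\mu=1$. **Locally divergence-free spaces.** $\mathbb V_h^{I,k}$ (resp. $\mathbb V_h^{J,k}$) is the set of $\mathbb R^8$-valued functions whose components restricted to each $I_{ij}$ (resp. $J_{i+\frac12,j+\frac12}$) are polynomials of total degree $\le k$ and whose 5th and 6th components $(B_1,B_2)$ satisfy $\partial_xB_1+\partial_yB_2=0$ inside each cell. $B_{\ell,h}^I,B_{\ell,h}^J$ denote the $B_\ell$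 components of $\bm U_h^I,\bm U_h^J$. $(\rho h)^I(x,y)$ and $(\rho h)^J(x,y)$ denote the value of $\rho h$ for the state $\bm U_h^I(x,y)$ and $\bm U_h^J(x,y)$, respectively. Cell averages: $\overline{\bm U}_{ij}^\bullet=\frac1{\Delta x\Delta y}\int_{I_{ij}}\bm U_h^\bullet$, $\overline{\bm U}_{i+\frac12,j+\frac12}^\bullet=\frac1{\Delta x\Delta y}\int_{J_{i+\frac12,j+\frac12}}\bm U_h^\bullet$, $\bullet\in\{I,J\}$. **Jumps and averages.** Across a vertical line, $[\![g(x_*,y)]\!]=g(x_*^+,y)-g(x_*^-,y)$, $\{\!\{g(x_*,y)\}\!\}=\frac12(g(x_*^+,y)+g(x_*^-,y))$; across a horizontal line, $[\![g(x,y_* )]\!]=g(x,y_*^+)-g(x,y_*^-)$, $\{\!\{g(x,y_* )\}\!\}=\frac12(g(x,y_*^+)+g(x,y_*^-))$. **Cell average decomposition (CAD).** A feasible 2D symmetric CAD on $\Omega=[-1,1]^2$ for $\mathbb P^k$, with parameters $\lambda_1,\lambda_2\ge0$, $\lambda=\lambda_1+\lambda_2>0$, is an identity valid for all polynomials $f$ of total degree $\le k$: $$\frac14\int_\Omega f=\bar\omega\sum_{\mu=1}^Q\omega_\mu\Big(\tfrac{\lambda_1}{\lambda}\big(f(-1,y^\mu)+f(1,y^\mu)\big)+\tfrac{\lambda_2}{\lambda}\big(f(x^\mu,-1)+f(x^\mu,1)\big)\Big)+\sum_{s=1}^S\tilde\omega_sf(\tilde x^s,\tilde y^s),$$ with $\bar\omega>0$,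 $\tilde\omega_s\ge0$, $2\bar\omega+\sum_s\tilde\omega_s=1$, $\{x^\mu\},\{y^\mu\}$ the $Q$-point Gauss nodes in $[-1,1]$, and $(\tilde x^s,\tilde y^s)\in\Omega$. The node set is $\mathcal Q_{ij}=\bigcup_{m=\pm1}\bigcup_{\sigma=\pm1}\mathcal Q_{i+\frac m4,j+\frac\sigma4}$ with $$\mathcal Q_{i+\frac m4,j+\frac\sigma4}=\{(x_{i+\frac m4}\pm\tfrac{\Delta x}4,y_{j+\frac\sigma4}^\mu)\}_{\mu}\cup\{(x_{i+\frac m4}^\mu,y_{j+\frac\sigma4}\pm\tfrac{\Delta y}4)\}_\mu\cup\{(x_{i+\frac m4}+\tfrac14\tilde x^s\Delta x,\ y_{j+\frac\sigma4}+\tfrac14\tilde y^s\Delta y)\}_{s}.$$ Point values of $\bm U_h^I,\bm U_h^J$ at nodes of $\mathcal Q_{i+\frac m4,j+\frac\sigma4}$ are the limits from inside the quarter cell $[x_{i+\frac m4}-\frac{\Delta x}4,x_{i+\frac m4}+\frac{\Delta x}4]\times[y_{j+\frac\sigma4}-\frac{\Delta y}4,y_{j+\frac\sigma4}+\frac{\Delta y}4]$, on which both are polynomial. **Cell-average operators of the locally divergence-free central discontinuous Galerkin scheme** for $\bm U_t+\nabla\cdot\bm F(\bm U)=-(\nabla\cdot\bm B)\bm S(\bm U)$, with parameter $\tau_{\max}>0$: $\mathcal L_{ij}^I(\bm U_h^I,\bm U_h^J)=\mathcal H_{ij}^I+\mathcal S_{ij}^J$, $\mathcal L_{i+\frac12,j+\frac12}^J(\bm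 U_h^J,\bm U_h^I)=\mathcal H_{i+\frac12,j+\frac12}^J+\mathcal S_{i+\frac12,j+\frac12}^I$, where (sums over $m=\pm1$, $\mu=1,\dots,Q$) $$\mathcal H_{ij}^I=\frac{\overline{\bm U}_{ij}^J-\overline{\bm U}_{ij}^I}{\tau_{\max}}-\frac1{\Delta x}\sum_{m,\mu}\frac{\omega_\mu}2\Big(\bm F_1(\bm U_h^J(x_{i+\frac12},y_{j+\frac m4}^\mu))-\bm F_1(\bm U_h^J(x_{i-\frac12},y_{j+\frac m4}^\mu))\Big)-\frac1{\Delta y}\sum_{m,\mu}\frac{\omega_\mu}2\Big(\bm F_2(\bm U_h^J(x_{i+\frac m4}^\mu,y_{j+\frac12}))-\bm F_2(\bm U_h^J(x_{i+\frac m4}^\mu,y_{j-\frac12}))\Big),$$ $$\mathcal S_{ij}^J=-\frac1{\Delta x}\sum_{m,\mu}\frac{\omega_\mu}2[\![B_{1,h}^J(x_i,y_{j+\frac m4}^\mu)]\!]\,\bm S\big(\{\!\{\bm U_h^J(x_i,y_{j+\frac m4}^\mu)\}\!\}\big)-\frac1{\Delta y}\sum_{m,\mu}\frac{\omega_\mu}2[\![B_{2,h}^J(x_{i+\frac m4}^\mu,y_j)]\!]\,\bm S\big(\{\!\{\bm U_h^J(x_{i+\frac m4}^\mu,y_j)\}\!\}\big),$$ and $\mathcal H_{i+\frac12,j+\frac12}^J$, $\mathcal S_{i+\frac12,j+\frac12}^I$ are given by the same formulas with the roles of $I$ and $J$ exchanged and all indices $i,j$ shifted by $\frac12$ (so that,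 e.g., $x_{i\pm\frac12}$ becomes $x_{i+1},x_i$, and the jumps are at $x_{i+\frac12}$, $y_{j+\frac12}$).
   Formalization: Added assumption on the equation of state: e(p,ρ) → 0 as p → 0+ for every ρ > 0. Without it the claim fails, e.g. for h = (1/2+√(ρ²+1/4))/ρ + 2p/ρ, even though 𝒢 is convex there. Convexity of 𝒢 is then proved, not assumed. *)

theory Defs
  imports "HOL-Analysis.Analysis"
begin

section \<open>Relativistic magnetohydrodynamics\<close>

text \<open>A state is \<open>(D, m, B, E)\<close>; an equation of state is given by the specific internal
  energy \<open>e p \<rho>\<close> as a function of pressure and density.\<close>

type_synonym state = "real \<times> (real^3) \<times> (real^3) \<times> real"

fun dens :: "state \<Rightarrow> real" where "dens (D, m, B, E) = D"
fun mom :: "state \<Rightarrow> real^3" where "mom (D, m, B, E) = m"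
fun mag :: "state \<Rightarrow> real^3" where "mag (D, m, B, E) = B"
fun energy :: "state \<Rightarrow> real" where "energy (D, m, B, E) = E"

definition enthalpy :: "(real \<Rightarrow> real \<Rightarrow> real) \<Rightarrow> real \<Rightarrow> real \<Rightarrow> real" where
  "enthalpy e p \<rho> = 1 + e p \<rho> + p / \<rho>"

definition eos :: "(real \<Rightarrow> real \<Rightarrow> real) \<Rightarrow> bool" where
  "eos e \<longleftrightarrow> (\<forall>p>0. \<forall>\<rho>>0.
     (\<lambda>(q, r). enthalpy e q r) differentiable (at (p, \<rho>)) \<and>
     enthalpy e p \<rho> \<ge> sqrt (1 + p\<^sup>2 / \<rho>\<^sup>2) + p / \<rho> \<and>
     enthalpy e p \<rho> * (1 / \<rho> - deriv (\<lambda>q. enthalpy e q \<rho>) p) < deriv (\<lambda>r. enthalpy e p r) \<rho> \<and>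
     deriv (\<lambda>r. enthalpy e p r) \<rho> < 0)"

text \<open>The internal energy vanishes with the pressure. This is independent of \<^const>\<open>eos\<close>, and
  convexity of the set \<open>admissible\<close> below fails without it: for
  \<open>e p \<rho> = 1 / (1 + \<rho>) + 2 * p / \<rho>\<close> one has \<open>eos e\<close>, but the states at rest with \<open>B = 0\<close> are
  \<open>(D, 0, 0, E)\<close> with \<open>E > D + D / (1 + D)\<close>, and the right-hand side is strictly concave in \<open>D\<close>.\<close>

definition cold_limit :: "(real \<Rightarrow> real \<Rightarrow> real) \<Rightarrow> bool" where
  "cold_limit e \<longleftrightarrow> (\<forall>\<rho>>0. ((\<lambda>p. e p \<rho>) \<longlongrightarrow> 0) (at_right 0))"

definition lorentz :: "real^3 \<Rightarrow> real" where
  "lorentz v = 1 / sqrt (1 - (norm v)\<^sup>2)"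

definition ptot :: "real^3 \<Rightarrow> real^3 \<Rightarrow> real \<Rightarrow> real" where
  "ptot v B p = p + ((1 - (norm v)\<^sup>2) * (norm B)\<^sup>2 + (v \<bullet> B)\<^sup>2) / 2"

definition cons_state ::
  "(real \<Rightarrow> real \<Rightarrow> real) \<Rightarrow> real \<Rightarrow> real^3 \<Rightarrow> real^3 \<Rightarrow> real \<Rightarrow> state" where
  "cons_state e \<rho> v B p =
    (let W = lorentz v; h = enthalpy e p \<rho> in
     (\<rho> * W,
      (\<rho> * h * W\<^sup>2) *\<^sub>R v + (norm B)\<^sup>2 *\<^sub>R v - (v \<bullet> B) *\<^sub>R B,
      B,
      \<rho> * h * W\<^sup>2 - ptot v B p + (norm B)\<^sup>2))"

definition is_primitive ::
  "(real \<Rightarrow> real \<Rightarrow> real) \<Rightarrow> state \<Rightarrow> real \<times> (real^3) \<times> real \<Rightarrow> bool" where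
  "is_primitive e U = (\<lambda>(\<rho>, v, p).
     \<rho> > 0 \<and> p > 0 \<and> norm v < 1 \<and> U = cons_state e \<rho> v (mag U) p)"

definition admissible :: "(real \<Rightarrow> real \<Rightarrow> real) \<Rightarrow> state set" where
  "admissible e = {U. \<exists>P. is_primitive e U P}"

text \<open>The primitive quantities below are meaningful on \<^const>\<open>admissible\<close> only, where they are
  unique.\<close>

definition primitive :: "(real \<Rightarrow> real \<Rightarrow> real) \<Rightarrow> state \<Rightarrow> real \<times> (real^3) \<times> real" where
  "primitive e U = (THE P. is_primitive e U P)"

definition rho :: "(real \<Rightarrow> real \<Rightarrow> real) \<Rightarrow> state \<Rightarrow> real" where
  "rho e U = fst (primitive e U)"

definition vel :: "(real \<Rightarrow> real \<Rightarrow> real) \<Rightarrow> state \<Rightarrow> real^3" where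
  "vel e U = fst (snd (primitive e U))"

definition pres :: "(real \<Rightarrow> real \<Rightarrow> real) \<Rightarrow> state \<Rightarrow> real" where
  "pres e U = snd (snd (primitive e U))"

definition rhoh :: "(real \<Rightarrow> real \<Rightarrow> real) \<Rightarrow> state \<Rightarrow> real" where
  "rhoh e U = rho e U * enthalpy e (pres e U) (rho e U)"

definition flux :: "(real \<Rightarrow> real \<Rightarrow> real) \<Rightarrow> 3 \<Rightarrow> state \<Rightarrow> state" where
  "flux e i U =
    (let v = vel e U; B = mag U; W = lorentz v in
     (dens U * v $ i,
      v $ i *\<^sub>R mom U - B $ i *\<^sub>R ((1 / W\<^sup>2) *\<^sub>R B + (v \<bullet> B) *\<^sub>R v) + ptot v B (pres e U) *\<^sub>R axis i 1,
      v $ i *\<^sub>R B - B $ i *\<^sub>R v,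
      mom U $ i))"

definition source :: "(real \<Rightarrow> real \<Rightarrow> real) \<Rightarrow> state \<Rightarrow> state" where
  "source e U =
    (let v = vel e U; B = mag U in
     (0, (1 - (norm v)\<^sup>2) *\<^sub>R B + (v \<bullet> B) *\<^sub>R v, v, v \<bullet> B))"


section \<open>Polynomials and quadrature\<close>

definition poly2 :: "nat \<Rightarrow> (real \<times> real \<Rightarrow> 'a::real_vector) \<Rightarrow> bool" where
  "poly2 k f \<longleftrightarrow> (\<exists>c. \<forall>x y. f (x, y) = (\<Sum>a\<le>k. \<Sum>b\<le>k - a. (x ^ a * y ^ b) *\<^sub>R c a b))"

text \<open>The \<open>Q\<close>-point Gauss rule on \<open>[-1,1]\<close>, with weights normalized to sum \<open>1\<close>.\<close>

definition gauss_rule :: "nat \<Rightarrow> (nat \<Rightarrow> real) \<Rightarrow> (nat \<Rightarrow> real) \<Rightarrow> bool" where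
  "gauss_rule Q \<xi> \<omega> \<longleftrightarrow>
     inj_on \<xi> {1..Q} \<and> \<xi> ` {1..Q} \<subseteq> {-1..1} \<and>
     (\<forall>n < 2 * Q. integral {-1..1} (\<lambda>t::real. t ^ n) / 2 = (\<Sum>\<mu>=1..Q. \<omega> \<mu> * \<xi> \<mu> ^ n))"

definition feasible_cad ::
  "nat \<Rightarrow> nat \<Rightarrow> (nat \<Rightarrow> real) \<Rightarrow> (nat \<Rightarrow> real) \<Rightarrow> real \<Rightarrow> real \<Rightarrow> real \<Rightarrow>
   nat \<Rightarrow> (nat \<Rightarrow> real) \<Rightarrow> (nat \<Rightarrow> real) \<Rightarrow> (nat \<Rightarrow> real) \<Rightarrow> bool" where
  "feasible_cad k Q \<xi> \<omega> lam1 lam2 \<omega>bar S \<omega>t xt yt \<longleftrightarrow>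
     lam1 \<ge> 0 \<and> lam2 \<ge> 0 \<and> lam1 + lam2 > 0 \<and> \<omega>bar > 0 \<and>
     (\<forall>s\<in>{1..S}. \<omega>t s \<ge> 0 \<and> xt s \<in> {-1..1} \<and> yt s \<in> {-1..1}) \<and>
     2 * \<omega>bar + (\<Sum>s=1..S. \<omega>t s) = 1 \<and>
     (\<forall>f :: real \<times> real \<Rightarrow> real. poly2 k f \<longrightarrow>
        integral ({-1..1} \<times> {-1..1}) f / 4 =
          \<omega>bar * (\<Sum>\<mu>=1..Q. \<omega> \<mu> *
            (lam1 / (lam1 + lam2) * (f (-1, \<xi> \<mu>) + f (1, \<xi> \<mu>)) +
             lam2 / (lam1 + lam2) * (f (\<xi> \<mu>, -1) + f (\<xi> \<mu>, 1))))
          + (\<Sum>s=1..S. \<omega>t s * f (xt s, yt s)))"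


section \<open>Overlapping meshes and discrete functions\<close>

text \<open>Cells are identified by their centers. The mesh has no boundary: indices range over all
  integers. The dual mesh is the primal mesh shifted by half a cell in each direction.\<close>

definition primal_centers :: "real \<Rightarrow> real \<Rightarrow> real \<Rightarrow> real \<Rightarrow> (real \<times> real) set" where
  "primal_centers x0 y0 dx dy = {(x0 + of_int i * dx, y0 + of_int j * dy) | i j. True}"

definition dual_centers :: "real \<Rightarrow> real \<Rightarrow> real \<Rightarrow> real \<Rightarrow> (real \<times> real) set" where
  "dual_centers x0 y0 dx dy = primal_centers (x0 + dx / 2) (y0 + dy / 2) dx dy"

definition rect :: "real \<Rightarrow> real \<Rightarrow> real \<times> real \<Rightarrow> (real \<times> real) set" where
  "rect dx dy = (\<lambda>(a, b). {a - dx / 2 <..< a + dx / 2} \<times> {b - dy / 2 <..< b + dy / 2})"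

definition cell_avg :: "real \<Rightarrow> real \<Rightarrow> (real \<times> real \<Rightarrow> state) \<Rightarrow> real \<times> real \<Rightarrow> state" where
  "cell_avg dx dy U z = (1 / (dx * dy)) *\<^sub>R integral (rect dx dy z) U"

definition ldf_space ::
  "nat \<Rightarrow> real \<Rightarrow> real \<Rightarrow> (real \<times> real) set \<Rightarrow> (real \<times> real \<Rightarrow> state) set" where
  "ldf_space k dx dy centers = {U. \<forall>z\<in>centers.
     (\<exists>P. poly2 k P \<and> (\<forall>w\<in>rect dx dy z. U w = P w)) \<and>
     (\<forall>(x, y)\<in>rect dx dy z.
        deriv (\<lambda>s. mag (U (s, y)) $ 1) x + deriv (\<lambda>s. mag (U (x, s)) $ 2) y = 0)}"

text \<open>One-sided values across a vertical (\<open>x\<close>) and a horizontal (\<open>y\<close>) line.\<close>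

definition xplus :: "(real \<times> real \<Rightarrow> 'a::t2_space) \<Rightarrow> real \<Rightarrow> real \<Rightarrow> 'a" where
  "xplus g x y = Lim (at_right x) (\<lambda>s. g (s, y))"

definition xminus :: "(real \<times> real \<Rightarrow> 'a::t2_space) \<Rightarrow> real \<Rightarrow> real \<Rightarrow> 'a" where
  "xminus g x y = Lim (at_left x) (\<lambda>s. g (s, y))"

definition yplus :: "(real \<times> real \<Rightarrow> 'a::t2_space) \<Rightarrow> real \<Rightarrow> real \<Rightarrow> 'a" where
  "yplus g x y = Lim (at_right y) (\<lambda>s. g (x, s))"

definition yminus :: "(real \<times> real \<Rightarrow> 'a::t2_space) \<Rightarrow> real \<Rightarrow> real \<Rightarrow> 'a" where
  "yminus g x y = Lim (at_left y) (\<lambda>s. g (x, s))"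

definition xjump :: "(real \<times> real \<Rightarrow> 'a::real_normed_vector) \<Rightarrow> real \<Rightarrow> real \<Rightarrow> 'a" where
  "xjump g x y = xplus g x y - xminus g x y"

definition yjump :: "(real \<times> real \<Rightarrow> 'a::real_normed_vector) \<Rightarrow> real \<Rightarrow> real \<Rightarrow> 'a" where
  "yjump g x y = yplus g x y - yminus g x y"

definition xmean :: "(real \<times> real \<Rightarrow> 'a::real_normed_vector) \<Rightarrow> real \<Rightarrow> real \<Rightarrow> 'a" where
  "xmean g x y = (1 / 2) *\<^sub>R (xplus g x y + xminus g x y)"

definition ymean :: "(real \<times> real \<Rightarrow> 'a::real_normed_vector) \<Rightarrow> real \<Rightarrow> real \<Rightarrow> 'a" where
  "ymean g x y = (1 / 2) *\<^sub>R (yplus g x y + yminus g x y)"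

text \<open>The \<open>\<mu>\<close>-th Gauss node of the quarter-cell side of length \<open>d / 2\<close> centered at \<open>c + m * d / 4\<close>
  (\<open>m\<close> is \<open>1\<close> or \<open>-1\<close>).\<close>

definition qnode :: "(nat \<Rightarrow> real) \<Rightarrow> real \<Rightarrow> real \<Rightarrow> real \<Rightarrow> nat \<Rightarrow> real" where
  "qnode \<xi> d c m \<mu> = c + m * d / 4 + d / 4 * \<xi> \<mu>"

text \<open>The nodes of the cell average decomposition on the quarter cell with center \<open>q\<close>.\<close>

definition quarter_nodes ::
  "nat \<Rightarrow> (nat \<Rightarrow> real) \<Rightarrow> nat \<Rightarrow> (nat \<Rightarrow> real) \<Rightarrow> (nat \<Rightarrow> real) \<Rightarrow> real \<Rightarrow> real \<Rightarrow>
   real \<times> real \<Rightarrow> (real \<times> real) set" where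
  "quarter_nodes Q \<xi> S xt yt dx dy = (\<lambda>(a, b).
     {(a + n * dx / 4, b + dy / 4 * \<xi> \<mu>) | n \<mu>. n \<in> {-1, 1} \<and> \<mu> \<in> {1..Q}} \<union>
     {(a + dx / 4 * \<xi> \<mu>, b + n * dy / 4) | n \<mu>. n \<in> {-1, 1} \<and> \<mu> \<in> {1..Q}} \<union>
     {(a + xt s * dx / 4, b + yt s * dy / 4) | s. s \<in> {1..S}})"

text \<open>All point values of \<open>U\<close> at the nodes in the cell with center \<open>(a, b)\<close>, taken as limits from
  inside the quarter cell to which the node belongs, lie in \<open>G\<close>.\<close>

definition node_values_in ::
  "nat \<Rightarrow> (nat \<Rightarrow> real) \<Rightarrow> nat \<Rightarrow> (nat \<Rightarrow> real) \<Rightarrow> (nat \<Rightarrow> real) \<Rightarrow> real \<Rightarrow> real \<Rightarrow>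
   state set \<Rightarrow> (real \<times> real \<Rightarrow> state) \<Rightarrow> real \<times> real \<Rightarrow> bool" where
  "node_values_in Q \<xi> S xt yt dx dy G U = (\<lambda>(a, b).
     \<forall>m\<in>{-1, 1}. \<forall>\<sigma>\<in>{-1, 1}.
       let q = (a + m * dx / 4, b + \<sigma> * dy / 4) in
       \<forall>z\<in>quarter_nodes Q \<xi> S xt yt dx dy q. Lim (at z within rect (dx / 2) (dy / 2) q) U \<in> G)"


section \<open>The central discontinuous Galerkin cell-average operators\<close>

text \<open>In the following, \<open>U\<close> lives on the mesh of the cell under consideration, \<open>V\<close> on the other
  mesh, and \<open>(a, b)\<close> is the center of the cell. The primal operator is obtained with
  \<open>U\<close> primal and \<open>V\<close> dual at the primal centers, the dual one by exchanging the two meshes.\<close>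

definition H_op ::
  "(real \<Rightarrow> real \<Rightarrow> real) \<Rightarrow> nat \<Rightarrow> (nat \<Rightarrow> real) \<Rightarrow> (nat \<Rightarrow> real) \<Rightarrow> real \<Rightarrow> real \<Rightarrow> real \<Rightarrow>
   (real \<times> real \<Rightarrow> state) \<Rightarrow> (real \<times> real \<Rightarrow> state) \<Rightarrow> real \<times> real \<Rightarrow> state" where
  "H_op e Q \<xi> \<omega> dx dy \<tau> U V = (\<lambda>(a, b).
     (1 / \<tau>) *\<^sub>R (cell_avg dx dy V (a, b) - cell_avg dx dy U (a, b))
     - (1 / dx) *\<^sub>R (\<Sum>m\<in>{-1, 1}. \<Sum>\<mu>=1..Q. (\<omega> \<mu> / 2) *\<^sub>R
         (flux e 1 (V (a + dx / 2, qnode \<xi> dy b m \<mu>)) - flux e 1 (V (a - dx / 2, qnode \<xi> dy b m \<mu>))))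
     - (1 / dy) *\<^sub>R (\<Sum>m\<in>{-1, 1}. \<Sum>\<mu>=1..Q. (\<omega> \<mu> / 2) *\<^sub>R
         (flux e 2 (V (qnode \<xi> dx a m \<mu>, b + dy / 2)) - flux e 2 (V (qnode \<xi> dx a m \<mu>, b - dy / 2)))))"

definition S_op ::
  "(real \<Rightarrow> real \<Rightarrow> real) \<Rightarrow> nat \<Rightarrow> (nat \<Rightarrow> real) \<Rightarrow> (nat \<Rightarrow> real) \<Rightarrow> real \<Rightarrow> real \<Rightarrow>
   (real \<times> real \<Rightarrow> state) \<Rightarrow> real \<times> real \<Rightarrow> state" where
  "S_op e Q \<xi> \<omega> dx dy V = (\<lambda>(a, b).
     - ((1 / dx) *\<^sub>R (\<Sum>m\<in>{-1, 1}. \<Sum>\<mu>=1..Q.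
          (\<omega> \<mu> / 2 * xjump (\<lambda>z. mag (V z) $ 1) a (qnode \<xi> dy b m \<mu>)) *\<^sub>R
          source e (xmean V a (qnode \<xi> dy b m \<mu>))))
     - (1 / dy) *\<^sub>R (\<Sum>m\<in>{-1, 1}. \<Sum>\<mu>=1..Q.
          (\<omega> \<mu> / 2 * yjump (\<lambda>z. mag (V z) $ 2) (qnode \<xi> dx a m \<mu>) b) *\<^sub>R
          source e (ymean V (qnode \<xi> dx a m \<mu>) b)))"

definition L_op ::
  "(real \<Rightarrow> real \<Rightarrow> real) \<Rightarrow> nat \<Rightarrow> (nat \<Rightarrow> real) \<Rightarrow> (nat \<Rightarrow> real) \<Rightarrow> real \<Rightarrow> real \<Rightarrow> real \<Rightarrow>
   (real \<times> real \<Rightarrow> state) \<Rightarrow> (real \<times> real \<Rightarrow> state) \<Rightarrow> real \<times> real \<Rightarrow> state" where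
  "L_op e Q \<xi> \<omega> dx dy \<tau> U V z = H_op e Q \<xi> \<omega> dx dy \<tau> U V z + S_op e Q \<xi> \<omega> dx dy V z"

text \<open>The quantities whose maximum is \<open>\<beta>\<^sub>1\<close> (resp. \<open>\<beta>\<^sub>2\<close>). The one-sided values of \<open>\<rho>h\<close> are those of
  the one-sided limit states.\<close>

definition xratio :: "(real \<Rightarrow> real \<Rightarrow> real) \<Rightarrow> (real \<times> real \<Rightarrow> state) \<Rightarrow> real \<Rightarrow> real \<Rightarrow> real" where
  "xratio e V x y = \<bar>xjump (\<lambda>z. mag (V z) $ 1) x y\<bar> /
     (2 * sqrt ((rhoh e (xplus V x y) + rhoh e (xminus V x y)) / 2))"

definition yratio :: "(real \<Rightarrow> real \<Rightarrow> real) \<Rightarrow> (real \<times> real \<Rightarrow> state) \<Rightarrow> real \<Rightarrow> real \<Rightarrow> real" where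
  "yratio e V x y = \<bar>yjump (\<lambda>z. mag (V z) $ 2) x y\<bar> /
     (2 * sqrt ((rhoh e (yplus V x y) + rhoh e (yminus V x y)) / 2))"

definition ratios1 ::
  "(real \<Rightarrow> real \<Rightarrow> real) \<Rightarrow> nat \<Rightarrow> (nat \<Rightarrow> real) \<Rightarrow> real \<Rightarrow> (real \<times> real \<Rightarrow> state) \<Rightarrow>
   (real \<times> real) set \<Rightarrow> real set" where
  "ratios1 e Q \<xi> dy V centers =
     {xratio e V a (qnode \<xi> dy b m \<mu>) | a b m \<mu>. (a, b) \<in> centers \<and> m \<in> {-1, 1} \<and> \<mu> \<in> {1..Q}}"

definition ratios2 ::
  "(real \<Rightarrow> real \<Rightarrow> real) \<Rightarrow> nat \<Rightarrow> (nat \<Rightarrow> real) \<Rightarrow> real \<Rightarrow> (real \<times> real \<Rightarrow> state) \<Rightarrow>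
   (real \<times> real) set \<Rightarrow> real set" where
  "ratios2 e Q \<xi> dx V centers =
     {yratio e V (qnode \<xi> dx a m \<mu>) b | a b m \<mu>. (a, b) \<in> centers \<and> m \<in> {-1, 1} \<and> \<mu> \<in> {1..Q}}"

text \<open>On the unbounded mesh a maximum of infinitely many quantities is rendered as a supremum of a
  bounded set; it is the maximum whenever that is attained.\<close>

definition is_sup :: "real set \<Rightarrow> real \<Rightarrow> bool" where
  "is_sup A b \<longleftrightarrow> bdd_above A \<and> b = Sup A"

end

theory Submission
  imports Defs "HOL-Computational_Algebra.Polynomial"
begin

text \<open>The idea is geometric quasilinearization: \<open>admissible e\<close> is cut out by \<open>D > 0\<close> and the
  inequalities \<open>gq u C U + pmag u C > 0\<close> with \<open>\<bar>u\<bar> < 1\<close> and arbitrary \<open>C\<close>, whose left-hand sides are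
  affine in the state \<open>U\<close>. Such a left-hand side is the sum of a fluid part and of the energy of the
  field \<open>B - C\<close>, both positive; conversely, the inequalities with \<open>C = B\<close> allow one to solve for the
  primitive variables by the intermediate value theorem in \<open>\<rho>hW\<^sup>2\<close>.

  Evaluated at the updated cell average, such a functional is estimated node by node. On the boundary
  of the cell the flux is controlled because signals are not faster than light. On the center lines
  the source is controlled with constant \<open>\<rho>hW\<^sup>2\<close> of the mean state, and this exceeds the smaller of the
  averaged \<open>\<rho>h\<close> and of a quarter of the squared jump of the normal magnetic field. What remains is a
  multiple of the discrete divergence of \<open>B\<close> over the quarter cells, which vanishes. The cell average
  decomposition and the CFL condition provide the nodal values needed to absorb the rest.\<close>

section \<open>Quasilinear functionals\<close>

text \<open>\<open>pmag u B\<close> is the maximum over \<open>C\<close> of a term linear in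
  \<open>B\<close> minus \<open>pmag u C\<close>, attained at \<open>C = B\<close>. Fixing
  \<open>C\<close> independently of the state replaces this quadratic by its tangents; this is why
  the family of inequalities is affine, as averages and quadrature require. The obstacle is the term
  \<open>B $ i * (u \<bullet> C)\<close> in the flux of such a functional: it has no sign and need
  not cancel between opposite sides of a cell. The field entering the fluxes is divergence-free only
  on each of the four cells of the other mesh that overlap the given one. Closing the boundaries of
  the four quarters takes the center lines, and the source supplies exactly the jumps there. In
  exchange, the source is taken at a mean state, whose \<open>\<rho>hW\<^sup>2\<close> is bounded
  below by half the averaged \<open>\<rho>h\<close> plus an eighth of the squared jump. This is the
  mean of two bounds for one quantity, the first coming from the ratio in the wave speed, the second
  from \<open>1 \<le> \<alpha>\<close>. So \<open>1\<close> acts in \<open>\<alpha>\<close> both as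
  the speed of light and here. \<open>cold_limit\<close> starts the intermediate value argument: the
  enthalpy must tend to \<open>1\<close> where the pressure vanishes.\<close>

lemma enthalpy_core:
  fixes \<epsilon> \<rho> p x y :: real
  assumes "sqrt (\<rho>\<^sup>2 + p\<^sup>2) \<le> \<epsilon>"
  shows "2 * \<rho> * x * y + p * (x\<^sup>2 - y\<^sup>2) \<le> \<epsilon> * (x\<^sup>2 + y\<^sup>2)"
proof -
  have "2 * \<rho> * x * y + p * (x\<^sup>2 - y\<^sup>2) = (\<rho>, p) \<bullet> (2 * x * y, x\<^sup>2 - y\<^sup>2)"
    by simp
  also have "\<dots> \<le> norm (\<rho>, p) * norm (2 * x * y, x\<^sup>2 - y\<^sup>2)"
    by (rule norm_cauchy_schwarz)
  also have "norm (2 * x * y, x\<^sup>2 - y\<^sup>2) = x\<^sup>2 + y\<^sup>2"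
  proof -
    have "(2 * x * y)\<^sup>2 + (x\<^sup>2 - y\<^sup>2)\<^sup>2 = (x\<^sup>2 + y\<^sup>2)\<^sup>2"
      by algebra
    then show ?thesis
      by (simp add: norm_prod_def)
  qed
  also have "norm (\<rho>, p) = sqrt (\<rho>\<^sup>2 + p\<^sup>2)"
    by (simp add: norm_prod_def)
  also have "sqrt (\<rho>\<^sup>2 + p\<^sup>2) * (x\<^sup>2 + y\<^sup>2) \<le> \<epsilon> * (x\<^sup>2 + y\<^sup>2)"
    using assms by (intro mult_right_mono) auto
  finally show ?thesis .
qed

lemma norm_diff_power2:
  fixes x y :: "'a::real_inner"
  shows "(norm (x - y))\<^sup>2 = (norm x)\<^sup>2 + (norm y)\<^sup>2 - 2 * (x \<bullet> y)"
  unfolding power2_norm_eq_inner by (simp add: inner_diff inner_commute del: dot_square_norm)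

lemma norm_add_power2:
  fixes x y :: "'a::real_inner"
  shows "(norm (x + y))\<^sup>2 = (norm x)\<^sup>2 + (norm y)\<^sup>2 + 2 * (x \<bullet> y)"
  unfolding power2_norm_eq_inner by (simp add: inner_add inner_commute del: dot_square_norm)

text \<open>The vector multiplying \<open>B\<close> is the momentum part of the source with velocity
  \<open>u\<close> and field \<open>C\<close>. The constant \<open>pmag u C\<close>, the magnetic
  pressure of \<open>(u, C)\<close>, is kept out so that \<open>gq u C\<close> is linear and
  commutes with sums and integrals.\<close>

definition gq :: "real^3 \<Rightarrow> real^3 \<Rightarrow> state \<Rightarrow> real" where
  "gq u C = (\<lambda>(D, m, B, E).
     E - m \<bullet> u - B \<bullet> ((1 - (norm u)\<^sup>2) *\<^sub>R C + (u \<bullet> C) *\<^sub>R u) - D * sqrt (1 - (norm u)\<^sup>2))"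

definition pmag :: "real^3 \<Rightarrow> real^3 \<Rightarrow> real" where
  "pmag u C = ((1 - (norm u)\<^sup>2) * (norm C)\<^sup>2 + (u \<bullet> C)\<^sup>2) / 2"

text \<open>Here \<open>z\<close> stands for \<open>\<rho>hW\<^sup>2\<close>, so that no equation of state is involved.\<close>

definition mhd :: "real \<Rightarrow> real \<Rightarrow> real \<Rightarrow> real^3 \<Rightarrow> real^3 \<Rightarrow> state" where
  "mhd D z p v B =
     (D, z *\<^sub>R v + (norm B)\<^sup>2 *\<^sub>R v - (v \<bullet> B) *\<^sub>R B, B, z - ptot v B p + (norm B)\<^sup>2)"

text \<open>The product with \<open>B\<close> in \<open>gq\<close> is the cross term of
  \<open>pmag u (B - C)\<close>, so completing the square in \<open>C\<close> leaves a rest free of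
  \<open>C\<close>. The last summand is half the squared area spanned by \<open>v - u\<close> and
  \<open>B\<close>.\<close>

lemma gq_mhd:
  "gq u C (mhd D z p v B) + pmag u C =
     (z * (1 - v \<bullet> u) - p - D * sqrt (1 - (norm u)\<^sup>2))
     + pmag u (B - C)
     + ((norm (v - u))\<^sup>2 * (norm B)\<^sup>2 - ((v - u) \<bullet> B)\<^sup>2) / 2"
  unfolding gq_def mhd_def pmag_def ptot_def
  by (simp add: norm_diff_power2 inner_diff inner_add inner_commute dot_square_norm)
    (simp add: power2_eq_square field_simps)

definition source_prim :: "real^3 \<Rightarrow> real^3 \<Rightarrow> state" where
  "source_prim v B = (0, (1 - (norm v)\<^sup>2) *\<^sub>R B + (v \<bullet> B) *\<^sub>R v, v, v \<bullet> B)"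

text \<open>Completing squares in \<open>\<sigma>\<close> moves the source into shifts of the two
  field terms. The only loss is \<open>\<sigma>\<^sup>2 * (norm (v - u))\<^sup>2 / 2\<close>, which
  \<open>hydro_strict\<close> absorbs as soon as \<open>\<sigma>\<^sup>2 < z\<close>. The added
  \<open>u \<bullet> C\<close> comes from the cross term of \<open>C\<close> with
  \<open>- \<sigma> *\<^sub>R u\<close>.\<close>

lemma gq_source:
  "gq u C (mhd D z p v B) + pmag u C + \<sigma> * (gq u C (source_prim v B) + u \<bullet> C) =
     (z * (1 - v \<bullet> u) - p - D * sqrt (1 - (norm u)\<^sup>2) - \<sigma>\<^sup>2 * (norm (v - u))\<^sup>2 / 2)
     + pmag u (B - C + \<sigma> *\<^sub>R (v - u))
     + ((norm (v - u))\<^sup>2 * (norm (B + \<sigma> *\<^sub>R u))\<^sup>2 - ((v - u) \<bullet> (B + \<sigma> *\<^sub>R u))\<^sup>2) / 2"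
  unfolding gq_def source_prim_def mhd_def pmag_def ptot_def
  by (simp add: norm_diff_power2 norm_add_power2 inner_diff inner_add inner_commute dot_square_norm power_mult_distrib)
    (simp add: power2_eq_square field_simps)

section \<open>Signs of the fluid and field terms\<close>

lemma pmag_nonneg: "norm u < 1 \<Longrightarrow> 0 \<le> pmag u C"
  unfolding pmag_def by (simp add: power_le_one abs_square_le_1)

lemma norm_lt_1_pos:
  fixes u :: "'a::real_normed_vector"
  shows "norm u < 1 \<Longrightarrow> 0 < 1 - (norm u)\<^sup>2"
  by (simp add: power_less_one_iff abs_square_less_1)

lemma gram_nonneg:
  fixes x y :: "'a::real_inner"
  shows "0 \<le> ((norm x)\<^sup>2 * (norm y)\<^sup>2 - (x \<bullet> y)\<^sup>2) / 2"
  using Cauchy_Schwarz_ineq[of x y] by (simp add: power2_norm_eq_inner)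

text \<open>Here \<open>r\<close> is \<open>\<rho>h\<close>, and \<open>r - p\<close> is the energy
  density at rest. Twice the difference of the two sides is the expression of
  \<open>enthalpy_core\<close> with \<open>x = 1\<close> and \<open>y = s\<close>, the quotient of
  the Lorentz factors of \<open>v\<close> and \<open>u\<close>. The constant \<open>z\<close>
  decides how strong a source can be absorbed.\<close>

lemma hydro_lower:
  fixes u v :: "'a::real_inner"
  assumes r: "sqrt (\<rho>\<^sup>2 + p\<^sup>2) \<le> r - p" and v: "norm v < 1" and u: "norm u < 1"
    and z: "z = r / (1 - (norm v)\<^sup>2)" and D: "D = \<rho> / sqrt (1 - (norm v)\<^sup>2)"
  shows "z * (norm (v - u))\<^sup>2 / 2 \<le> z * (1 - v \<bullet> u) - p - D * sqrt (1 - (norm u)\<^sup>2)"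
proof -
  define a where "a = 1 - (norm v)\<^sup>2"
  define s where "s = sqrt (1 - (norm u)\<^sup>2) / sqrt a"
  have a: "a > 0" using norm_lt_1_pos[OF v] by (simp add: a_def)
  have s2: "s\<^sup>2 = (1 - (norm u)\<^sup>2) / a"
    using a norm_lt_1_pos[OF u] by (simp add: s_def power_divide)
  have "2 * (z * (1 - v \<bullet> u) - p - D * sqrt (1 - (norm u)\<^sup>2)) - z * (norm (v - u))\<^sup>2
      = (r - p) * (1\<^sup>2 + s\<^sup>2) - (2 * \<rho> * s * 1 + p * (1\<^sup>2 - s\<^sup>2))"
  proof -
    have *: "D * sqrt (1 - (norm u)\<^sup>2) = \<rho> * s"
      by (simp add: D s_def a_def)
    have "(norm (v - u))\<^sup>2 = (1 - a) + (norm u)\<^sup>2 - 2 * (v \<bullet> u)"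
      by (simp add: norm_diff_power2 a_def)
    then have "2 * z * (1 - v \<bullet> u) - z * (norm (v - u))\<^sup>2 = z * a + z * (1 - (norm u)\<^sup>2)"
      by algebra
    also have "\<dots> = r * (1 + s\<^sup>2)"
      using a by (simp add: z s2 a_def[symmetric] field_simps)
    finally show ?thesis unfolding * by (simp add: algebra_simps)
  qed
  moreover have "2 * \<rho> * 1 * s + p * (1\<^sup>2 - s\<^sup>2) \<le> (r - p) * (1\<^sup>2 + s\<^sup>2)"
    by (rule enthalpy_core[OF r])
  ultimately show ?thesis by (simp add: algebra_simps)
qed

text \<open>At \<open>v = u\<close> the quadratic term vanishes and \<open>k < z\<close> gains
  nothing; there strictness comes from \<open>0 < p\<close>, which makes \<open>r - p\<close> exceed
  \<open>\<rho>\<close>.\<close>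

lemma hydro_strict:
  fixes u v :: "'a::real_inner"
  assumes rho: "0 < \<rho>" and p: "0 < p" and r: "sqrt (\<rho>\<^sup>2 + p\<^sup>2) \<le> r - p" and v: "norm v < 1" and u: "norm u < 1"
    and z: "z = r / (1 - (norm v)\<^sup>2)" and D: "D = \<rho> / sqrt (1 - (norm v)\<^sup>2)"
    and k: "k < z"
  shows "k * (norm (v - u))\<^sup>2 / 2 < z * (1 - v \<bullet> u) - p - D * sqrt (1 - (norm u)\<^sup>2)"
proof (cases "v = u")
  case True
  have a: "0 < 1 - (norm v)\<^sup>2" using norm_lt_1_pos[OF v] .
  have "sqrt (\<rho>\<^sup>2) < sqrt (\<rho>\<^sup>2 + p\<^sup>2)" using p by (intro real_sqrt_less_mono) auto
  then have "\<rho> < r - p" using r rho by simp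
  moreover have "z * (1 - u \<bullet> u) = r"
    using a unfolding z True power2_norm_eq_inner by simp
  moreover have "D * sqrt (1 - (norm u)\<^sup>2) = \<rho>"
    using a unfolding D True by simp
  ultimately show ?thesis using True by simp
next
  case False
  then have "k * (norm (v - u))\<^sup>2 / 2 < z * (norm (v - u))\<^sup>2 / 2" using k by simp
  also note hydro_lower[OF r v u z D]
  finally show ?thesis .
qed

text \<open>It follows from nonnegativity of \<open>(norm (v - u))\<^sup>2 + (norm v)\<^sup>2 * (1 -
  (norm u)\<^sup>2)\<close>, with \<open>p\<close> absorbed by half of \<open>r\<close>. The
  rest-mass term is left out because \<open>mean_state_enthalpy\<close> adds it back on both sides,
  where it averages linearly.\<close>

lemma hydro_mean:
  fixes u v :: "'a::real_inner"
  assumes p: "0 < p" and r: "2 * p \<le> r" and v: "norm v < 1" and u: "norm u < 1"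
    and z: "z = r / (1 - (norm v)\<^sup>2)"
  shows "(1 - (norm u)\<^sup>2) * r / 2 \<le> z * (1 - v \<bullet> u) - p"
proof -
  define a where "a = 1 - (norm v)\<^sup>2"
  have a: "a > 0" using norm_lt_1_pos[OF v] by (simp add: a_def)
  have "0 \<le> r * ((norm (v - u))\<^sup>2 + (1 - a) * (1 - (norm u)\<^sup>2))"
    using r p norm_lt_1_pos[OF u] by (intro mult_nonneg_nonneg add_nonneg_nonneg) (auto simp: a_def)
  also have "(norm (v - u))\<^sup>2 = (1 - a) + (norm u)\<^sup>2 - 2 * (v \<bullet> u)"
    by (simp add: norm_diff_power2 a_def)
  finally have "r * a + (1 - (norm u)\<^sup>2) * r * a \<le> 2 * r * (1 - v \<bullet> u)"
    by (simp add: algebra_simps)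
  then have "r + (1 - (norm u)\<^sup>2) * r \<le> 2 * (z * (1 - v \<bullet> u))"
    using a by (simp add: z a_def[symmetric] field_simps)
  then show ?thesis using r by (simp add: field_simps)
qed

text \<open>Component \<open>i\<close> of \<open>k *\<^sub>R u - l *\<^sub>R v\<close> is
  \<open>u $ i - v $ i\<close>, and \<open>k - l\<close> is \<open>- s\<close> times this number. So
  \<open>\<bar>s\<bar> \<le> 1\<close>, a signal speed not below that of light, gives
  \<open>\<bar>k - l\<bar> \<le> norm (k *\<^sub>R u - l *\<^sub>R v)\<close>. Squared, this is
  \<open>k\<^sup>2 * b + l\<^sup>2 * a \<le> 2 * k * l * (1 - v \<bullet> u)\<close>.\<close>

lemma hydro_flux:
  fixes u v :: "real^'n"
  assumes rho: "0 < \<rho>" and p: "0 < p" and r: "sqrt (\<rho>\<^sup>2 + p\<^sup>2) \<le> r - p" and v: "norm v < 1" and u: "norm u < 1"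
    and z: "z = r / (1 - (norm v)\<^sup>2)" and D: "D = \<rho> / sqrt (1 - (norm v)\<^sup>2)"
    and s: "\<bar>s\<bar> \<le> 1"
  shows "0 \<le> (1 + s * v $ i) * (z * (1 - v \<bullet> u) - D * sqrt (1 - (norm u)\<^sup>2)) - p * (1 + s * u $ i)"
proof -
  define a where "a = 1 - (norm v)\<^sup>2"
  define b where "b = 1 - (norm u)\<^sup>2"
  define k where "k = 1 + s * v $ i"
  define l where "l = 1 + s * u $ i"
  \<comment> \<open>Chosen so that \<open>z * k\<^sup>2 * b = r * X\<^sup>2\<close> and
    \<open>k * D * sqrt b = \<rho> * X\<close>, which leads to \<open>enthalpy_core\<close> with
    \<open>x = l\<close> and \<open>y = X\<close>.\<close>
  define X where "X = k * sqrt b / sqrt a"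
  have a: "a > 0" using norm_lt_1_pos[OF v] by (simp add: a_def)
  have b: "b > 0" using norm_lt_1_pos[OF u] by (simp add: b_def)
  have "\<bar>s * u $ i\<bar> \<le> \<bar>u $ i\<bar>"
    using s by (simp add: abs_mult mult_left_le_one_le)
  then have l: "l > 0"
    using component_le_norm_cart[of u i] u by (auto simp: l_def)
  have r0: "r > 0" using r p order_trans[OF real_sqrt_ge_zero r] by simp
  have "(k - l)\<^sup>2 \<le> ((k *\<^sub>R u - l *\<^sub>R v) $ i)\<^sup>2"
  proof -
    have "(k - l)\<^sup>2 = s\<^sup>2 * (u $ i - v $ i)\<^sup>2"
      by (simp add: k_def l_def power2_eq_square algebra_simps)
    also have "\<dots> \<le> (u $ i - v $ i)\<^sup>2"
      using s by (intro mult_left_le_one_le) (auto simp: abs_square_le_1)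
    also have "u $ i - v $ i = (k *\<^sub>R u - l *\<^sub>R v) $ i"
      by (simp add: k_def l_def algebra_simps)
    finally show ?thesis .
  qed
  also have "\<dots> \<le> (norm (k *\<^sub>R u - l *\<^sub>R v))\<^sup>2"
    using component_le_norm_cart[of "k *\<^sub>R u - l *\<^sub>R v" i] by (metis abs_norm_cancel abs_le_square_iff)
  also have "\<dots> = k\<^sup>2 * (1 - b) + l\<^sup>2 * (1 - a) - 2 * k * l * (v \<bullet> u)"
    by (simp add: norm_diff_power2 a_def b_def power_mult_distrib inner_commute)
  finally have "k\<^sup>2 * b + l\<^sup>2 * a \<le> 2 * k * l * (1 - v \<bullet> u)"
    by (simp add: power2_eq_square algebra_simps)
  then have "z * (k\<^sup>2 * b + l\<^sup>2 * a) \<le> z * (2 * k * l * (1 - v \<bullet> u))"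
    using a r0 by (intro mult_left_mono) (auto simp: z a_def[symmetric])
  moreover have "z * (k\<^sup>2 * b + l\<^sup>2 * a) = r * (X\<^sup>2 + l\<^sup>2)"
    using a b by (simp add: z a_def[symmetric] X_def power_divide power_mult_distrib field_simps)
  moreover have "k * D * sqrt b = \<rho> * X"
    by (simp add: D a_def[symmetric] X_def)
  ultimately have "(r - p) * (l\<^sup>2 + X\<^sup>2) - (2 * \<rho> * l * X + p * (l\<^sup>2 - X\<^sup>2))
      \<le> 2 * l * (k * (z * (1 - v \<bullet> u) - D * sqrt b) - p * l)"
    by (simp add: algebra_simps power2_eq_square)
  with enthalpy_core[OF r, of l X]
  have "0 \<le> 2 * l * (k * (z * (1 - v \<bullet> u) - D * sqrt b) - p * l)" by linarith
  then show ?thesis using l unfolding k_def l_def b_def by (simp add: zero_le_mult_iff)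
qed

section \<open>Dominant energy of the field\<close>

text \<open>Dominant energy condition: the stress-energy tensor of the electric field
  \<open>e\<close> and the magnetic field \<open>d\<close>, contracted with a null covector along
  the first axis and with \<open>(1, -u)\<close>. Multiplied by \<open>2 * (1 - u1)\<close> it is an
  explicit sum of nonnegative terms.\<close>

lemma em_dominant:
  fixes e1 e2 e3 d1 d2 d3 u1 u2 u3 :: real
  assumes "u1\<^sup>2 + u2\<^sup>2 + u3\<^sup>2 \<le> 1" and "u1 < 1"
  shows "0 \<le> (e1\<^sup>2 + e2\<^sup>2 + e3\<^sup>2 + d1\<^sup>2 + d2\<^sup>2 + d3\<^sup>2) / 2 * (1 - u1) + (e2 * d3 - e3 * d2)
     - (u1 * (e2 * d3 - e3 * d2) + u2 * (e3 * d1 - e1 * d3) + u3 * (e1 * d2 - e2 * d1))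
     + (e1 * (u1 * e1 + u2 * e2 + u3 * e3) + d1 * (u1 * d1 + u2 * d2 + u3 * d3))" (is "0 \<le> ?T")
proof -
  define P where "P = (1 - u1) * (e2 + d3) + e1 * u2 + d1 * u3"
  define R where "R = (1 - u1) * (e3 - d2) + e1 * u3 - d1 * u2"
  have "2 * (1 - u1) * ?T = P\<^sup>2 + R\<^sup>2 + (1 - (u1\<^sup>2 + u2\<^sup>2 + u3\<^sup>2)) * (e1\<^sup>2 + d1\<^sup>2)"
    unfolding P_def R_def by (simp add: power2_eq_square field_simps)
  also have "\<dots> \<ge> 0"
    using assms by (intro add_nonneg_nonneg mult_nonneg_nonneg) auto
  finally show ?thesis using assms by (simp add: zero_le_mult_iff)
qed

lemma norm3_power2: "(norm (x :: real^3))\<^sup>2 = (x $ 1)\<^sup>2 + (x $ 2)\<^sup>2 + (x $ 3)\<^sup>2"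
  by (simp add: norm_vec_def L2_set_def sum_3)

text \<open>The expression is affine in \<open>s\<close>, so the null directions
  \<open>s = 1\<close> and \<open>s = -1\<close> suffice. The axes are permuted cyclically, and
  \<open>s = -1\<close> is reached by a half-turn reversing the axis \<open>i\<close>; these are
  proper rotations and preserve the cross product.\<close>

lemma em_dominant_vec:
  fixes e d u :: "real^3"
  assumes u: "norm u < 1" and s: "\<bar>s\<bar> \<le> 1"
  shows "0 \<le> ((norm e)\<^sup>2 + (norm d)\<^sup>2) / 2 * (1 - s * u $ i) + s * cross3 e d $ i - u \<bullet> cross3 e d
     + s * (e $ i * (u \<bullet> e) + d $ i * (u \<bullet> d))" (is "0 \<le> ?F s")
proof -
  have u1: "(u$1)\<^sup>2 + (u$2)\<^sup>2 + (u$3)\<^sup>2 \<le> 1"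
    using u by (simp add: norm_vec_def L2_set_def sum_3 power_le_one)
  have c: "\<bar>u $ j\<bar> < 1" for j
    using component_le_norm_cart[of u j] u by simp
  have i: "i = 1 \<or> i = 2 \<or> i = 3" using exhaust_3 by blast
  have perm: "(u$2)\<^sup>2 + (u$3)\<^sup>2 + (u$1)\<^sup>2 \<le> 1" "(u$3)\<^sup>2 + (u$1)\<^sup>2 + (u$2)\<^sup>2 \<le> 1"
    using u1 by simp_all
  have le: "u $ j < 1" "- u $ j < 1" for j using c[of j] by auto
  note expand = norm3_power2 inner_vec_def sum_3 cross3_def
  have 1: "0 \<le> ?F 1"
  proof -
    consider "i = 1" | "i = 2" | "i = 3" using i by blast
    then show ?thesis
    proof cases
      case 1
      show ?thesis
        using em_dominant[OF u1 le(1), of "e$1" "e$2" "e$3" "d$1" "d$2" "d$3"]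
        unfolding 1 expand by (simp add: power2_eq_square field_simps)
    next
      case 2
      show ?thesis
        using em_dominant[OF perm(1) le(1), of "e$2" "e$3" "e$1" "d$2" "d$3" "d$1"]
        unfolding 2 expand by (simp add: power2_eq_square field_simps)
    next
      case 3
      show ?thesis
        using em_dominant[OF perm(2) le(1), of "e$3" "e$1" "e$2" "d$3" "d$1" "d$2"]
        unfolding 3 expand by (simp add: power2_eq_square field_simps)
    qed
  qed
  have m1: "(- u$1)\<^sup>2 + (- u$2)\<^sup>2 + (u$3)\<^sup>2 \<le> 1" "(- u$2)\<^sup>2 + (- u$3)\<^sup>2 + (u$1)\<^sup>2 \<le> 1" "(- u$3)\<^sup>2 + (- u$1)\<^sup>2 + (u$2)\<^sup>2 \<le> 1"
    using u1 by simp_all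
  have 2: "0 \<le> ?F (-1)"
  proof -
    consider "i = 1" | "i = 2" | "i = 3" using i by blast
    then show ?thesis
    proof cases
      case 1
      show ?thesis
        using em_dominant[OF m1(1) le(2), of "- e$1" "- e$2" "e$3" "- d$1" "- d$2" "d$3"]
        unfolding 1 expand by (simp add: power2_eq_square field_simps)
    next
      case 2
      show ?thesis
        using em_dominant[OF m1(2) le(2), of "- e$2" "- e$3" "e$1" "- d$2" "- d$3" "d$1"]
        unfolding 2 expand by (simp add: power2_eq_square field_simps)
    next
      case 3
      show ?thesis
        using em_dominant[OF m1(3) le(2), of "- e$3" "- e$1" "e$2" "- d$3" "- d$1" "d$2"]
        unfolding 3 expand by (simp add: power2_eq_square field_simps)
    qed
  qed
  have "?F s = (1 + s) / 2 * ?F 1 + (1 - s) / 2 * ?F (-1)"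
    by (simp add: field_simps)
  moreover have "0 \<le> (1 + s) / 2 * ?F 1" "0 \<le> (1 - s) / 2 * ?F (-1)"
    using 1 2 s by (auto intro!: mult_nonneg_nonneg)
  ultimately show ?thesis by linarith
qed

section \<open>States and fluxes in terms of electromagnetic fields\<close>

definition flux_prim :: "3 \<Rightarrow> real \<Rightarrow> real \<Rightarrow> real \<Rightarrow> real^3 \<Rightarrow> real^3 \<Rightarrow> state" where
  "flux_prim i D z p v B =
     (D * v $ i,
      v $ i *\<^sub>R (z *\<^sub>R v + (norm B)\<^sup>2 *\<^sub>R v - (v \<bullet> B) *\<^sub>R B)
        - B $ i *\<^sub>R ((1 - (norm v)\<^sup>2) *\<^sub>R B + (v \<bullet> B) *\<^sub>R v) + ptot v B p *\<^sub>R axis i 1,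
      v $ i *\<^sub>R B - B $ i *\<^sub>R v,
      (z *\<^sub>R v + (norm B)\<^sup>2 *\<^sub>R v - (v \<bullet> B) *\<^sub>R B) $ i)"

text \<open>The electric field of an ideal conductor is \<open>- cross3 v B\<close>. The field terms
  are thus an electromagnetic energy minus \<open>u\<close> times a Poynting vector, formed with the
  differences between the fields of \<open>(v, B)\<close> and of \<open>(u, C)\<close>.\<close>

lemma gq_mhd_em:
  "gq u C (mhd D z p v B) + pmag u C =
     (z * (1 - v \<bullet> u) - p - D * sqrt (1 - (norm u)\<^sup>2))
     + ((norm (cross3 u C - cross3 v B))\<^sup>2 + (norm (B - C))\<^sup>2) / 2 - u \<bullet> cross3 (cross3 u C - cross3 v B) (B - C)"
  unfolding gq_mhd unfolding pmag_def
  unfolding norm3_power2 inner_vec_def sum_3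
  by (simp add: cross3_def power2_eq_square field_simps)

text \<open>With the two corrections, the field part becomes a quadratic form in the same
  differences \<open>e\<close> and \<open>d\<close> as in \<open>gq_mhd_em\<close>. The correction
  \<open>u $ i * pmag u C\<close> is equal on opposite sides of a cell;
  \<open>B $ i * (u \<bullet> C)\<close> is left to the discrete divergence.\<close>

lemma gq_flux_prim:
  fixes i :: 3 and u v B C :: "real^3"
  defines "e \<equiv> cross3 u C - cross3 v B" and "d \<equiv> B - C"
  shows "gq u C (flux_prim i D z p v B) + u $ i * pmag u C - B $ i * (u \<bullet> C) =
     v $ i * (z * (1 - v \<bullet> u) - D * sqrt (1 - (norm u)\<^sup>2)) - p * u $ i
     + cross3 e d $ i - ((norm e)\<^sup>2 + (norm d)\<^sup>2) / 2 * u $ i + e $ i * (u \<bullet> e) + d $ i * (u \<bullet> d)"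
proof -
  define q where "q = sqrt (1 - (norm u)\<^sup>2)"
  have i: "i = 1 \<or> i = 2 \<or> i = 3" using exhaust_3 by blast
  have ax: "axis i (1::real) \<bullet> u = u $ i" by (simp add: inner_axis' )
  show ?thesis
    unfolding gq_def flux_prim_def ptot_def pmag_def e_def d_def q_def[symmetric]
    apply (simp add: inner_diff_left inner_diff_right inner_add_left inner_add_right ax)
    apply (insert i)
    unfolding norm3_power2 inner_vec_def sum_3
    apply (elim disjE; simp add: cross3_def power2_eq_square)
    by (simp_all add: field_simps)
qed

section \<open>Primitive variables\<close>

lemma enthalpy_bound:
  assumes "eos e" "0 < p" "0 < \<rho>"
  shows "sqrt (\<rho>\<^sup>2 + p\<^sup>2) \<le> \<rho> * enthalpy e p \<rho> - p"
proof -
  have "enthalpy e p \<rho> \<ge> sqrt (1 + p\<^sup>2 / \<rho>\<^sup>2) + p / \<rho>"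
    using assms unfolding eos_def by blast
  then have "\<rho> * (sqrt (1 + p\<^sup>2 / \<rho>\<^sup>2) + p / \<rho>) \<le> \<rho> * enthalpy e p \<rho>"
    using assms by (intro mult_left_mono) auto
  moreover have "\<rho> * sqrt (1 + p\<^sup>2 / \<rho>\<^sup>2) = sqrt (\<rho>\<^sup>2 + p\<^sup>2)"
  proof -
    have "\<rho>\<^sup>2 + p\<^sup>2 = \<rho>\<^sup>2 * (1 + p\<^sup>2 / \<rho>\<^sup>2)"
      using assms by (simp add: field_simps)
    then show ?thesis using assms by (simp add: real_sqrt_mult)
  qed
  ultimately show ?thesis using assms by (simp add: algebra_simps)
qed

text \<open>Joint differentiability makes the partial \<open>deriv\<close> values in
  \<open>eos\<close> the coefficients of a total derivative, so that the enthalpy can be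
  differentiated along curves.\<close>

lemma enthalpy_derivative:
  assumes "eos e" "0 < p" "0 < \<rho>"
  obtains hp hr where
    "((\<lambda>(q, r). enthalpy e q r) has_derivative (\<lambda>(x, y). hp * x + hr * y)) (at (p, \<rho>))"
    "enthalpy e p \<rho> * (1 / \<rho> - hp) < hr" "hr < 0"
proof -
  have ex: "(\<lambda>(q, r). enthalpy e q r) differentiable (at (p, \<rho>))"
    and in1: "enthalpy e p \<rho> * (1 / \<rho> - deriv (\<lambda>q. enthalpy e q \<rho>) p) < deriv (\<lambda>r. enthalpy e p r) \<rho>"
    and in2: "deriv (\<lambda>r. enthalpy e p r) \<rho> < 0"
    using assms unfolding eos_def by blast+
  from ex obtain F where F: "((\<lambda>(q, r). enthalpy e q r) has_derivative F) (at (p, \<rho>))"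
    unfolding differentiable_def by blast
  interpret F: bounded_linear F using F by (rule has_derivative_bounded_linear)
  obtain hp hr where lin: "F (x, y) = hp * x + hr * y" for x y
  proof -
    have "F (x, y) = F (1, 0) * x + F (0, 1) * y" for x y
    proof -
      have "(x, y) = x *\<^sub>R (1, 0) + y *\<^sub>R (0, 1)" by simp
      then have "F (x, y) = x *\<^sub>R F (1, 0) + y *\<^sub>R F (0, 1)" by (simp only: F.add F.scaleR)
      then show ?thesis by (simp add: mult.commute)
    qed
    then show thesis by (rule that)
  qed
  have "((\<lambda>q. (\<lambda>(q, r). enthalpy e q r) (q, \<rho>)) has_derivative (\<lambda>x. F (x, 0))) (at p)"
    by (rule has_derivative_compose[OF has_derivative_Pair[OF has_derivative_ident has_derivative_const] F])
  then have "deriv (\<lambda>q. enthalpy e q \<rho>) p = hp"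
    by (intro DERIV_imp_deriv) (simp add: has_field_derivative_def lin)
  moreover have "((\<lambda>r. (\<lambda>(q, r). enthalpy e q r) (p, r)) has_derivative (\<lambda>y. F (0, y))) (at \<rho>)"
    by (rule has_derivative_compose[OF has_derivative_Pair[OF has_derivative_const has_derivative_ident] F])
  then have "deriv (\<lambda>r. enthalpy e p r) \<rho> = hr"
    by (intro DERIV_imp_deriv) (simp add: has_field_derivative_def lin)
  moreover have "F = (\<lambda>(x, y). hp * x + hr * y)"
    by (auto simp: fun_eq_iff lin)
  ultimately show thesis using that[of hp hr] F in1 in2 by simp
qed

lemma enthalpy_curve:
  assumes "eos e" "0 < P t" "0 < R t"
    and P: "(P has_real_derivative P') (at t)" and R: "(R has_real_derivative R') (at t)"
  obtains hp hr where
    "((\<lambda>t. enthalpy e (P t) (R t)) has_real_derivative hp * P' + hr * R') (at t)"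
    "enthalpy e (P t) (R t) * (1 / R t - hp) < hr" "hr < 0"
proof -
  obtain hp hr where h: "((\<lambda>(q, r). enthalpy e q r) has_derivative (\<lambda>(x, y). hp * x + hr * y)) (at (P t, R t))"
    "enthalpy e (P t) (R t) * (1 / R t - hp) < hr" "hr < 0"
    using enthalpy_derivative[OF assms(1-3)] .
  have "((\<lambda>t. (\<lambda>(q, r). enthalpy e q r) (P t, R t)) has_derivative
      (\<lambda>x. (\<lambda>(x, y). hp * x + hr * y) (P' * x, R' * x))) (at t)"
    by (rule has_derivative_compose[OF has_derivative_Pair[OF P[unfolded has_field_derivative_def] R[unfolded has_field_derivative_def]] h(1)])
  moreover have "(\<lambda>x. (\<lambda>(x, y). hp * x + hr * y) (P' * x, R' * x)) = (*) (hp * P' + hr * R')"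
    by (simp add: fun_eq_iff algebra_simps)
  ultimately have "((\<lambda>t. enthalpy e (P t) (R t)) has_real_derivative hp * P' + hr * R') (at t)"
    by (simp add: has_field_derivative_def)
  then show thesis using that h by blast
qed

lemma enthalpy_antimono:
  assumes "eos e" "0 < p" "0 < r" "r \<le> s"
  shows "enthalpy e p s \<le> enthalpy e p r"
proof (rule DERIV_nonpos_imp_nonincreasing[OF assms(4)])
  fix t assume "r \<le> t" "t \<le> s"
  then have "0 < t" using assms by simp
  obtain hp hr where "((\<lambda>t. enthalpy e p t) has_real_derivative hp * 0 + hr * 1) (at t)" "hr < 0"
    by (rule enthalpy_curve[OF assms(1), of "\<lambda>_. p" t "\<lambda>t. t" 0 1]) (use \<open>0 < t\<close> assms in auto)
  then show "\<exists>y. (enthalpy e p has_real_derivative y) (at t) \<and> y \<le> 0"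
    by (intro exI[of _ hr]) auto
qed

lemma cons_state_mhd:
  assumes "norm v < 1"
  shows "cons_state e \<rho> v B p =
    mhd (\<rho> / sqrt (1 - (norm v)\<^sup>2)) (\<rho> * enthalpy e p \<rho> / (1 - (norm v)\<^sup>2)) p v B"
  using norm_lt_1_pos[OF assms]
  by (simp add: cons_state_def mhd_def lorentz_def Let_def power_divide)

text \<open>Given the conserved state, the equation for the momentum determines the velocity, and that for
  the energy the pressure, as functions of \<open>z = \<rho>hW\<^sup>2\<close>; \<open>vsq\<close> is the squared velocity.\<close>

definition velz :: "real^3 \<Rightarrow> real^3 \<Rightarrow> real \<Rightarrow> real^3" where
  "velz m B z = (1 / (z + (norm B)\<^sup>2)) *\<^sub>R (m + (m \<bullet> B / z) *\<^sub>R B)"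

definition vsq :: "real^3 \<Rightarrow> real^3 \<Rightarrow> real \<Rightarrow> real" where
  "vsq m B z = (norm m)\<^sup>2 / (z + (norm B)\<^sup>2)\<^sup>2
     + (m \<bullet> B)\<^sup>2 * (2 * z + (norm B)\<^sup>2) / (z * (z + (norm B)\<^sup>2))\<^sup>2"

definition presz :: "real^3 \<Rightarrow> real^3 \<Rightarrow> real \<Rightarrow> real \<Rightarrow> real" where
  "presz m B E z = z + (norm B)\<^sup>2 / 2
     + ((norm m)\<^sup>2 * (norm B)\<^sup>2 - (m \<bullet> B)\<^sup>2) / (2 * (z + (norm B)\<^sup>2)\<^sup>2) - E"

lemma norm_velz: "0 < z \<Longrightarrow> (norm (velz m B z))\<^sup>2 = vsq m B z"
proof -
  assume z: "0 < z"
  define b where "b = (norm B)\<^sup>2"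
  have b: "0 \<le> b" by (simp add: b_def)
  have "(norm (velz m B z))\<^sup>2 = ((norm m)\<^sup>2 + (m \<bullet> B / z)\<^sup>2 * b + 2 * (m \<bullet> B / z) * (m \<bullet> B)) / (z + b)\<^sup>2"
    by (simp add: velz_def norm_add_power2 power_divide power_mult_distrib b_def)
  also have "\<dots> = vsq m B z"
    using z b by (simp add: vsq_def b_def[symmetric] divide_simps) (simp add: power2_eq_square algebra_simps)
  finally show ?thesis .
qed

lemma inner_velz: "0 < z \<Longrightarrow> velz m B z \<bullet> B = m \<bullet> B / z"
proof -
  assume z: "0 < z"
  then have "0 < z + (norm B)\<^sup>2" by (intro add_pos_nonneg) auto
  moreover have "(m + (m \<bullet> B / z) *\<^sub>R B) \<bullet> B = (m \<bullet> B / z) * (z + (norm B)\<^sup>2)"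
    using z by (simp add: inner_add_left dot_square_norm algebra_simps)
  ultimately show ?thesis by (simp add: velz_def)
qed

lemma mhd_velz:
  assumes z: "0 < z"
  shows "mhd D z (presz m B E z) (velz m B z) B = (D, m, B, E)"
proof -
  have zb: "0 < z + (norm B)\<^sup>2" using z by (intro add_pos_nonneg) auto
  have "z *\<^sub>R velz m B z + (norm B)\<^sup>2 *\<^sub>R velz m B z - (velz m B z \<bullet> B) *\<^sub>R B = m"
    using zb unfolding inner_velz[OF z] scaleR_left_distrib[symmetric] by (simp add: velz_def)
  moreover have "z - ptot (velz m B z) B (presz m B E z) + (norm B)\<^sup>2 = E"
  proof -
    define b where "b = (norm B)\<^sup>2"
    have b: "0 \<le> b" by (simp add: b_def)
    have "b * vsq m B z - (m \<bullet> B / z)\<^sup>2 = ((norm m)\<^sup>2 * b - (m \<bullet> B)\<^sup>2) / (z + b)\<^sup>2"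
      using z b by (simp add: vsq_def b_def[symmetric] divide_simps) (simp add: power2_eq_square algebra_simps)
    then show ?thesis
      unfolding ptot_def norm_velz[OF z] inner_velz[OF z] presz_def b_def[symmetric]
      by (simp add: algebra_simps add_divide_distrib diff_divide_distrib)
  qed
  ultimately show ?thesis by (simp add: mhd_def)
qed

text \<open>Pairing the momentum with \<open>B\<close> gives
  \<open>m \<bullet> B = z * (v \<bullet> B)\<close>; with this scalar known, the momentum equation
  is solved for \<open>v\<close>.\<close>

lemma mhd_velz_unique:
  assumes z: "0 < z" and U: "mhd D z p v B = (D', m, B, E)"
  shows "v = velz m B z" "p = presz m B E z"
proof -
  have zb: "0 < z + (norm B)\<^sup>2" using z by (intro add_pos_nonneg) auto
  have m: "m = z *\<^sub>R v + (norm B)\<^sup>2 *\<^sub>R v - (v \<bullet> B) *\<^sub>R B" and E: "E = z - ptot v B p + (norm B)\<^sup>2"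
    using U by (auto simp: mhd_def)
  have "m \<bullet> B = z * (v \<bullet> B)"
    by (simp add: m inner_add_left inner_diff_left dot_square_norm)
  then have "m \<bullet> B / z = v \<bullet> B" using z by simp
  then have "m + (m \<bullet> B / z) *\<^sub>R B = (z + (norm B)\<^sup>2) *\<^sub>R v"
    by (simp only:) (simp add: m algebra_simps)
  then show v: "v = velz m B z" using zb by (simp add: velz_def)
  have "z - ptot (velz m B z) B (presz m B E z) + (norm B)\<^sup>2 = E"
    using mhd_velz[OF z, of D m B E] by (simp add: mhd_def)
  then show "p = presz m B E z" using E v by (simp add: ptot_def)
qed

lemma vsq_nonneg: "0 < z \<Longrightarrow> 0 \<le> vsq m B z"
  by (metis norm_velz zero_le_power2)

text \<open>The slope of the pressure is written through that of \<open>vsq\<close> because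
  \<open>enthalpy_upcrossing\<close> compares the changes of pressure and density, and the density
  depends on \<open>z\<close> through \<open>vsq\<close> only.\<close>

lemma vsq_deriv:
  assumes z: "0 < z"
  obtains V' where "(vsq m B has_real_derivative V') (at z)" "V' \<le> 0"
    "(presz m B E has_real_derivative 1 - vsq m B z - z * V' / 2) (at z)"
proof -
  define b where "b = (norm B)\<^sup>2"
  have b: "0 \<le> b" by (simp add: b_def)
  define M where "M = (norm m)\<^sup>2"
  have M: "0 \<le> M" by (simp add: M_def)
  define t where "t = m \<bullet> B"
  define q where "q = inverse (z + b)"
  define a where "a = inverse z"
  define V' where "V' = - (2 * M * q ^ 3) + 2 * t\<^sup>2 * a\<^sup>2 * q\<^sup>2 * (1 - (2 * z + b) * a - (2 * z + b) * q)"
  have q: "(z + b) * q = 1" "q > 0" and a: "z * a = 1" "a > 0"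
    using z b by (simp_all add: q_def a_def)
  have dq: "((\<lambda>z. inverse (z + b)) has_real_derivative - (q\<^sup>2)) (at z)"
    using z b by (auto intro!: derivative_eq_intros simp: q_def power2_eq_square)
  have da: "(inverse has_real_derivative - (a\<^sup>2)) (at z)"
    using z by (auto intro!: derivative_eq_intros simp: a_def power2_eq_square)
  have dq2: "((\<lambda>z. inverse (z + b) ^ 2) has_real_derivative - (2 * q ^ 3)) (at z)"
    using DERIV_power[OF dq, of 2] by (simp add: q_def power2_eq_square power3_eq_cube algebra_simps)
  have da2: "((\<lambda>z. inverse z ^ 2) has_real_derivative - (2 * a ^ 3)) (at z)"
    using DERIV_power[OF da, of 2] by (simp add: a_def power2_eq_square power3_eq_cube algebra_simps)
  have 1: "vsq m B = (\<lambda>z. M * inverse (z + b) ^ 2 + t\<^sup>2 * (2 * z + b) * inverse z ^ 2 * inverse (z + b) ^ 2)"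
    by (simp add: fun_eq_iff vsq_def b_def M_def t_def divide_inverse power_mult_distrib mult_ac power_inverse)
  have 2: "presz m B E = (\<lambda>z. z + b / 2 + (M * b - t\<^sup>2) / 2 * inverse (z + b) ^ 2 - E)"
    by (simp add: fun_eq_iff presz_def b_def M_def t_def power_inverse[symmetric] inverse_eq_divide power_divide)
  have "(vsq m B has_real_derivative V') (at z)"
    unfolding 1
    using DERIV_add[OF DERIV_cmult[OF dq2, of M]
        DERIV_mult[OF DERIV_mult[OF DERIV_cmult[OF DERIV_add[OF DERIV_cmult[OF DERIV_ident, of 2] DERIV_const[of b]], of "t\<^sup>2"] da2] dq2]]
    by (rule DERIV_cong)
      (simp add: q_def a_def V'_def power2_eq_square power3_eq_cube algebra_simps)
  moreover have "V' \<le> 0"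
  proof -
    have "0 < z * q" using q(2) z by simp
    then have "1 \<le> (2 * z + b) * q" using q(1) by (simp add: algebra_simps)
    moreover have "0 \<le> (2 * z + b) * a" using z a(2) b by simp
    ultimately have "1 - (2 * z + b) * a - (2 * z + b) * q \<le> 0" by linarith
    then have "2 * t\<^sup>2 * a\<^sup>2 * q\<^sup>2 * (1 - (2 * z + b) * a - (2 * z + b) * q) \<le> 0"
      by (rule mult_nonneg_nonpos[rotated]) simp
    moreover have "0 \<le> 2 * M * q ^ 3" using M q(2) by simp
    ultimately show ?thesis unfolding V'_def by linarith
  qed
  moreover have "(presz m B E has_real_derivative 1 - vsq m B z - z * V' / 2) (at z)"
  proof -
    have "(presz m B E has_real_derivative 1 - (M * b - t\<^sup>2) * q ^ 3) (at z)"
      unfolding 2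
      using DERIV_diff[OF DERIV_add[OF DERIV_add[OF DERIV_ident DERIV_const[of "b / 2"]]
          DERIV_cmult[OF dq2, of "(M * b - t\<^sup>2) / 2"]] DERIV_const[of E]]
      by (rule DERIV_cong) simp
    moreover have "(M * q\<^sup>2 + t\<^sup>2 * (2 * z + b) * a\<^sup>2 * q\<^sup>2)
        + z * (- (M * q ^ 3) + t\<^sup>2 * a\<^sup>2 * q\<^sup>2 * (1 - (2 * z + b) * a - (2 * z + b) * q))
      = (M * b - t\<^sup>2) * q ^ 3" (is "?l = ?r")
    proof -
      \<comment> \<open>Partial fractions of \<open>(2 * z + b) / (z * (z + b))\<close>.\<close>
      have k: "a * (2 * z + b) * q = a + q"
      proof -
        have "a * (2 * z + b) * q = z * a * q + a * ((z + b) * q)" by algebra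
        then show ?thesis by (simp add: q(1) a(1))
      qed
      have "?l = M * q\<^sup>2 * (1 - z * q)
          + t\<^sup>2 * q\<^sup>2 * ((2 * z + b) * a\<^sup>2 + z * a * a - z * a * ((2 * z + b) * a\<^sup>2) - z * a * (a * (2 * z + b) * q))"
        by (simp add: power2_eq_square power3_eq_cube algebra_simps)
      also have "\<dots> = M * q\<^sup>2 * (b * q) - t\<^sup>2 * q\<^sup>2 * q"
      proof -
        have "1 - z * q = b * q" using q(1) by (simp add: algebra_simps)
        then show ?thesis unfolding a(1) k by (simp only:) (simp add: algebra_simps)
      qed
      also have "\<dots> = ?r" by (simp add: power2_eq_square power3_eq_cube algebra_simps)
      finally show ?thesis .
    qed
    moreover have "vsq m B z = M * q\<^sup>2 + t\<^sup>2 * (2 * z + b) * a\<^sup>2 * q\<^sup>2"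
      unfolding 1 q_def a_def ..
    moreover have "z * V' / 2 = z * (- (M * q ^ 3) + t\<^sup>2 * a\<^sup>2 * q\<^sup>2 * (1 - (2 * z + b) * a - (2 * z + b) * q))"
      by (simp add: V'_def)
    ultimately show ?thesis by (simp only: diff_diff_eq)
  qed
  ultimately show thesis using that by blast
qed

text \<open>Just after \<open>a\<close> the function is positive. At the first later point where it
  is not, it vanishes after positive values, which contradicts a positive derivative.\<close>

lemma upcrossing_unique:
  fixes g :: "real \<Rightarrow> real"
  assumes "a < b" "g a = 0" "g b = 0"
    and d: "\<And>x. a \<le> x \<Longrightarrow> x \<le> b \<Longrightarrow> \<exists>g'. (g has_real_derivative g') (at x) \<and> (g x = 0 \<longrightarrow> 0 < g')"
  shows False
proof -
  have cont: "continuous_on {a..b} g"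
    by (intro continuous_at_imp_continuous_on ballI) (use d DERIV_isCont in force)
  obtain g' where "(g has_real_derivative g') (at a)" "0 < g'" using d[of a] assms by auto
  then obtain \<delta> where \<delta>: "0 < \<delta>" "\<And>h. 0 < h \<Longrightarrow> h < \<delta> \<Longrightarrow> g a < g (a + h)"
    using DERIV_pos_inc_right by blast
  define c where "c = a + min (\<delta> / 2) ((b - a) / 2)"
  have c: "a < c" "c < b" "0 < g c"
    using \<delta>(1) \<delta>(2)[of "c - a"] assms by (auto simp: c_def min_def field_simps)
  define S where "S = {x \<in> {c..b}. g x \<le> 0}"
  have "closed S"
    unfolding S_def
    by (intro continuous_on_closed_Collect_le continuous_on_subset[OF cont] continuous_intros)
      (use c in auto)
  moreover have "S \<noteq> {}" "bdd_below S" using c assms by (auto simp: S_def)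
  ultimately have "Inf S \<in> S" by (rule closed_contains_Inf[rotated 2])
  then have s: "c \<le> Inf S" "Inf S \<le> b" "g (Inf S) \<le> 0" by (auto simp: S_def)
  have pos: "0 < g x" if "c \<le> x" "x < Inf S" for x
    using that s cInf_lower[OF _ \<open>bdd_below S\<close>, of x] by (force simp: S_def)
  have "Inf S \<noteq> c" using s c by auto
  then have cs: "c < Inf S" using s by simp
  have "g (Inf S) = 0"
  proof (rule ccontr)
    assume "g (Inf S) \<noteq> 0"
    then obtain x where "c \<le> x" "x \<le> Inf S" "g x = 0"
      using IVT2'[of g "Inf S" 0 c] s c cs continuous_on_subset[OF cont, of "{c..Inf S}"] by auto
    then show False using pos[of x] \<open>g (Inf S) \<noteq> 0\<close> by (cases "x = Inf S") auto
  qed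
  then obtain l where "(g has_real_derivative l) (at (Inf S))" "0 < l" using d[of "Inf S"] s c by auto
  then obtain \<eta> where \<eta>: "0 < \<eta>" "\<And>h. 0 < h \<Longrightarrow> h < \<eta> \<Longrightarrow> g (Inf S - h) < g (Inf S)"
    using DERIV_pos_inc_left by blast
  define h where "h = min (\<eta> / 2) (Inf S - c)"
  have "0 < h" "h < \<eta>" "c \<le> Inf S - h" using \<eta>(1) cs by (auto simp: h_def)
  then show False using \<eta>(2)[of h] pos[of "Inf S - h"] \<open>g (Inf S) = 0\<close> by auto
qed

section \<open>Monotonicity in \<open>z\<close> and uniqueness of the primitive variables\<close>

lemma vsq_antimono:
  assumes "0 < z" "z \<le> w" shows "vsq m B w \<le> vsq m B z"
proof (rule DERIV_nonpos_imp_nonincreasing[OF assms(2)])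
  fix x assume "z \<le> x" "x \<le> w"
  then have "0 < x" using assms by simp
  then show "\<exists>y. (vsq m B has_real_derivative y) (at x) \<and> y \<le> 0"
    by (metis vsq_deriv)
qed

lemma presz_strict_mono:
  assumes "0 < z" "z < w" "vsq m B z < 1" shows "presz m B E z < presz m B E w"
proof (rule DERIV_pos_imp_increasing[OF assms(2)])
  fix x assume x: "z \<le> x" "x \<le> w"
  then have "0 < x" using assms by simp
  obtain V' where V': "V' \<le> 0"
    "(presz m B E has_real_derivative 1 - vsq m B x - x * V' / 2) (at x)"
    using vsq_deriv[OF \<open>0 < x\<close>, of m B E] .
  have "0 \<le> - (x * V') / 2" using V' \<open>0 < x\<close> by (simp add: mult_nonneg_nonpos)
  moreover have "vsq m B x < 1" using vsq_antimono[OF assms(1) x(1), of m B] assms by simp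
  ultimately have "0 < 1 - vsq m B x - x * V' / 2" by simp
  then show "\<exists>y. (presz m B E has_real_derivative y) (at x) \<and> 0 < y"
    using V' by blast
qed

text \<open>Together with \<open>is_primitiveI\<close> this reduces the primitive variables to one
  unknown \<open>z\<close>, a root of the last equation subject to positive pressure and subluminal
  velocity.\<close>

lemma is_primitiveD:
  assumes e: "eos e" and P: "is_primitive e (D, m, B, E) (\<rho>, v, p)"
  obtains z where "0 < z" "0 < D" "vsq m B z < 1" "v = velz m B z" "p = presz m B E z"
    "\<rho> = D * sqrt (1 - vsq m B z)" "\<rho> * enthalpy e p \<rho> = z * (1 - vsq m B z)"
proof -
  have pr: "0 < \<rho>" "0 < p" and v: "norm v < 1" and U: "(D, m, B, E) = cons_state e \<rho> v B p"
    using P by (auto simp: is_primitive_def)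
  define a where "a = 1 - (norm v)\<^sup>2"
  define z where "z = \<rho> * enthalpy e p \<rho> / a"
  have a: "0 < a" using norm_lt_1_pos[OF v] by (simp add: a_def)
  have "0 \<le> sqrt (\<rho>\<^sup>2 + p\<^sup>2)" by simp
  then have "0 < \<rho> * enthalpy e p \<rho>" using enthalpy_bound[OF e pr(2,1)] pr by linarith
  then have z: "0 < z" using a by (simp add: z_def)
  have eq: "mhd (\<rho> / sqrt a) z p v B = (D, m, B, E)"
    using U cons_state_mhd[OF v] by (simp add: z_def a_def)
  note vp = mhd_velz_unique[OF z eq]
  have vs: "vsq m B z = (norm v)\<^sup>2" using norm_velz[OF z, of m B] vp by simp
  have D: "D = \<rho> / sqrt a" using eq by (simp add: mhd_def)
  show thesis
    by (rule that[OF z _ _ vp]) (use D a pr vs in \<open>auto simp: a_def z_def\<close>)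
qed

lemma is_primitiveI:
  assumes z: "0 < z" and D: "0 < D" and V: "vsq m B z < 1" and p: "0 < presz m B E z"
    and \<rho>: "\<rho> = D * sqrt (1 - vsq m B z)" and h: "\<rho> * enthalpy e (presz m B E z) \<rho> = z * (1 - vsq m B z)"
  shows "is_primitive e (D, m, B, E) (\<rho>, velz m B z, presz m B E z)"
proof -
  have n: "(norm (velz m B z))\<^sup>2 = vsq m B z" using norm_velz[OF z] .
  then have v: "norm (velz m B z) < 1" using V by (metis abs_norm_cancel abs_square_less_1)
  have "cons_state e \<rho> (velz m B z) B (presz m B E z) = mhd D z (presz m B E z) (velz m B z) B"
    unfolding cons_state_mhd[OF v] n h using V by (simp add: \<rho>)
  also have "\<dots> = (D, m, B, E)" using mhd_velz[OF z] .
  finally show ?thesis using v p D V by (simp add: is_primitive_def \<rho>)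
qed

text \<open>In terms of \<open>\<rho> = D / W\<close>, the equation \<open>\<rho>hW\<^sup>2 = z\<close> reads \<open>D\<^sup>2 h / \<rho> = z\<close>. The difference of
  its two sides changes sign only upwards, because the assumptions on the enthalpy say that sound is slower than light.\<close>

lemma enthalpy_upcrossing:
  assumes e: "eos e" and z: "0 < z" and D: "0 < D" and V: "vsq m B z < 1" and p: "0 < presz m B E z"
  defines "R \<equiv> \<lambda>z. D * sqrt (1 - vsq m B z)"
  defines "g \<equiv> \<lambda>z. D\<^sup>2 * enthalpy e (presz m B E z) (R z) / R z - z"
  shows "\<exists>g'. (g has_real_derivative g') (at z) \<and> (g z = 0 \<longrightarrow> 0 < g')"
proof -
  obtain V' where V': "(vsq m B has_real_derivative V') (at z)" "V' \<le> 0"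
    "(presz m B E has_real_derivative 1 - vsq m B z - z * V' / 2) (at z)"
    using vsq_deriv[OF z, of m B E] .
  define s where "s = sqrt (1 - vsq m B z)"
  define P' where "P' = 1 - vsq m B z - z * V' / 2"
  define R' where "R' = - (D * V') / (2 * s)"
  have s: "0 < s" "s\<^sup>2 = 1 - vsq m B z" using V by (auto simp: s_def)
  have Rz: "R z = D * s" "0 < R z" using D s by (auto simp: R_def s_def)
  have R': "(R has_real_derivative R') (at z)"
  proof -
    have "((\<lambda>x. sqrt (1 - vsq m B x)) has_real_derivative (0 - V') * (inverse (sqrt (1 - vsq m B z)) / 2)) (at z)"
      using DERIV_chain2[OF DERIV_real_sqrt DERIV_diff[OF DERIV_const V'(1)]] V
      by (simp add: mult.commute)
    from DERIV_cmult[OF this, of D] show ?thesis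
      unfolding R_def R'_def by (rule DERIV_cong) (simp add: s_def divide_simps)
  qed
  obtain hp hr where h: "((\<lambda>t. enthalpy e (presz m B E t) (R t)) has_real_derivative hp * P' + hr * R') (at z)"
    "enthalpy e (presz m B E z) (R z) * (1 / R z - hp) < hr" "hr < 0"
    using enthalpy_curve[of e "presz m B E" z R P' R'] e p Rz R' V'(3) unfolding P'_def by metis
  define H where "H = enthalpy e (presz m B E z) (R z)"
  define g' where "g' = D\<^sup>2 * ((hp * P' + hr * R') * R z - H * R') / (R z * R z) - 1"
  have "(g has_real_derivative g') (at z)"
    using DERIV_diff[OF DERIV_divide[OF DERIV_cmult[OF h(1), of "D\<^sup>2"] R' less_imp_neq[OF Rz(2), symmetric]] DERIV_ident]
    unfolding g_def by (rule DERIV_cong) (simp add: g'_def H_def algebra_simps)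
  moreover have "0 < g'" if g0: "g z = 0"
  proof -
    \<comment> \<open>At a zero of \<open>g\<close> the enthalpy is eliminated. This turns
      \<open>- z * V' / 2\<close> into \<open>H * R'\<close>, and so the slope of the pressure into
      \<open>s\<^sup>2 + H * R'\<close>.\<close>
    have Hz: "H = s * z / D"
      using g0 D s Rz by (simp add: g_def H_def field_simps power2_eq_square)
    then have H: "0 < H" using D s z by simp
    have HR: "H * R' = - z * V' / 2"
      using D s by (simp add: Hz R'_def field_simps)
    then have P': "P' = s\<^sup>2 + H * R'" by (simp add: P'_def s)
    have Hr: "0 \<le> H * R'" using HR V' z by (simp add: mult_nonneg_nonpos)
    have P0: "0 < P'" using P' Hr zero_less_power[OF s(1), of 2] by linarith
    \<comment> \<open>The sound-speed inequality bounds \<open>hp\<close> from below. After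
      insertion of \<open>P' = s\<^sup>2 + H * R'\<close> the terms \<open>hr * R'\<close> cancel,
      and what is left over is positive because \<open>hr < 0\<close>.\<close>
    have "1 / R z - hp < hr / H" using h(2) H by (simp add: H_def[symmetric] field_simps)
    then have "(1 / R z - hr / H) * P' < hp * P'" using P0 by (intro mult_strict_right_mono) auto
    then have "(1 / R z - hr / H) * P' + hr * R' < hp * P' + hr * R'" by simp
    moreover have "(1 / R z - hr / H) * P' + hr * R' = P' / R z - hr * s\<^sup>2 / H"
      using H by (simp add: P' left_diff_distrib distrib_left add_divide_distrib)
    moreover have "0 < - (hr * s\<^sup>2 / H)" using h(3) H s(1) by (simp add: divide_neg_pos mult_neg_pos)
    ultimately have "P' / R z < hp * P' + hr * R'" by linarith
    then have "P' < (hp * P' + hr * R') * R z" using Rz by (simp add: field_simps)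
    then have "s\<^sup>2 < (hp * P' + hr * R') * R z - H * R'" by (simp add: P')
    then have "D\<^sup>2 * s\<^sup>2 < D\<^sup>2 * ((hp * P' + hr * R') * R z - H * R')" using D by simp
    moreover have "R z * R z = D\<^sup>2 * s\<^sup>2" by (simp add: Rz power2_eq_square)
    ultimately show ?thesis using D s Rz(2) unfolding g'_def by (simp add: field_simps)
  qed
  ultimately show ?thesis by blast
qed

text \<open>Positive pressure and subluminal velocity at the smaller of two roots persist up to the
  larger one by monotonicity, so \<open>enthalpy_upcrossing\<close> is available on the whole
  interval between them.\<close>

lemma is_primitive_unique:
  assumes e: "eos e" and P: "is_primitive e U P" and P': "is_primitive e U P'"
  shows "P = P'"
proof -
  obtain D m B E where U: "U = (D, m, B, E)" by (metis prod_cases4)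
  obtain \<rho> v p where Pe: "P = (\<rho>, v, p)" by (metis prod_cases3)
  obtain \<rho>' v' p' where Pe': "P' = (\<rho>', v', p')" by (metis prod_cases3)
  have pr: "0 < \<rho>" "0 < p" "0 < \<rho>'" "0 < p'" using P P' by (auto simp: is_primitive_def Pe Pe')
  obtain z where z: "0 < z" "0 < D" "vsq m B z < 1" "v = velz m B z" "p = presz m B E z"
    "\<rho> = D * sqrt (1 - vsq m B z)" "\<rho> * enthalpy e p \<rho> = z * (1 - vsq m B z)"
    using is_primitiveD[OF e P[unfolded U Pe]] .
  obtain w where w: "0 < w" "0 < D" "vsq m B w < 1" "v' = velz m B w" "p' = presz m B E w"
    "\<rho>' = D * sqrt (1 - vsq m B w)" "\<rho>' * enthalpy e p' \<rho>' = w * (1 - vsq m B w)"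
    using is_primitiveD[OF e P'[unfolded U Pe']] .
  define R where "R = (\<lambda>z. D * sqrt (1 - vsq m B z))"
  define g where "g = (\<lambda>z. D\<^sup>2 * enthalpy e (presz m B E z) (R z) / R z - z)"
  have zero: "g x = 0" if "0 < x" "vsq m B x < 1" "R x * enthalpy e (presz m B E x) (R x) = x * (1 - vsq m B x)" for x
  proof -
    have R2: "(R x)\<^sup>2 = D\<^sup>2 * (1 - vsq m B x)" and "R x > 0" using that z(2) by (auto simp: R_def power_mult_distrib)
    then have "D\<^sup>2 * (R x * enthalpy e (presz m B E x) (R x)) = x * (R x)\<^sup>2" using that by (simp add: R2)
    then show ?thesis using \<open>R x > 0\<close> by (simp add: g_def field_simps power2_eq_square)
  qed
  have False if lt: "x < y" and x: "0 < x" "vsq m B x < 1" "0 < presz m B E x" "g x = 0" and y: "g y = 0" for x y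
  proof (rule upcrossing_unique[OF lt x(4) y])
    fix t assume t: "x \<le> t" "t \<le> y"
    have "vsq m B t < 1" using vsq_antimono[OF x(1) t(1), of m B] x by simp
    moreover have "0 < presz m B E t"
      using presz_strict_mono[of x t m B E] x t by (cases "x = t") auto
    ultimately show "\<exists>g'. (g has_real_derivative g') (at t) \<and> (g t = 0 \<longrightarrow> 0 < g')"
      unfolding g_def R_def using x t by (intro enthalpy_upcrossing[OF e _ z(2)]) auto
  qed
  moreover have "g z = 0" "g w = 0" using z w by (auto intro!: zero simp: R_def)
  ultimately have "z = w" using z w pr by (metis linorder_neqE_linordered_idom)
  then show ?thesis using z w Pe Pe' by simp
qed

section \<open>The admissible set as an intersection of half-spaces\<close>

lemma admissible_imp_gq:
  assumes e: "eos e" and U: "is_primitive e U (\<rho>, v, p)" and u: "norm u < 1"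
  shows "0 < gq u C U + pmag u C"
proof -
  have pr: "0 < \<rho>" "0 < p" and v: "norm v < 1" and Uc: "U = cons_state e \<rho> v (mag U) p"
    using U by (auto simp: is_primitive_def)
  define z where "z = \<rho> * enthalpy e p \<rho> / (1 - (norm v)\<^sup>2)"
  note hb = enthalpy_bound[OF e pr(2,1)]
  have "0 \<le> sqrt (\<rho>\<^sup>2 + p\<^sup>2)" by simp
  then have z: "0 < z" unfolding z_def using hb pr norm_lt_1_pos[OF v] by (intro divide_pos_pos) linarith+
  have "0 < z * (1 - v \<bullet> u) - p - (\<rho> / sqrt (1 - (norm v)\<^sup>2)) * sqrt (1 - (norm u)\<^sup>2)"
    using hydro_strict[OF pr hb v u z_def refl, of 0] z by simp
  moreover have "U = mhd (\<rho> / sqrt (1 - (norm v)\<^sup>2)) z p v (mag U)"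
    using Uc cons_state_mhd[OF v] by (simp add: z_def)
  then have "gq u C U + pmag u C = (z * (1 - v \<bullet> u) - p - (\<rho> / sqrt (1 - (norm v)\<^sup>2)) * sqrt (1 - (norm u)\<^sup>2))
     + pmag u (mag U - C) + ((norm (v - u))\<^sup>2 * (norm (mag U))\<^sup>2 - ((v - u) \<bullet> mag U)\<^sup>2) / 2"
    using gq_mhd by metis
  ultimately show ?thesis
    using pmag_nonneg[OF u, of "mag U - C"] gram_nonneg[of "v - u" "mag U"] by linarith
qed

text \<open>At the value \<open>z0\<close> in the proof, the conserved state is that of a pressureless fluid with
  enthalpy \<open>1\<close>, except for its energy. Hence the inequality at the corresponding velocity says that
  the pressure needed to match the energy is negative there.\<close>

lemma pressure_root:
  assumes D: "0 < D" and L: "\<And>u. norm u < 1 \<Longrightarrow> 0 < gq u B (D, m, B, E) + pmag u B"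
  obtains z1 where "0 < z1" "vsq m B z1 < 1" "presz m B E z1 = 0" "D < z1 * sqrt (1 - vsq m B z1)"
proof -
  \<comment> \<open>With \<open>h = 1\<close> and \<open>D = \<rho>W\<close>, the relation
    \<open>z = \<rho>hW\<^sup>2\<close> reads \<open>\<psi> z = D\<^sup>2\<close>.\<close>
  define \<psi> where "\<psi> z = z\<^sup>2 * (1 - vsq m B z)" for z
  have contV: "isCont (vsq m B) x" if "0 < x" for x
    using vsq_deriv[OF that, of m B 0] DERIV_isCont by metis
  have contP: "isCont (presz m B E) x" if "0 < x" for x
    using vsq_deriv[OF that, of m B E] DERIV_isCont by metis
  \<comment> \<open>\<open>K - D\<^sup>2\<close> will bound \<open>w\<^sup>2 * vsq m B w\<close>;
    since \<open>w\<close> is at least \<open>1\<close> and \<open>K\<close>, its square exceeds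
    \<open>K\<close> and \<open>D\<^sup>2 \<le> \<psi> w\<close> follows.\<close>
  define K where "K = D\<^sup>2 + (norm m)\<^sup>2 + 2 * (m \<bullet> B)\<^sup>2 / D"
  have K: "0 \<le> K" using D by (simp add: K_def)
  define w where "w = D + 1 + K"
  have w: "D \<le> w" "1 \<le> w" "K \<le> w" using D K by (auto simp: w_def)
  have "\<psi> D \<le> D\<^sup>2"
    unfolding \<psi>_def using vsq_nonneg[OF D, of m B] by (intro mult_left_le) auto
  moreover have "D\<^sup>2 \<le> \<psi> w"
  proof -
    define b where "b = (norm B)\<^sup>2"
    have b: "0 \<le> b" by (simp add: b_def)
    have w0: "0 < w" using w by simp
    have "w\<^sup>2 * vsq m B w = w\<^sup>2 * (norm m)\<^sup>2 / (w + b)\<^sup>2 + (m \<bullet> B)\<^sup>2 * ((2 * w + b) / (w + b)\<^sup>2)"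
      unfolding vsq_def b_def[symmetric] power_mult_distrib distrib_left[of "w\<^sup>2"] using w0 by simp
    also have "\<dots> \<le> (norm m)\<^sup>2 + (m \<bullet> B)\<^sup>2 * (2 / D)"
    proof (intro add_mono mult_left_mono)
      have "w\<^sup>2 * (norm m)\<^sup>2 \<le> (w + b)\<^sup>2 * (norm m)\<^sup>2"
        using w0 b by (intro mult_right_mono power_mono) auto
      then show "w\<^sup>2 * (norm m)\<^sup>2 / (w + b)\<^sup>2 \<le> (norm m)\<^sup>2"
        using w0 b by (simp add: divide_le_eq mult.commute)
      have "(2 * w + b) / (w + b)\<^sup>2 \<le> (2 * (w + b)) / (w + b)\<^sup>2"
        using w0 b by (intro divide_right_mono) auto
      also have "\<dots> = 2 / (w + b)"
        unfolding power2_eq_square by (rule nonzero_mult_divide_mult_cancel_right) (use w0 b in simp)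
      also have "\<dots> \<le> 2 / D" using D w b by (intro divide_left_mono) auto
      finally show "(2 * w + b) / (w + b)\<^sup>2 \<le> 2 / D" .
    qed auto
    also have "\<dots> = K - D\<^sup>2" by (simp add: K_def)
    finally have "w\<^sup>2 * vsq m B w \<le> K - D\<^sup>2" .
    moreover have "K \<le> w\<^sup>2" using w self_le_power[of w 2] by simp
    ultimately show ?thesis by (simp add: \<psi>_def algebra_simps)
  qed
  moreover have "continuous_on {D..w} \<psi>"
    unfolding \<psi>_def by (intro continuous_at_imp_continuous_on ballI continuous_intros contV) (use D in auto)
  ultimately obtain z0 where z0: "D \<le> z0" "\<psi> z0 = D\<^sup>2"
    using IVT'[of \<psi> D "D\<^sup>2" w] w by auto
  then have z0p: "0 < z0" using D by simp
  define V0 where "V0 = vsq m B z0"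
  have V0: "1 - V0 = (D / z0)\<^sup>2" using z0 z0p by (simp add: \<psi>_def V0_def power_divide field_simps)
  then have V01: "V0 < 1" using D z0p by (metis diff_gt_0_iff_gt divide_pos_pos zero_less_power)
  have sV: "sqrt (1 - V0) = D / z0" using V0 D z0p by simp
  define v where "v = velz m B z0"
  have vV: "(norm v)\<^sup>2 = V0" using norm_velz[OF z0p] by (simp add: v_def V0_def)
  then have v1: "norm v < 1" using V01 by (metis abs_norm_cancel abs_square_less_1)
  have "gq v B (mhd D z0 (presz m B E z0) v B) + pmag v B =
      z0 * (1 - V0) - presz m B E z0 - D * sqrt (1 - V0)"
    unfolding gq_mhd by (simp add: vV dot_square_norm) (simp add: pmag_def)
  also have "\<dots> = - presz m B E z0"
    unfolding sV unfolding V0 using z0p by (simp add: power2_eq_square)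
  finally have "presz m B E z0 < 0"
    using L[OF v1] mhd_velz[OF z0p, of D m B E] by (simp add: v_def)
  moreover have "\<bar>E\<bar> + z0 - E \<le> presz m B E (\<bar>E\<bar> + z0)"
    using Cauchy_Schwarz_ineq[of m B] by (simp add: presz_def power2_norm_eq_inner)
  then have "0 \<le> presz m B E (\<bar>E\<bar> + z0)" using z0p by linarith
  moreover have "continuous_on {z0..\<bar>E\<bar> + z0} (presz m B E)"
    by (intro continuous_at_imp_continuous_on ballI contP) (use z0p in auto)
  ultimately obtain z1 where z1: "z0 \<le> z1" "presz m B E z1 = 0"
    using IVT'[of "presz m B E" z0 0 "\<bar>E\<bar> + z0"] by auto
  have "z0 \<noteq> z1" using \<open>presz m B E z0 < 0\<close> z1 by auto
  then have lt: "z0 < z1" using z1 by simp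
  have V1: "vsq m B z1 \<le> V0" using vsq_antimono[OF z0p z1(1)] by (simp add: V0_def)
  \<comment> \<open>The strict margin obtained here says that at zero pressure a fluid with enthalpy
    \<open>1\<close> would have \<open>\<rho>hW\<^sup>2\<close> below \<open>z1\<close>.
    \<open>gq_imp_admissible\<close> starts from it.\<close>
  have "D = z0 * sqrt (1 - V0)" using sV z0p by simp
  also have "\<dots> < z1 * sqrt (1 - V0)" using lt V01 by simp
  also have "\<dots> \<le> z1 * sqrt (1 - vsq m B z1)" using V1 lt z0p by simp
  finally show thesis using that[of z1] lt z0p V1 V01 z1 by simp
qed

text \<open>A root of \<open>F\<close> is found to the right of \<open>z1\<close>. Near
  \<open>z1\<close> the pressure tends to zero and the enthalpy to \<open>1\<close>, so the margin
  of \<open>pressure_root\<close> makes \<open>F\<close> positive; for large \<open>z\<close> it is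
  nonpositive because \<open>\<rho>h\<close> is at least twice the pressure, which is at least
  \<open>z - E\<close>.\<close>

lemma gq_imp_admissible:
  assumes e: "eos e" "cold_limit e" and D: "0 < D"
    and L: "\<And>u. norm u < 1 \<Longrightarrow> 0 < gq u B (D, m, B, E) + pmag u B"
  shows "(D, m, B, E) \<in> admissible e"
proof -
  obtain z1 where z1: "0 < z1" "vsq m B z1 < 1" "presz m B E z1 = 0" "D < z1 * sqrt (1 - vsq m B z1)"
    using pressure_root[OF D L] by blast
  define R where "R = (\<lambda>z. D * sqrt (1 - vsq m B z))"
  define F where "F = (\<lambda>z. z * (1 - vsq m B z) - R z * enthalpy e (presz m B E z) (R z))"
  have V1: "vsq m B z \<le> vsq m B z1" "vsq m B z < 1" if "z1 \<le> z" for z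
    using vsq_antimono[OF z1(1) that, of m B] z1(2) by auto
  have P0: "0 < presz m B E z" if "z1 < z" for z
    using presz_strict_mono[OF z1(1) that z1(2), of E] z1(3) by simp
  have R1: "R z1 \<le> R z" "0 < R z" if "z1 \<le> z" for z
    using V1[OF that] D by (auto simp: R_def)
  have contV: "isCont (vsq m B) x" if "z1 \<le> x" for x
    using vsq_deriv[of x m B 0] DERIV_isCont that z1(1) by (metis less_le_trans)
  have contP: "isCont (presz m B E) x" if "z1 \<le> x" for x
    using vsq_deriv[of x m B E] DERIV_isCont that z1(1) by (metis less_le_trans)
  have contR: "isCont R x" if "z1 \<le> x" for x
    unfolding R_def by (intro continuous_intros contV that)
  have contF: "isCont F x" if x: "z1 < x" for x
  proof -
    obtain hp hr where "((\<lambda>(q, r). enthalpy e q r) has_derivative (\<lambda>(x, y). hp * x + hr * y)) (at (presz m B E x, R x))"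
      using enthalpy_derivative[OF e(1) P0[OF x] R1(2)] x by (metis less_imp_le)
    then have "isCont (\<lambda>(q, r). enthalpy e q r) (presz m B E x, R x)"
      by (rule has_derivative_continuous)
    then have "isCont (\<lambda>x. (\<lambda>(q, r). enthalpy e q r) (presz m B E x, R x)) x"
      by (rule isCont_o2[rotated]) (intro continuous_intros contP contR less_imp_le[OF x])
    then show ?thesis unfolding F_def using x
      by (intro continuous_intros contV contR) auto
  qed
  \<comment> \<open>\<open>cold_limit\<close> holds at each fixed density, without uniformity, while
    \<open>R z\<close> moves with \<open>z\<close>. As \<open>R\<close> increases and the enthalpy
    decreases in the density, freezing the density at \<open>R z1\<close> inside the enthalpy yields
    a minorant of \<open>F\<close>.\<close>
  define G where "G = (\<lambda>z. z * (1 - vsq m B z) - R z * (1 + e (presz m B E z) (R z1) + presz m B E z / R z1))"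
  have FG: "G z \<le> F z" if "z1 < z" for z
  proof -
    have "enthalpy e (presz m B E z) (R z) \<le> enthalpy e (presz m B E z) (R z1)"
      using that by (intro enthalpy_antimono[OF e(1)] P0 R1) auto
    then show ?thesis using R1(2)[of z] that unfolding F_def G_def enthalpy_def by simp
  qed
  have "(G \<longlongrightarrow> z1 * (1 - vsq m B z1) - R z1 * (1 + 0 + presz m B E z1 / R z1)) (at_right z1)"
  proof -
    have tV: "(vsq m B \<longlongrightarrow> vsq m B z1) (at_right z1)"
      using contV[of z1] by (simp add: isCont_def filterlim_at_split)
    have tP: "(presz m B E \<longlongrightarrow> presz m B E z1) (at_right z1)"
      using contP[of z1] by (simp add: isCont_def filterlim_at_split)
    have tR: "(R \<longlongrightarrow> R z1) (at_right z1)"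
      using contR[of z1] by (simp add: isCont_def filterlim_at_split)
    have "filterlim (presz m B E) (at_right 0) (at_right z1)"
    proof (rule tendsto_imp_filterlim_at_right)
      show "\<forall>\<^sub>F z in at_right z1. 0 < presz m B E z"
        using eventually_at_right_less[of z1] by eventually_elim (rule P0)
    qed (use tP z1(3) in simp)
    moreover have "((\<lambda>p. e p (R z1)) \<longlongrightarrow> 0) (at_right 0)"
      using e(2) R1(2)[of z1] by (simp add: cold_limit_def)
    ultimately have "((\<lambda>z. e (presz m B E z) (R z1)) \<longlongrightarrow> 0) (at_right z1)"
      by (rule filterlim_compose[rotated])
    then show ?thesis unfolding G_def
      by (intro tendsto_intros tV tP tR) (use R1(2)[of z1] in auto)
  qed
  moreover have "0 < z1 * (1 - vsq m B z1) - R z1 * (1 + 0 + presz m B E z1 / R z1)"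
  proof -
    have "R z1 < z1 * sqrt (1 - vsq m B z1) * sqrt (1 - vsq m B z1)"
      using z1(2,4) unfolding R_def by (intro mult_strict_right_mono) auto
    also have "\<dots> = z1 * (1 - vsq m B z1)" using z1(2) by simp
    finally show ?thesis using z1(3) by simp
  qed
  ultimately have "\<forall>\<^sub>F z in at_right z1. 0 < G z" by (rule order_tendstoD(1))
  then have "\<forall>\<^sub>F z in at_right z1. z1 < z \<and> 0 < G z"
    using eventually_at_right_less by eventually_elim auto
  then obtain z2 where z2: "z1 < z2" "0 < G z2"
    using eventually_happens trivial_limit_at_right_real by blast
  \<comment> \<open>Beyond \<open>2 * \<bar>E\<bar>\<close> one has
    \<open>2 * (z - E) \<ge> z\<close>, so twice the pressure outweighs \<open>z\<close>.\<close>
  define z3 where "z3 = max z2 (2 * \<bar>E\<bar> + 1)"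
  have z3: "z2 \<le> z3" "z1 < z3" "2 * \<bar>E\<bar> < z3" using z2 by (auto simp: z3_def)
  have "F z3 \<le> 0"
  proof -
    have "2 * presz m B E z3 \<le> sqrt ((R z3)\<^sup>2 + (presz m B E z3)\<^sup>2) + presz m B E z3"
      using real_sqrt_le_mono[of "(presz m B E z3)\<^sup>2" "(R z3)\<^sup>2 + (presz m B E z3)\<^sup>2"] P0[OF z3(2)] by simp
    also have "\<dots> \<le> R z3 * enthalpy e (presz m B E z3) (R z3)"
      using enthalpy_bound[OF e(1) P0[OF z3(2)] R1(2)[OF less_imp_le[OF z3(2)]]] by linarith
    finally have "2 * presz m B E z3 \<le> R z3 * enthalpy e (presz m B E z3) (R z3)" .
    moreover have "z3 - E \<le> presz m B E z3"
      using Cauchy_Schwarz_ineq[of m B] by (simp add: presz_def power2_norm_eq_inner)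
    moreover have "z3 * (1 - vsq m B z3) \<le> z3"
      using vsq_nonneg[of z3 m B] z3 z1 by (intro mult_left_le) auto
    ultimately show ?thesis using z3 unfolding F_def by linarith
  qed
  moreover have "0 \<le> F z2" using FG[OF z2(1)] z2(2) by simp
  moreover have "continuous_on {z2..z3} F"
    by (intro continuous_at_imp_continuous_on ballI contF) (use z2 in auto)
  ultimately obtain z where z: "z2 \<le> z" "F z = 0"
    using IVT2'[of F z3 0 z2] z3 by auto
  have zz: "z1 < z" using z z2 by simp
  have "is_primitive e (D, m, B, E) (R z, velz m B z, presz m B E z)"
    by (rule is_primitiveI) (use zz z1 D V1(2)[of z] P0[OF zz] z in \<open>auto simp: R_def F_def\<close>)
  then show ?thesis unfolding admissible_def by blast
qed

lemma admissible_iff: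
  assumes "eos e" "cold_limit e"
  shows "U \<in> admissible e \<longleftrightarrow> 0 < dens U \<and> (\<forall>u C. norm u < 1 \<longrightarrow> 0 < gq u C U + pmag u C)"
proof
  assume "U \<in> admissible e"
  then obtain \<rho> v p where P: "is_primitive e U (\<rho>, v, p)" by (auto simp: admissible_def)
  obtain D m B E where U: "U = (D, m, B, E)" by (metis prod_cases4)
  show "0 < dens U \<and> (\<forall>u C. norm u < 1 \<longrightarrow> 0 < gq u C U + pmag u C)"
    using admissible_imp_gq[OF assms(1) P] is_primitiveD[OF assms(1) P[unfolded U]] U by auto
next
  assume *: "0 < dens U \<and> (\<forall>u C. norm u < 1 \<longrightarrow> 0 < gq u C U + pmag u C)"
  obtain D m B E where U: "U = (D, m, B, E)" by (metis prod_cases4)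
  show "U \<in> admissible e"
    unfolding U by (rule gq_imp_admissible[OF assms]) (use * U in auto)
qed

lemma primitive_eq: "eos e \<Longrightarrow> is_primitive e U P \<Longrightarrow> primitive e U = P"
  unfolding primitive_def by (blast intro: the_equality is_primitive_unique)

text \<open>Uniqueness of the primitive variables enters here: \<open>flux\<close>,
  \<open>source\<close> and \<open>rhoh\<close> rest on a definite description, which is identified
  with the given values.\<close>

lemma admissibleE:
  assumes e: "eos e" and U: "U \<in> admissible e"
  obtains D z p v B \<rho> r where "U = mhd D z p v B" "mag U = B" "dens U = D" "rhoh e U = r"
    "0 < \<rho>" "0 < p" "sqrt (\<rho>\<^sup>2 + p\<^sup>2) \<le> r - p" "norm v < 1"
    "z = r / (1 - (norm v)\<^sup>2)" "D = \<rho> / sqrt (1 - (norm v)\<^sup>2)"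
    "\<And>i. flux e i U = flux_prim i D z p v B" "source e U = source_prim v B"
proof -
  obtain \<rho> v p where P: "is_primitive e U (\<rho>, v, p)" using U by (auto simp: admissible_def)
  have pr: "0 < \<rho>" "0 < p" and v: "norm v < 1" and Uc: "U = cons_state e \<rho> v (mag U) p"
    using P by (auto simp: is_primitive_def)
  note prim = primitive_eq[OF e P]
  have vals: "vel e U = v" "pres e U = p" "rho e U = \<rho>" by (simp_all add: vel_def pres_def rho_def prim)
  define r where "r = \<rho> * enthalpy e p \<rho>"
  define B where "B = mag U"
  define D where "D = \<rho> / sqrt (1 - (norm v)\<^sup>2)"
  define z where "z = r / (1 - (norm v)\<^sup>2)"
  have U': "U = mhd D z p v B" using Uc cons_state_mhd[OF v] by (simp add: D_def z_def r_def B_def)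
  have DU: "dens U = D" and mU: "mom U = z *\<^sub>R v + (norm B)\<^sup>2 *\<^sub>R v - (v \<bullet> B) *\<^sub>R B"
    by (simp_all add: U' mhd_def)
  have W: "1 / (lorentz v)\<^sup>2 = 1 - (norm v)\<^sup>2"
    using norm_lt_1_pos[OF v] by (simp add: lorentz_def power_divide)
  have "flux e i U = flux_prim i D z p v B" for i
    by (simp add: flux_def Let_def vals DU mU W B_def[symmetric] flux_prim_def)
  moreover have "source e U = source_prim v B"
    by (simp add: source_def Let_def vals B_def[symmetric] source_prim_def)
  moreover have "rhoh e U = r" by (simp add: rhoh_def vals r_def)
  ultimately show thesis
    using that[OF U' B_def[symmetric] DU _ pr enthalpy_bound[OF e pr(2,1), folded r_def] v z_def D_def] by blast
qed

section \<open>Midpoints of admissible states and the estimates for flux and source\<close>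

lemma linear_gq: "linear (gq u C)"
  by (rule linearI) (auto simp: gq_def inner_add_left inner_add_right algebra_simps)

lemma linear_dens: "linear dens"
  by (rule linearI) auto

lemma mag_add: "mag (U + V) = mag U + mag V" and mag_scale: "mag (c *\<^sub>R U) = c *\<^sub>R mag U"
  and dens_add: "dens (U + V) = dens U + dens V" and dens_scale: "dens (c *\<^sub>R U) = c * dens U"
  by (cases U; cases V; simp)+

text \<open>The source is evaluated at the mean of two traces, so its velocity is meaningful only if
  that mean is admissible.\<close>

lemma admissible_mean:
  assumes "eos e" "cold_limit e" "U \<in> admissible e" "V \<in> admissible e"
  shows "(1 / 2) *\<^sub>R (V + U) \<in> admissible e"
proof -
  have "0 < gq u C ((1 / 2) *\<^sub>R (V + U)) + pmag u C" if "norm u < 1" for u C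
  proof -
    have eq: "gq u C ((1 / 2) *\<^sub>R (V + U)) + pmag u C = ((gq u C V + pmag u C) + (gq u C U + pmag u C)) / 2"
      using linear_gq[of u C] by (simp add: linear_add linear_scale field_simps)
    have "0 < gq u C V + pmag u C" "0 < gq u C U + pmag u C"
      using assms that admissible_iff by blast+
    then show ?thesis unfolding eq by simp
  qed
  then show ?thesis using assms by (simp add: admissible_iff dens_add dens_scale)
qed

text \<open>What makes the averaged \<open>\<rho>h\<close> of the two sides sufficient in the wave speed bound: the jump of
  the normal magnetic field is converted into internal energy of the mean state.\<close>

lemma mean_state_enthalpy:
  assumes e: "eos e" and G: "U1 \<in> admissible e" "U2 \<in> admissible e"
    and M: "(1 / 2) *\<^sub>R (U2 + U1) = mhd D z p v B" and p: "0 < p" and v: "norm v < 1"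
  shows "(rhoh e U1 + rhoh e U2) / 4 + (mag U2 $ i - mag U1 $ i)\<^sup>2 / 8 < z"
proof -
  define a where "a = 1 - (norm v)\<^sup>2"
  have a: "0 < a" using norm_lt_1_pos[OF v] by (simp add: a_def)
  define d where "d = mag U2 $ i - mag U1 $ i"
  define M where "M = (1 / 2) *\<^sub>R (U2 + U1)"
  have MB: "mag M = B" using M by (simp add: M_def mhd_def)
  have BM: "mag M = (1 / 2) *\<^sub>R (mag U2 + mag U1)" by (simp add: M_def mag_add mag_scale)
  \<comment> \<open>The functional is taken at the velocity and field of the mean state itself,
    where it equals \<open>z * a - p\<close> once the rest-mass term is added back. Either side
    differs from the mean by half the jump, and \<open>pmag\<close> of this difference supplies the
    squared jump.\<close>
  have side: "a * rhoh e U / 2 + a * d\<^sup>2 / 8 \<le> gq v B U + pmag v B + dens U * sqrt a"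
    if U: "U \<in> admissible e" and jump: "(mag U $ i - B $ i)\<^sup>2 = d\<^sup>2 / 4" for U
  proof -
    obtain D' z' p' v' B' \<rho>' r' where s: "U = mhd D' z' p' v' B'" "mag U = B'" "dens U = D'" "rhoh e U = r'"
      "0 < \<rho>'" "0 < p'" "sqrt (\<rho>'\<^sup>2 + p'\<^sup>2) \<le> r' - p'" "norm v' < 1" "z' = r' / (1 - (norm v')\<^sup>2)"
      using admissibleE[OF e U] by metis
    have "p' \<le> sqrt (\<rho>'\<^sup>2 + p'\<^sup>2)" using real_le_rsqrt by simp
    then have "2 * p' \<le> r'" using s by linarith
    from hydro_mean[OF s(6) this s(8) v s(9)]
    have "a * r' / 2 \<le> z' * (1 - v' \<bullet> v) - p'" by (simp add: a_def)
    moreover have "a * d\<^sup>2 / 8 \<le> pmag v (B' - B)"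
    proof -
      have "\<bar>(B' - B) $ i\<bar> \<le> norm (B' - B)" by (rule component_le_norm_cart)
      then have "((B' - B) $ i)\<^sup>2 \<le> (norm (B' - B))\<^sup>2" by (metis abs_norm_cancel abs_le_square_iff)
      then have "a * (d\<^sup>2 / 4) \<le> a * (norm (B' - B))\<^sup>2"
        using jump a s by (intro mult_left_mono) auto
      then have "a * d\<^sup>2 / 4 \<le> a * (norm (B' - B))\<^sup>2 + (v \<bullet> (B' - B))\<^sup>2" by (simp add: add_increasing2)
      then show ?thesis by (simp add: pmag_def a_def[symmetric])
    qed
    ultimately show ?thesis
      using gram_nonneg[of "v' - v" B'] unfolding s(1) gq_mhd s(3)[unfolded s(1)] s(4)[unfolded s(1)] a_def[symmetric]
      by linarith
  qed
  have "gq v B M + pmag v B + dens M * sqrt a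
      = ((gq v B U1 + pmag v B + dens U1 * sqrt a) + (gq v B U2 + pmag v B + dens U2 * sqrt a)) / 2"
    using linear_gq[of v B] by (simp add: M_def linear_add linear_scale dens_add dens_scale field_simps)
  moreover have "a * rhoh e U1 / 2 + a * d\<^sup>2 / 8 \<le> gq v B U1 + pmag v B + dens U1 * sqrt a"
    by (rule side[OF G(1)]) (simp add: MB[symmetric] BM d_def power2_eq_square field_simps)
  moreover have "a * rhoh e U2 / 2 + a * d\<^sup>2 / 8 \<le> gq v B U2 + pmag v B + dens U2 * sqrt a"
    by (rule side[OF G(2)]) (simp add: MB[symmetric] BM d_def power2_eq_square field_simps)
  moreover have "gq v B M + pmag v B + dens M * sqrt a = z * a - p"
  proof -
    have "dens M = D" using M by (simp add: M_def mhd_def)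
    then show ?thesis unfolding M_def[symmetric] M[folded M_def] gq_mhd
      by (simp add: a_def dot_square_norm pmag_def)
  qed
  ultimately have "a * ((rhoh e U1 + rhoh e U2) / 4 + d\<^sup>2 / 8) \<le> z * a - p"
    by (simp add: field_simps)
  then have "a * ((rhoh e U1 + rhoh e U2) / 4 + d\<^sup>2 / 8) < a * z" using p by (simp add: mult.commute)
  then show ?thesis using a by (simp add: d_def)
qed

text \<open>The linear inequalities describing \<open>admissible e\<close> (\<open>gq u C\<close> with \<open>c = pmag u C\<close>, \<open>w = u\<close>,
  \<open>\<kappa> = u \<bullet> C\<close>, and positivity of \<open>dens\<close> with \<open>c = \<kappa> = 0\<close>) enter the scheme only through the
  following properties. The terms with \<open>w\<close> and \<open>\<kappa>\<close> cancel in the sum over the boundary of a cell.\<close>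

definition gauge :: "(real \<Rightarrow> real \<Rightarrow> real) \<Rightarrow> (state \<Rightarrow> real) \<Rightarrow> real \<Rightarrow> real^3 \<Rightarrow> real \<Rightarrow> bool" where
  "gauge e l c w \<kappa> \<longleftrightarrow> linear l \<and>
     (\<forall>U\<in>admissible e. 0 < l U + c) \<and>
     (\<forall>U\<in>admissible e. \<forall>s i. \<bar>s\<bar> \<le> 1 \<longrightarrow>
        0 \<le> l U + c + s * (l (flux e i U) + w $ i * c - mag U $ i * \<kappa>)) \<and>
     (\<forall>U\<in>admissible e. \<forall>V\<in>admissible e. \<forall>\<alpha> i. 1 \<le> \<alpha> \<longrightarrow>
        \<bar>mag V $ i - mag U $ i\<bar> / (2 * sqrt ((rhoh e V + rhoh e U) / 2)) \<le> \<alpha> \<longrightarrow>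
        (mag V $ i - mag U $ i) * (l (source e ((1 / 2) *\<^sub>R (V + U))) + \<kappa>)
          < 2 * \<alpha> * (l ((1 / 2) *\<^sub>R (V + U)) + c))"

lemma gauge_dens:
  assumes e: "eos e" "cold_limit e"
  shows "gauge e dens 0 0 0"
proof -
  have "0 \<le> dens U + s * dens (flux e i U)" if U: "U \<in> admissible e" and s: "\<bar>s\<bar> \<le> 1" for U s i
  proof -
    obtain D z p v B where v: "norm v < 1" and f: "dens U = D" "flux e i U = flux_prim i D z p v B"
      using admissibleE[OF e(1) U] by metis
    have "\<bar>s * v $ i\<bar> \<le> \<bar>v $ i\<bar>"
      using s by (simp add: abs_mult mult_left_le_one_le)
    then have "0 \<le> 1 + s * v $ i" using component_le_norm_cart[of v i] v by linarith
    moreover have "0 \<le> D" using U f e by (simp add: admissible_iff)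
    ultimately have "0 \<le> D * (1 + s * v $ i)" by simp
    then show ?thesis by (simp add: f flux_prim_def algebra_simps)
  qed
  moreover have "dens (source e U) = 0" for U by (simp add: source_def Let_def)
  ultimately show ?thesis
    using e by (auto simp: gauge_def linear_dens admissible_iff dens_add dens_scale)
qed

lemma gauge_gq:
  assumes e: "eos e" "cold_limit e" and u: "norm u < 1"
  shows "gauge e (gq u C) (pmag u C) u (u \<bullet> C)"
  unfolding gauge_def
proof (intro conjI ballI allI impI linear_gq)
  fix U assume "U \<in> admissible e"
  then show "0 < gq u C U + pmag u C" using e u by (simp add: admissible_iff)
next
  fix U and s :: real and i :: 3 assume U: "U \<in> admissible e" and s: "\<bar>s\<bar> \<le> 1"
  obtain D z p v B \<rho> r where U': "U = mhd D z p v B" "mag U = B"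
    and st: "0 < \<rho>" "0 < p" "sqrt (\<rho>\<^sup>2 + p\<^sup>2) \<le> r - p" "norm v < 1"
      "z = r / (1 - (norm v)\<^sup>2)" "D = \<rho> / sqrt (1 - (norm v)\<^sup>2)"
    and f: "\<And>i. flux e i U = flux_prim i D z p v B"
    by (rule admissibleE[OF e(1) U]) (rule that; assumption)
  define E where "E = cross3 u C - cross3 v B"
  have "gq u C U + pmag u C + s * (gq u C (flux e i U) + u $ i * pmag u C - mag U $ i * (u \<bullet> C)) =
     ((1 + s * v $ i) * (z * (1 - v \<bullet> u) - D * sqrt (1 - (norm u)\<^sup>2)) - p * (1 + s * u $ i))
     + (((norm E)\<^sup>2 + (norm (B - C))\<^sup>2) / 2 * (1 - s * u $ i) + s * cross3 E (B - C) $ i - u \<bullet> cross3 E (B - C)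
        + s * (E $ i * (u \<bullet> E) + (B - C) $ i * (u \<bullet> (B - C))))"
    unfolding U'(2) f gq_flux_prim unfolding U'(1) gq_mhd_em E_def[symmetric] by algebra
  then show "0 \<le> gq u C U + pmag u C + s * (gq u C (flux e i U) + u $ i * pmag u C - mag U $ i * (u \<bullet> C))"
    using hydro_flux[OF st(1-3) st(4) u st(5,6) s, of i] em_dominant_vec[OF u s, of E "B - C" i] by linarith
next
  fix U V and \<alpha> :: real and i :: 3 assume G: "U \<in> admissible e" "V \<in> admissible e" and \<alpha>: "1 \<le> \<alpha>"
    and jump: "\<bar>mag V $ i - mag U $ i\<bar> / (2 * sqrt ((rhoh e V + rhoh e U) / 2)) \<le> \<alpha>"
  define d where "d = mag V $ i - mag U $ i"
  define R where "R = (rhoh e V + rhoh e U) / 2"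
  define M where "M = (1 / 2) *\<^sub>R (V + U)"
  have "M \<in> admissible e" using admissible_mean[OF e G] by (simp add: M_def)
  then obtain D z p v B \<rho> r where M: "M = mhd D z p v B"
    and st: "0 < \<rho>" "0 < p" "sqrt (\<rho>\<^sup>2 + p\<^sup>2) \<le> r - p" "norm v < 1"
      "z = r / (1 - (norm v)\<^sup>2)" "D = \<rho> / sqrt (1 - (norm v)\<^sup>2)"
    and S: "source e M = source_prim v B"
    by (rule admissibleE[OF e(1)]) (rule that; assumption)
  have pos: "0 < rhoh e X" if X: "X \<in> admissible e" for X
  proof -
    obtain r p \<rho> where "rhoh e X = r" "0 < p" "sqrt (\<rho>\<^sup>2 + p\<^sup>2) \<le> r - p"
      using admissibleE[OF e(1) X] by metis
    moreover have "0 \<le> sqrt (\<rho>\<^sup>2 + p\<^sup>2)" by simp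
    ultimately show ?thesis by linarith
  qed
  have R: "0 < R" using add_pos_pos[OF pos[OF G(2)] pos[OF G(1)]] by (simp add: R_def)
  \<comment> \<open>Since \<open>2 * \<alpha> * \<sigma> = - d\<close>, the combination in
    \<open>gq_source\<close> becomes the claim.\<close>
  define \<sigma> where "\<sigma> = - d / (2 * \<alpha>)"
  have "\<sigma>\<^sup>2 < z"
  proof -
    have "\<bar>d\<bar> \<le> 2 * \<alpha> * sqrt R"
      using jump R by (simp add: d_def R_def divide_le_eq mult_ac)
    then have "\<bar>\<sigma>\<bar> \<le> sqrt R" using \<alpha> by (simp add: \<sigma>_def field_simps)
    then have "\<sigma>\<^sup>2 \<le> R" using R by (metis abs_le_square_iff abs_of_nonneg less_imp_le real_sqrt_ge_zero real_sqrt_pow2)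
    moreover have "\<bar>\<sigma>\<bar> \<le> \<bar>d / 2\<bar>"
      using \<alpha> mult_left_mono[of 1 \<alpha> "\<bar>d\<bar>"] by (simp add: \<sigma>_def divide_simps)
    then have "\<sigma>\<^sup>2 \<le> (d / 2)\<^sup>2" by (rule abs_le_square_iff[THEN iffD1])
    then have "\<sigma>\<^sup>2 \<le> d\<^sup>2 / 4" by (simp add: power_divide)
    \<comment> \<open>The left-hand side is the mean of \<open>R\<close> and
      \<open>d\<^sup>2 / 4\<close>, both at least \<open>\<sigma>\<^sup>2\<close>.\<close>
    moreover have "R / 2 + d\<^sup>2 / 8 < z"
      using mean_state_enthalpy[OF e(1) G M[unfolded M_def] st(2,4), of i] by (simp add: R_def d_def add.commute)
    ultimately show ?thesis by linarith
  qed
  have "0 < gq u C M + pmag u C + \<sigma> * (gq u C (source e M) + u \<bullet> C)"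
    unfolding S unfolding M gq_source
    using hydro_strict[OF st(1-4) u st(5,6) \<open>\<sigma>\<^sup>2 < z\<close>] pmag_nonneg[OF u, of "B - C + \<sigma> *\<^sub>R (v - u)"]
      gram_nonneg[of "v - u" "B + \<sigma> *\<^sub>R u"] by linarith
  then have "0 < 2 * \<alpha> * (gq u C M + pmag u C + \<sigma> * (gq u C (source e M) + u \<bullet> C))" using \<alpha> by simp
  also have "\<dots> = 2 * \<alpha> * (gq u C M + pmag u C) - d * (gq u C (source e M) + u \<bullet> C)"
    using \<alpha> by (simp add: \<sigma>_def field_simps)
  finally show "(mag V $ i - mag U $ i) * (gq u C (source e ((1 / 2) *\<^sub>R (V + U))) + u \<bullet> C)
      < 2 * \<alpha> * (gq u C ((1 / 2) *\<^sub>R (V + U)) + pmag u C)"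
    by (simp add: d_def M_def)
qed

lemma admissible_gauge:
  assumes e: "eos e" "cold_limit e" and l: "\<And>l c w \<kappa>. gauge e l c w \<kappa> \<Longrightarrow> 0 < l U + c"
  shows "U \<in> admissible e"
  using l[OF gauge_dens[OF e]] l[OF gauge_gq[OF e]] by (simp add: admissible_iff[OF e])

section \<open>Gauss quadrature and polynomials\<close>

lemma gauss_poly:
  assumes g: "gauss_rule Q \<xi> \<omega>" and q: "degree q < 2 * Q"
  shows "integral {-1..1} (poly q) = 2 * (\<Sum>\<mu>=1..Q. \<omega> \<mu> * poly q (\<xi> \<mu>))"
proof -
  have int: "(\<lambda>t::real. t ^ n) integrable_on {-1..1}" for n
    by (intro integrable_continuous_real continuous_intros)
  have "integral {-1..1} (poly q) = integral {-1..1} (\<lambda>t. \<Sum>n\<le>degree q. coeff q n * t ^ n)"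
    by (rule arg_cong[where f="integral _"]) (simp add: fun_eq_iff poly_altdef)
  also have "\<dots> = (\<Sum>n\<le>degree q. coeff q n * integral {-1..1} (\<lambda>t. t ^ n))"
    by (subst integral_sum) (auto intro!: integrable_on_mult_right int)
  also have "\<dots> = (\<Sum>n\<le>degree q. coeff q n * (2 * (\<Sum>\<mu>=1..Q. \<omega> \<mu> * \<xi> \<mu> ^ n)))"
  proof (rule sum.cong[OF refl])
    fix n assume "n \<in> {..degree q}"
    then have "n < 2 * Q" using q by simp
    then have "integral {-1..1} (\<lambda>t::real. t ^ n) / 2 = (\<Sum>\<mu>=1..Q. \<omega> \<mu> * \<xi> \<mu> ^ n)"
      using g by (simp add: gauss_rule_def)
    then show "coeff q n * integral {-1..1} (\<lambda>t. t ^ n) = coeff q n * (2 * (\<Sum>\<mu>=1..Q. \<omega> \<mu> * \<xi> \<mu> ^ n))"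
      by (simp add: field_simps)
  qed
  also have "\<dots> = (\<Sum>\<mu>=1..Q. \<Sum>n\<le>degree q. coeff q n * (2 * (\<omega> \<mu> * \<xi> \<mu> ^ n)))"
    unfolding sum_distrib_left by (rule sum.swap)
  also have "\<dots> = 2 * (\<Sum>\<mu>=1..Q. \<omega> \<mu> * poly q (\<xi> \<mu>))"
    by (simp add: poly_altdef sum_distrib_left mult_ac)
  finally show ?thesis .
qed

lemma gauss_weight_sum:
  assumes "gauss_rule Q \<xi> \<omega>" "0 < Q"
  shows "(\<Sum>\<mu>=1..Q. \<omega> \<mu>) = 1"
proof -
  have "degree (1 :: real poly) < 2 * Q" using assms(2) by simp
  from gauss_poly[OF assms(1) this] have "integral {-1..1} (poly (1 :: real poly)) = 2 * (\<Sum>\<mu>=1..Q. \<omega> \<mu>)"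
    by simp
  moreover have "poly (1 :: real poly) = (\<lambda>_. 1)" by auto
  ultimately show ?thesis by simp
qed

lemma gauss_poly_pos:
  assumes g: "gauss_rule Q \<xi> \<omega>" and q: "degree q < 2 * Q" "q \<noteq> 0"
    and nn: "\<And>t. t \<in> {-1..1} \<Longrightarrow> 0 \<le> poly q t"
  shows "0 < (\<Sum>\<mu>=1..Q. \<omega> \<mu> * poly q (\<xi> \<mu>))"
proof -
  have "integral {-1..1} (poly q) \<noteq> 0"
  proof
    assume "integral {-1..1} (poly q) = 0"
    then have "{-1..1} \<subseteq> {t. poly q t = 0}"
      using integral_eq_0_iff[of "-1" 1 "poly q"] nn by (auto simp: continuous_at_imp_continuous_on)
    then have "finite {-1..1::real}" using poly_roots_finite[OF q(2)] finite_subset by blast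
    then show False using infinite_Icc[of "-1::real" 1] by simp
  qed
  moreover have "0 \<le> integral {-1..1} (poly q)"
    by (intro integral_nonneg integrable_continuous_real) (use nn in \<open>auto simp: continuous_at_imp_continuous_on\<close>)
  ultimately show ?thesis using gauss_poly[OF g q(1)] by linarith
qed

text \<open>The squared product of the other node factors has degree \<open>2 * Q - 2\<close> and
  isolates one weight. A further factor \<open>1 + t\<close> or \<open>1 - t\<close> is still
  integrated exactly, and would give zero if the node were an endpoint. Interior nodes matter
  because the divergence condition holds in open cells only.\<close>

lemma gauss_node_weight:
  assumes g: "gauss_rule Q \<xi> \<omega>" and \<mu>: "\<mu> \<in> {1..Q}"
  shows "0 < \<omega> \<mu>" "-1 < \<xi> \<mu>" "\<xi> \<mu> < 1"
proof -
  have range: "\<xi> \<mu> \<in> {-1..1}" and inj: "inj_on \<xi> {1..Q}"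
    using g \<mu> unfolding gauss_rule_def by blast+
  define r where "r = (\<Prod>\<nu>\<in>{1..Q} - {\<mu>}. [:- \<xi> \<nu>, 1:]\<^sup>2)"
  have r0: "r \<noteq> 0" by (simp add: r_def)
  have "degree r \<le> (\<Sum>\<nu>\<in>{1..Q} - {\<mu>}. 2)"
    unfolding r_def using degree_prod_sum_le[of "{1..Q} - {\<mu>}" "\<lambda>\<nu>. [:- \<xi> \<nu>, 1:]\<^sup>2"]
    by (simp add: degree_power_eq)
  then have "degree r \<le> (Q - 1) * 2" using \<mu> by simp
  moreover have "0 < Q" using \<mu> by simp
  ultimately have dr: "degree r < 2 * Q - 1" by linarith
  have rn: "0 \<le> poly r t" for t by (simp add: r_def poly_prod prod_nonneg)
  have zero: "poly r (\<xi> \<nu>) = 0" if "\<nu> \<in> {1..Q}" "\<nu> \<noteq> \<mu>" for \<nu>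
    using that by (auto simp: r_def poly_prod)
  have sum: "(\<Sum>\<nu>=1..Q. \<omega> \<nu> * poly (s * r) (\<xi> \<nu>)) = \<omega> \<mu> * (poly s (\<xi> \<mu>) * poly r (\<xi> \<mu>))" for s
  proof -
    have "(\<Sum>\<nu>=1..Q. \<omega> \<nu> * poly (s * r) (\<xi> \<nu>)) = (\<Sum>\<nu>\<in>{\<mu>}. \<omega> \<nu> * poly (s * r) (\<xi> \<nu>))"
      by (rule sum.mono_neutral_right) (use \<mu> zero in auto)
    then show ?thesis by simp
  qed
  have "0 < \<omega> \<mu> * poly r (\<xi> \<mu>)"
    using gauss_poly_pos[OF g, of "1 * r"] sum[of 1] r0 rn dr \<mu> by simp
  then show "0 < \<omega> \<mu>" using rn[of "\<xi> \<mu>"] by (simp add: zero_less_mult_iff)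
  have pos: "0 < \<omega> \<mu> * (poly [:1, c:] (\<xi> \<mu>) * poly r (\<xi> \<mu>))" if "c = 1 \<or> c = -1" for c
  proof -
    have "degree ([:1, c:] * r) \<le> degree [:1, c:] + degree r" by (rule degree_mult_le)
    then have "degree ([:1, c:] * r) < 2 * Q" using dr that by auto
    moreover have "[:1, c:] * r \<noteq> 0" unfolding mult_eq_0_iff using r0 by simp
    moreover have "0 \<le> poly ([:1, c:] * r) t" if "t \<in> {-1..1}" for t
      unfolding poly_mult using rn that \<open>c = 1 \<or> c = -1\<close> by (intro mult_nonneg_nonneg) auto
    ultimately show ?thesis using gauss_poly_pos[OF g] sum[of "[:1, c:]"] by metis
  qed
  show "\<xi> \<mu> < 1" using range pos[of "-1"] by (cases "\<xi> \<mu> = 1") auto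
  show "-1 < \<xi> \<mu>" using range pos[of 1] by (cases "\<xi> \<mu> = -1") auto
qed

lemma gauss_ftc:
  assumes g: "gauss_rule Q \<xi> \<omega>" and q: "degree q \<le> 2 * Q"
  shows "poly q (c + h) - poly q (c - h) = 2 * h * (\<Sum>\<mu>=1..Q. \<omega> \<mu> * poly (pderiv q) (c + h * \<xi> \<mu>))"
proof -
  define r where "r = pcompose q [:c, h:]"
  have pr: "pderiv r = smult h (pcompose (pderiv q) [:c, h:])"
  proof -
    have "pderiv [:c, h:] = [:h:]" by (simp add: pderiv_pCons)
    then show ?thesis unfolding r_def pderiv_pcompose by simp
  qed
  have ftc: "integral {-1..1} (poly (pderiv r)) = poly r 1 - poly r (-1)"
  proof (rule integral_unique, rule fundamental_theorem_of_calculus[where f="poly r"])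
    show "(poly r has_vector_derivative poly (pderiv r) x) (at x within {-1..1})" for x
      by (rule has_vector_derivative_at_within)
        (simp add: poly_DERIV flip: has_real_derivative_iff_has_vector_derivative)
  qed simp
  have "degree r \<le> 2 * Q"
  proof -
    have "degree r \<le> degree q * degree [:c, h:]" unfolding r_def by (rule degree_pcompose_le)
    also have "\<dots> \<le> degree q * 1" by (intro mult_left_mono) auto
    finally show ?thesis using q by simp
  qed
  then have "degree (pderiv r) < 2 * Q \<or> pderiv r = 0"
    by (cases "degree r = 0") (auto simp: degree_pderiv pderiv_eq_0_iff)
  then have "integral {-1..1} (poly (pderiv r)) = 2 * (\<Sum>\<mu>=1..Q. \<omega> \<mu> * poly (pderiv r) (\<xi> \<mu>))"
  proof
    assume "pderiv r = 0"
    moreover have "poly (0 :: real poly) = (\<lambda>_. 0)" by auto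
    ultimately show ?thesis by simp
  qed (rule gauss_poly[OF g])
  then show ?thesis
    unfolding ftc unfolding pr by (simp add: r_def poly_pcompose sum_distrib_left mult_ac)
qed

section \<open>Bivariate polynomials of bounded total degree\<close>

lemma poly2_sum:
  assumes "\<And>i. i \<in> A \<Longrightarrow> poly2 k (f i)" "finite A"
  shows "poly2 k (\<lambda>z. \<Sum>i\<in>A. f i z)"
proof -
  have "\<forall>i\<in>A. \<exists>c. \<forall>x y. f i (x, y) = (\<Sum>a\<le>k. \<Sum>b\<le>k - a. (x ^ a * y ^ b) *\<^sub>R c a b)"
    using assms(1) unfolding poly2_def by blast
  from bchoice[OF this]
  obtain c where c: "\<And>i x y. i \<in> A \<Longrightarrow> f i (x, y) = (\<Sum>a\<le>k. \<Sum>b\<le>k - a. (x ^ a * y ^ b) *\<^sub>R c i a b)"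
    by blast
  have "(\<Sum>i\<in>A. f i (x, y)) = (\<Sum>a\<le>k. \<Sum>b\<le>k - a. (x ^ a * y ^ b) *\<^sub>R (\<Sum>i\<in>A. c i a b))" for x y
  proof -
    have "(\<Sum>i\<in>A. f i (x, y)) = (\<Sum>i\<in>A. \<Sum>a\<le>k. \<Sum>b\<le>k - a. (x ^ a * y ^ b) *\<^sub>R c i a b)"
      by (intro sum.cong refl c)
    also have "\<dots> = (\<Sum>a\<le>k. \<Sum>i\<in>A. \<Sum>b\<le>k - a. (x ^ a * y ^ b) *\<^sub>R c i a b)"
      by (rule sum.swap)
    also have "\<dots> = (\<Sum>a\<le>k. \<Sum>b\<le>k - a. \<Sum>i\<in>A. (x ^ a * y ^ b) *\<^sub>R c i a b)"
      by (intro sum.cong refl sum.swap)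
    finally show ?thesis by (simp add: scaleR_right.sum)
  qed
  then show ?thesis unfolding poly2_def by (intro exI[of _ "\<lambda>a b. \<Sum>i\<in>A. c i a b"]) auto
qed

lemma poly2_monom:
  assumes "i + j \<le> k" shows "poly2 k (\<lambda>(x, y). (x ^ i * y ^ j) *\<^sub>R v)"
proof -
  have "(x ^ i * y ^ j) *\<^sub>R v = (\<Sum>a\<le>k. \<Sum>b\<le>k - a. (x ^ a * y ^ b) *\<^sub>R (if a = i \<and> b = j then v else 0))" for x y :: real
  proof -
    have "(\<Sum>a\<le>k. \<Sum>b\<le>k - a. (x ^ a * y ^ b) *\<^sub>R (if a = i \<and> b = j then v else 0))
        = (\<Sum>a\<le>k. if a = i then (\<Sum>b\<le>k - i. if b = j then (x ^ i * y ^ j) *\<^sub>R v else 0) else 0)"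
      by (rule sum.cong[OF refl], rename_tac a, case_tac "a = i") (simp_all add: if_distrib[of "scaleR _"] cong: if_cong)
    also have "\<dots> = (x ^ i * y ^ j) *\<^sub>R v"
    proof -
      have "i \<le> k" "j \<le> k - i" using assms by simp_all
      then show ?thesis by simp
    qed
    finally show ?thesis by simp
  qed
  then show ?thesis unfolding poly2_def by (intro exI[of _ "\<lambda>a b. if a = i \<and> b = j then v else 0"]) auto
qed

lemma poly2_affine:
  assumes "poly2 k f" shows "poly2 k (\<lambda>(x, y). f (c + h * x, d + g * y))"
proof -
  obtain C where C: "\<And>x y. f (x, y) = (\<Sum>a\<le>k. \<Sum>b\<le>k - a. (x ^ a * y ^ b) *\<^sub>R C a b)"
    using assms unfolding poly2_def by blast
  define p where "p a i = of_nat (a choose i) * h ^ i * c ^ (a - i)" for a i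
  define q where "q b j = of_nat (b choose j) * g ^ j * d ^ (b - j)" for b j
  have p: "(c + h * x) ^ a = (\<Sum>i\<le>a. p a i * x ^ i)" for x a
    using binomial_ring[of "h * x" c a] by (simp add: p_def power_mult_distrib add.commute mult_ac)
  have q: "(d + g * y) ^ b = (\<Sum>j\<le>b. q b j * y ^ j)" for y b
    using binomial_ring[of "g * y" d b] by (simp add: q_def power_mult_distrib add.commute mult_ac)
  have trm: "poly2 k (\<lambda>(x, y). ((c + h * x) ^ a * (d + g * y) ^ b) *\<^sub>R C a b)"
    if ab: "a \<le> k" "b \<le> k - a" for a b
  proof -
    have "((c + h * x) ^ a * (d + g * y) ^ b) *\<^sub>R C a b
        = (\<Sum>i\<le>a. \<Sum>j\<le>b. (x ^ i * y ^ j) *\<^sub>R ((p a i * q b j) *\<^sub>R C a b))" for x y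
      unfolding p q sum_product scaleR_sum_left
      by (intro sum.cong refl) (simp only: scaleR_scaleR mult_ac)
    then have "(\<lambda>(x, y). ((c + h * x) ^ a * (d + g * y) ^ b) *\<^sub>R C a b)
        = (\<lambda>z. \<Sum>i\<le>a. \<Sum>j\<le>b. (\<lambda>(x, y). (x ^ i * y ^ j) *\<^sub>R ((p a i * q b j) *\<^sub>R C a b)) z)"
      by (simp add: fun_eq_iff)
    moreover have "poly2 k (\<lambda>z. \<Sum>i\<le>a. \<Sum>j\<le>b. (\<lambda>(x, y). (x ^ i * y ^ j) *\<^sub>R ((p a i * q b j) *\<^sub>R C a b)) z)"
      by (rule poly2_sum[OF poly2_sum[OF poly2_monom]]) (use ab in auto)
    ultimately show ?thesis by (simp only:)
  qed
  have "poly2 k (\<lambda>z. \<Sum>a\<le>k. \<Sum>b\<le>k - a. (\<lambda>(x, y). ((c + h * x) ^ a * (d + g * y) ^ b) *\<^sub>R C a b) z)"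
    by (rule poly2_sum[OF poly2_sum[OF trm]]) auto
  moreover have "(\<lambda>(x, y). f (c + h * x, d + g * y))
      = (\<lambda>z. \<Sum>a\<le>k. \<Sum>b\<le>k - a. (\<lambda>(x, y). ((c + h * x) ^ a * (d + g * y) ^ b) *\<^sub>R C a b) z)"
    by (simp add: C fun_eq_iff)
  ultimately show ?thesis by (simp only:)
qed

lemma poly2_linear:
  assumes "linear l" "poly2 k f" shows "poly2 k (\<lambda>z. l (f z))"
proof -
  obtain C where C: "\<And>x y. f (x, y) = (\<Sum>a\<le>k. \<Sum>b\<le>k - a. (x ^ a * y ^ b) *\<^sub>R C a b)"
    using assms unfolding poly2_def by blast
  show ?thesis unfolding poly2_def
    by (intro exI[of _ "\<lambda>a b. l (C a b)"]) (simp add: C linear_sum[OF assms(1)] linear_scale[OF assms(1)])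
qed

lemma poly2_continuous:
  fixes f :: "real \<times> real \<Rightarrow> 'a::real_normed_vector"
  assumes "poly2 k f" shows "continuous_on A f"
proof -
  obtain C where C: "\<And>x y. f (x, y) = (\<Sum>a\<le>k. \<Sum>b\<le>k - a. (x ^ a * y ^ b) *\<^sub>R C a b)"
    using assms unfolding poly2_def by blast
  have "f = (\<lambda>z. \<Sum>a\<le>k. \<Sum>b\<le>k - a. (fst z ^ a * snd z ^ b) *\<^sub>R C a b)"
    by (auto simp: C fun_eq_iff)
  then show ?thesis by (simp add: continuous_intros)
qed

lemma poly2_section:
  fixes f :: "real \<times> real \<Rightarrow> real"
  assumes "poly2 k f"
  obtains p where "degree p \<le> k" "\<And>x. f (x, y) = poly p x"
proof -
  obtain C where C: "\<And>x y. f (x, y) = (\<Sum>a\<le>k. \<Sum>b\<le>k - a. (x ^ a * y ^ b) *\<^sub>R C a b)"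
    using assms unfolding poly2_def by blast
  show thesis
  proof
    show "degree (\<Sum>a\<le>k. monom (\<Sum>b\<le>k - a. y ^ b * C a b) a) \<le> k"
      by (intro degree_sum_le) (auto intro: order_trans[OF degree_monom_le])
    show "f (x, y) = poly (\<Sum>a\<le>k. monom (\<Sum>b\<le>k - a. y ^ b * C a b) a) x" for x
      by (simp add: C poly_sum poly_monom sum_distrib_left sum_distrib_right mult_ac)
  qed
qed

lemma poly2_swap:
  fixes f :: "real \<times> real \<Rightarrow> real"
  assumes "poly2 k f" shows "poly2 k (\<lambda>(x, y). f (y, x))"
proof -
  obtain C where C: "\<And>x y. f (x, y) = (\<Sum>a\<le>k. \<Sum>b\<le>k - a. (x ^ a * y ^ b) *\<^sub>R C a b)"
    using assms unfolding poly2_def by blast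
  have "poly2 k (\<lambda>z. \<Sum>a\<le>k. \<Sum>b\<le>k - a. (\<lambda>(x, y). (x ^ b * y ^ a) *\<^sub>R C a b) z)"
    by (intro poly2_sum poly2_monom) auto
  moreover have "(\<lambda>(x, y). f (y, x)) = (\<lambda>z. \<Sum>a\<le>k. \<Sum>b\<le>k - a. (\<lambda>(x, y). (x ^ b * y ^ a) *\<^sub>R C a b) z)"
    by (auto simp: C fun_eq_iff mult_ac)
  ultimately show ?thesis by simp
qed

text \<open>The derivatives in the tensor product of the Gauss nodes are turned into boundary
  values by exactness of the Gauss rule in one direction at a time.\<close>

lemma gauss_divergence:
  fixes f g :: "real \<times> real \<Rightarrow> real"
  assumes gauss: "gauss_rule Q \<xi> \<omega>" and f: "poly2 k f" and g: "poly2 k g" and k: "k \<le> 2 * Q"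
    and h: "0 < hx" "0 < hy"
    and div: "\<And>x y. cx - hx < x \<Longrightarrow> x < cx + hx \<Longrightarrow> cy - hy < y \<Longrightarrow> y < cy + hy \<Longrightarrow>
      deriv (\<lambda>s. f (s, y)) x + deriv (\<lambda>s. g (x, s)) y = 0"
  shows "(\<Sum>\<mu>=1..Q. \<omega> \<mu> * (f (cx + hx, cy + hy * \<xi> \<mu>) - f (cx - hx, cy + hy * \<xi> \<mu>))) / hx
       + (\<Sum>\<mu>=1..Q. \<omega> \<mu> * (g (cx + hx * \<xi> \<mu>, cy + hy) - g (cx + hx * \<xi> \<mu>, cy - hy))) / hy = 0"
proof -
  have ftc: "(F (c + h) - F (c - h)) / h = 2 * (\<Sum>\<nu>=1..Q. \<omega> \<nu> * deriv F (c + h * \<xi> \<nu>))"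
    if F: "\<And>x. F x = poly p x" and p: "degree p \<le> k" and "0 < h" for F p and c h :: real
  proof -
    have "F = poly p" using F by auto
    moreover have "deriv (poly p) x = poly (pderiv p) x" for x
      by (rule DERIV_imp_deriv) (rule poly_DERIV)
    ultimately show ?thesis using gauss_ftc[OF gauss, of p c h] k p \<open>0 < h\<close> by (simp add: field_simps)
  qed
  have 1: "(f (cx + hx, y) - f (cx - hx, y)) / hx = 2 * (\<Sum>\<nu>=1..Q. \<omega> \<nu> * deriv (\<lambda>s. f (s, y)) (cx + hx * \<xi> \<nu>))" for y
    by (rule poly2_section[OF f, of y]) (rule ftc[where F="\<lambda>s. f (s, y)"]; use h in auto)
  have 2: "(g (x, cy + hy) - g (x, cy - hy)) / hy = 2 * (\<Sum>\<nu>=1..Q. \<omega> \<nu> * deriv (\<lambda>s. g (x, s)) (cy + hy * \<xi> \<nu>))" for x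
    by (rule poly2_section[OF poly2_swap[OF g], of x]) (rule ftc[where F="\<lambda>s. g (x, s)"]; use h in auto)
  have "(\<Sum>\<mu>=1..Q. \<omega> \<mu> * (f (cx + hx, cy + hy * \<xi> \<mu>) - f (cx - hx, cy + hy * \<xi> \<mu>))) / hx
       + (\<Sum>\<mu>=1..Q. \<omega> \<mu> * (g (cx + hx * \<xi> \<mu>, cy + hy) - g (cx + hx * \<xi> \<mu>, cy - hy))) / hy
     = (\<Sum>\<mu>=1..Q. \<omega> \<mu> * ((f (cx + hx, cy + hy * \<xi> \<mu>) - f (cx - hx, cy + hy * \<xi> \<mu>)) / hx))
       + (\<Sum>\<mu>=1..Q. \<omega> \<mu> * ((g (cx + hx * \<xi> \<mu>, cy + hy) - g (cx + hx * \<xi> \<mu>, cy - hy)) / hy))"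
    by (simp add: sum_divide_distrib)
  also have "\<dots> = (\<Sum>\<mu>=1..Q. \<Sum>\<nu>=1..Q. 2 * \<omega> \<mu> * \<omega> \<nu> * deriv (\<lambda>s. f (s, cy + hy * \<xi> \<mu>)) (cx + hx * \<xi> \<nu>))
       + (\<Sum>\<mu>=1..Q. \<Sum>\<nu>=1..Q. 2 * \<omega> \<mu> * \<omega> \<nu> * deriv (\<lambda>s. g (cx + hx * \<xi> \<mu>, s)) (cy + hy * \<xi> \<nu>))"
    unfolding 1 2 by (simp add: sum_distrib_left mult_ac)
  \<comment> \<open>Exchanging the sums brings both derivatives to the same node of the tensor grid,
    an interior point where the divergence vanishes.\<close>
  also have "(\<Sum>\<mu>=1..Q. \<Sum>\<nu>=1..Q. 2 * \<omega> \<mu> * \<omega> \<nu> * deriv (\<lambda>s. g (cx + hx * \<xi> \<mu>, s)) (cy + hy * \<xi> \<nu>))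
       = (\<Sum>\<nu>=1..Q. \<Sum>\<mu>=1..Q. 2 * \<omega> \<mu> * \<omega> \<nu> * deriv (\<lambda>s. g (cx + hx * \<xi> \<mu>, s)) (cy + hy * \<xi> \<nu>))"
    by (rule sum.swap)
  also have "(\<Sum>\<mu>=1..Q. \<Sum>\<nu>=1..Q. 2 * \<omega> \<mu> * \<omega> \<nu> * deriv (\<lambda>s. f (s, cy + hy * \<xi> \<mu>)) (cx + hx * \<xi> \<nu>)) + \<dots>
      = (\<Sum>\<mu>=1..Q. \<Sum>\<nu>=1..Q. 2 * \<omega> \<mu> * \<omega> \<nu> * (deriv (\<lambda>s. f (s, cy + hy * \<xi> \<mu>)) (cx + hx * \<xi> \<nu>)
          + deriv (\<lambda>s. g (cx + hx * \<xi> \<nu>, s)) (cy + hy * \<xi> \<mu>)))"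
    unfolding sum.distrib[symmetric] by (intro sum.cong refl) (simp add: algebra_simps)
  also have "\<dots> = 0"
  proof (intro sum.neutral ballI)
    fix \<mu> \<nu> assume "\<mu> \<in> {1..Q}" "\<nu> \<in> {1..Q}"
    note n = gauss_node_weight(2,3)[OF gauss this(1)] gauss_node_weight(2,3)[OF gauss this(2)]
    have lim: "c - h < c + h * t" "c + h * t < c + h" if "0 < h" "-1 < t" "t < 1" for c h t :: real
      using mult_strict_left_mono[OF that(2,1)] mult_strict_left_mono[OF that(3,1)] by auto
    have "deriv (\<lambda>s. f (s, cy + hy * \<xi> \<mu>)) (cx + hx * \<xi> \<nu>)
          + deriv (\<lambda>s. g (cx + hx * \<xi> \<nu>, s)) (cy + hy * \<xi> \<mu>) = 0"
      by (rule div) (rule lim; use h n in simp)+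
    then show "2 * \<omega> \<mu> * \<omega> \<nu> * (deriv (\<lambda>s. f (s, cy + hy * \<xi> \<mu>)) (cx + hx * \<xi> \<nu>)
          + deriv (\<lambda>s. g (cx + hx * \<xi> \<nu>, s)) (cy + hy * \<xi> \<mu>)) = 0" by simp
  qed
  finally show ?thesis .
qed

section \<open>Change of variables on rectangles\<close>

lemma integral_affine:
  fixes F :: "real \<Rightarrow> real"
  assumes h: "0 < h" and F: "F integrable_on {c - h..c + h}"
  shows "integral {c - h..c + h} F = h * integral {-1..1} (\<lambda>t. F (c + h * t))"
proof -
  have "(F has_integral integral {c - h..c + h} F) (cbox (c - h) (c + h))"
    using F by (simp add: integrable_integral)
  from has_integral_affinity'[OF this h, of c]
  have "((\<lambda>t. F (c + h * t)) has_integral integral {c - h..c + h} F / h) {-1..1}"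
    using h by (simp add: add.commute divide_inverse_commute)
  then show ?thesis using h by (simp add: integral_unique)
qed

lemma has_integral_rect_affine:
  fixes f :: "real \<times> real \<Rightarrow> real"
  assumes h: "0 < hx" "0 < hy" and f: "continuous_on UNIV f"
  shows "(f has_integral hx * hy * integral ({-1..1} \<times> {-1..1}) (\<lambda>(x, y). f (cx + hx * x, cy + hy * y)))
    (cbox (cx - hx, cy - hy) (cx + hx, cy + hy))"
proof -
  have cont: "continuous_on A (\<lambda>z. f (g z))" if "continuous_on A g" for A and g :: "'c::topological_space \<Rightarrow> real \<times> real"
    using continuous_on_compose2[OF f that] by simp
  have "integral (cbox (cx - hx, cy - hy) (cx + hx, cy + hy)) f
      = integral {cx - hx..cx + hx} (\<lambda>x. integral {cy - hy..cy + hy} (\<lambda>y. f (x, y)))"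
    using integral_prod_continuous[OF continuous_on_subset[OF f subset_UNIV]] by simp
  also have "\<dots> = hx * integral {-1..1} (\<lambda>x. integral {cy - hy..cy + hy} (\<lambda>y. f (cx + hx * x, y)))"
    using integral_integrable_2dim[OF continuous_on_subset[OF f subset_UNIV]]
    by (intro integral_affine h) simp
  also have "\<dots> = hx * integral {-1..1} (\<lambda>x. hy * integral {-1..1} (\<lambda>y. f (cx + hx * x, cy + hy * y)))"
    by (subst integral_affine[OF h(2)]) (auto intro!: integrable_continuous_real cont continuous_intros)
  also have "\<dots> = hx * hy * integral {-1..1} (\<lambda>x. integral {-1..1} (\<lambda>y. f (cx + hx * x, cy + hy * y)))"
    by simp
  also have "integral {-1..1} (\<lambda>x. integral {-1..1} (\<lambda>y. f (cx + hx * x, cy + hy * y)))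
      = integral (cbox (-1, -1) (1, 1)) (\<lambda>(x, y). f (cx + hx * x, cy + hy * y))"
    using integral_prod_continuous[of "-1" "-1" 1 1 "\<lambda>(x, y). f (cx + hx * x, cy + hy * y)"]
    by (simp add: case_prod_beta cont continuous_intros)
  finally have "integral (cbox (cx - hx, cy - hy) (cx + hx, cy + hy)) f
      = hx * hy * integral ({-1..1} \<times> {-1..1}) (\<lambda>(x, y). f (cx + hx * x, cy + hy * y))"
    by (simp add: cbox_Pair_eq)
  then show ?thesis
    using integrable_integral[OF integrable_continuous[OF continuous_on_subset[OF f subset_UNIV]]] by metis
qed

section \<open>One cell\<close>

text \<open>\<open>A\<close> and \<open>A'\<close> are states on opposite sides of the cell,
  \<open>M\<close> and \<open>M'\<close> the traces on the center line, at the same Gauss node. The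
  flux bounds at \<open>A\<close> and \<open>A'\<close> are used with opposite signs, so the terms
  with \<open>w\<close> cancel; those with \<open>\<kappa>\<close> are collected on the left for the
  discrete divergence.\<close>

lemma interface_estimate:
  fixes i :: 3
  assumes ga: "gauge e l c w \<kappa>"
    and G: "A \<in> admissible e" "A' \<in> admissible e" "M \<in> admissible e" "M' \<in> admissible e"
    and \<alpha>: "1 \<le> \<alpha>" "\<bar>mag M $ i - mag M' $ i\<bar> / (2 * sqrt ((rhoh e M + rhoh e M') / 2)) \<le> \<alpha>"
    and t: "0 < t" "t \<le> \<eta>"
  shows "t * \<kappa> * ((mag M $ i - mag M' $ i) - (mag A $ i - mag A' $ i))
    < \<eta> * \<alpha> * ((l A + c) + (l A' + c) + (l M + c) + (l M' + c)) - t * (l (flux e i A) - l (flux e i A'))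
      - t * ((mag M $ i - mag M' $ i) * l (source e ((1 / 2) *\<^sub>R (M + M'))))"
proof -
  define K where "K = \<eta> * \<alpha>"
  have "\<eta> * 1 \<le> K" unfolding K_def using t \<alpha>(1) by (intro mult_left_mono) auto
  then have K: "0 < K" "t \<le> K" using t by auto
  \<comment> \<open>At most \<open>1\<close> because of \<open>t \<le> \<eta>\<close>, the CFL
    condition, and \<open>1 \<le> \<alpha>\<close>.\<close>
  define s where "s = t / K"
  have s: "\<bar>s\<bar> \<le> 1" "\<bar>- s\<bar> \<le> 1" and sK: "K * s = t" using K t by (auto simp: s_def)
  have flux: "0 \<le> l X + c + r * (l (flux e i X) + w $ i * c - mag X $ i * \<kappa>)"
    if "X \<in> admissible e" "\<bar>r\<bar> \<le> 1" for X r
    using ga that unfolding gauge_def by blast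
  have "0 \<le> K * (l A + c + (- s) * (l (flux e i A) + w $ i * c - mag A $ i * \<kappa>))"
    using K flux[OF G(1) s(2)] by (intro mult_nonneg_nonneg) auto
  also have "\<dots> = K * (l A + c) - (K * s) * (l (flux e i A) + w $ i * c - mag A $ i * \<kappa>)"
    by (simp add: algebra_simps)
  finally have 1: "t * (l (flux e i A) + w $ i * c - mag A $ i * \<kappa>) \<le> K * (l A + c)" by (simp add: sK)
  have "0 \<le> K * (l A' + c + s * (l (flux e i A') + w $ i * c - mag A' $ i * \<kappa>))"
    using K flux[OF G(2) s(1)] by (intro mult_nonneg_nonneg) auto
  also have "\<dots> = K * (l A' + c) + (K * s) * (l (flux e i A') + w $ i * c - mag A' $ i * \<kappa>)"
    by (simp add: algebra_simps)
  finally have 2: "0 \<le> K * (l A' + c) + t * (l (flux e i A') + w $ i * c - mag A' $ i * \<kappa>)" by (simp add: sK)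
  define d where "d = mag M $ i - mag M' $ i"
  define N where "N = (1 / 2) *\<^sub>R (M + M')"
  have lin: "linear l" using ga by (simp add: gauge_def)
  have lN: "2 * (l N + c) = (l M + c) + (l M' + c)"
    using lin by (simp add: N_def linear_add linear_scale)
  have pos: "0 < l M + c" "0 < l M' + c" using ga G by (auto simp: gauge_def)
  have "d * (l (source e N) + \<kappa>) < 2 * \<alpha> * (l N + c)"
    using ga G \<alpha> unfolding gauge_def d_def N_def by blast
  then have "t * (d * (l (source e N) + \<kappa>)) < t * (2 * \<alpha> * (l N + c))" using t by simp
  also have "\<dots> = t * \<alpha> * (2 * (l N + c))" by simp
  also have "\<dots> \<le> K * (2 * (l N + c))"
    unfolding K_def lN using t \<alpha>(1) pos by (intro mult_right_mono) auto
  finally have 3: "t * (d * (l (source e N) + \<kappa>)) < K * ((l M + c) + (l M' + c))" unfolding lN .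
  show ?thesis using 1 2 3 unfolding K_def[symmetric] d_def[symmetric] N_def[symmetric]
    by (simp add: algebra_simps)
qed

lemma rect_box: "rect h g (c, d) = box (c - h / 2, d - g / 2) (c + h / 2, d + g / 2)"
  by (auto simp: rect_def mem_box Basis_prod_def)

lemma has_integral_quarters:
  fixes f :: "real \<times> real \<Rightarrow> 'a::banach"
  assumes h: "0 < h" "0 < g"
    and f: "\<And>m s. m \<in> {-1, 1} \<Longrightarrow> s \<in> {-1, 1} \<Longrightarrow>
      (f has_integral I m s) (cbox (a + m * h - h, b + s * g - g) (a + m * h + h, b + s * g + g))"
  shows "(f has_integral (\<Sum>m\<in>{-1, 1}. \<Sum>s\<in>{-1, 1}. I m s)) (cbox (a - 2 * h, b - 2 * g) (a + 2 * h, b + 2 * g))"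
proof -
  have basis: "(0, 1) \<in> (Basis :: (real \<times> real) set)" "(1, 0) \<in> (Basis :: (real \<times> real) set)"
    by (auto simp: Basis_prod_def)
  have col: "(f has_integral I m (-1) + I m 1) (cbox (a + m * h - h, b - 2 * g) (a + m * h + h, b + 2 * g))"
    if m: "m \<in> {-1, 1}" for m
  proof (rule has_integral_split[OF _ _ basis(1), where c=b])
    have "cbox (a + m * h - h, b - 2 * g) (a + m * h + h, b + 2 * g) \<inter> {x. x \<bullet> (0, 1) \<le> b}
        = cbox (a + m * h - h, b + (-1) * g - g) (a + m * h + h, b + (-1) * g + g)"
      using h by (auto simp: cbox_Pair_eq)
    then show "(f has_integral I m (-1)) (cbox (a + m * h - h, b - 2 * g) (a + m * h + h, b + 2 * g) \<inter> {x. x \<bullet> (0, 1) \<le> b})"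
      using f[OF m, of "-1"] by simp
    have "cbox (a + m * h - h, b - 2 * g) (a + m * h + h, b + 2 * g) \<inter> {x. b \<le> x \<bullet> (0, 1)}
        = cbox (a + m * h - h, b + 1 * g - g) (a + m * h + h, b + 1 * g + g)"
      using h by (auto simp: cbox_Pair_eq)
    then show "(f has_integral I m 1) (cbox (a + m * h - h, b - 2 * g) (a + m * h + h, b + 2 * g) \<inter> {x. b \<le> x \<bullet> (0, 1)})"
      using f[OF m, of 1] by simp
  qed
  have "(f has_integral (I (-1) (-1) + I (-1) 1) + (I 1 (-1) + I 1 1)) (cbox (a - 2 * h, b - 2 * g) (a + 2 * h, b + 2 * g))"
  proof (rule has_integral_split[OF _ _ basis(2), where c=a])
    have "cbox (a - 2 * h, b - 2 * g) (a + 2 * h, b + 2 * g) \<inter> {x. x \<bullet> (1, 0) \<le> a}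
        = cbox (a + (-1) * h - h, b - 2 * g) (a + (-1) * h + h, b + 2 * g)"
      using h by (auto simp: cbox_Pair_eq)
    then show "(f has_integral I (-1) (-1) + I (-1) 1) (cbox (a - 2 * h, b - 2 * g) (a + 2 * h, b + 2 * g) \<inter> {x. x \<bullet> (1, 0) \<le> a})"
      using col[of "-1"] by simp
    have "cbox (a - 2 * h, b - 2 * g) (a + 2 * h, b + 2 * g) \<inter> {x. a \<le> x \<bullet> (1, 0)}
        = cbox (a + 1 * h - h, b - 2 * g) (a + 1 * h + h, b + 2 * g)"
      using h by (auto simp: cbox_Pair_eq)
    then show "(f has_integral I 1 (-1) + I 1 1) (cbox (a - 2 * h, b - 2 * g) (a + 2 * h, b + 2 * g) \<inter> {x. a \<le> x \<bullet> (1, 0)})"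
      using col[of 1] by simp
  qed
  then show ?thesis by simp
qed

text \<open>\<open>(a, b)\<close> is the center of a cell, and \<open>P m s\<close> is the polynomial that represents \<open>V\<close> on the cell of
  the other mesh centered at the corner of this cell in direction \<open>(m, s)\<close>.\<close>

locale mesh_cell =
  fixes e :: "real \<Rightarrow> real \<Rightarrow> real" and k S :: nat and \<xi> \<omega> xt yt :: "nat \<Rightarrow> real"
    and dx dy a b :: real and V :: "real \<times> real \<Rightarrow> state"
    and P :: "real \<Rightarrow> real \<Rightarrow> real \<times> real \<Rightarrow> state"
  assumes eos: "eos e" "cold_limit e"
    and mesh: "0 < dx" "0 < dy"
    and gauss: "gauss_rule (k + 1) \<xi> \<omega>"
    and cad_nodes: "\<And>s. s \<in> {1..S} \<Longrightarrow> xt s \<in> {-1..1} \<and> yt s \<in> {-1..1}"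
    and P: "\<And>m s. m \<in> {-1, 1} \<Longrightarrow> s \<in> {-1, 1} \<Longrightarrow> poly2 k (P m s)"
    and VP: "\<And>m s z. m \<in> {-1, 1} \<Longrightarrow> s \<in> {-1, 1} \<Longrightarrow>
      z \<in> rect dx dy (a + m * dx / 2, b + s * dy / 2) \<Longrightarrow> V z = P m s z"
    and div: "\<And>m s x y. m \<in> {-1, 1} \<Longrightarrow> s \<in> {-1, 1} \<Longrightarrow>
      (x, y) \<in> rect dx dy (a + m * dx / 2, b + s * dy / 2) \<Longrightarrow>
      deriv (\<lambda>t. mag (V (t, y)) $ 1) x + deriv (\<lambda>t. mag (V (x, t)) $ 2) y = 0"
    and nodes: "\<And>m s z. m \<in> {-1, 1} \<Longrightarrow> s \<in> {-1, 1} \<Longrightarrow>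
      z \<in> quarter_nodes (k + 1) \<xi> S xt yt dx dy (a + m * dx / 4, b + s * dy / 4) \<Longrightarrow>
      Lim (at z within rect (dx / 2) (dy / 2) (a + m * dx / 4, b + s * dy / 4)) V \<in> admissible e"
begin

section \<open>Traces of the discrete solution on quarter cells\<close>

lemma quarter_subset:
  assumes "m \<in> {-1, 1}" "s \<in> {-1, 1}"
  shows "rect (dx / 2) (dy / 2) (a + m * dx / 4, b + s * dy / 4) \<subseteq> rect dx dy (a + m * dx / 2, b + s * dy / 2)"
  using assms mesh by (auto simp: rect_def)

lemma P_cont: "m \<in> {-1, 1} \<Longrightarrow> s \<in> {-1, 1} \<Longrightarrow> isCont (P m s) z"
  using poly2_continuous[OF P, of m s UNIV] by (cases z) (simp add: continuous_on_eq_continuous_at)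

text \<open>A node may lie on the boundary of its quarter cell, but it is in the closure of this
  open set and hence a limit point. So the hypothesis on limits becomes one on polynomial
  values.\<close>

lemma quarter_limit:
  assumes ms: "m \<in> {-1, 1}" "s \<in> {-1, 1}" and X: "X \<in> {-1..1}" and Y: "Y \<in> {-1..1}"
  defines "z \<equiv> (a + m * dx / 4 + X * dx / 4, b + s * dy / 4 + Y * dy / 4)"
  shows "Lim (at z within rect (dx / 2) (dy / 2) (a + m * dx / 4, b + s * dy / 4)) V = P m s z"
proof (rule tendsto_Lim)
  define R where "R = rect (dx / 2) (dy / 2) (a + m * dx / 4, b + s * dy / 4)"
  have box: "R = box (a + m * dx / 4 - dx / 4, b + s * dy / 4 - dy / 4) (a + m * dx / 4 + dx / 4, b + s * dy / 4 + dy / 4)"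
    by (simp add: R_def rect_box)
  have mono: "T * h \<le> h" "- h \<le> T * h" if "T \<in> {-1..1}" "0 < h" for T h :: real
    using that mult_right_mono[of T 1 h] mult_right_mono[of "-1" T h] by auto
  have "(a + m * dx / 4, b + s * dy / 4) \<in> R" using mesh by (simp add: R_def rect_def)
  then have "closure R = cbox (a + m * dx / 4 - dx / 4, b + s * dy / 4 - dy / 4) (a + m * dx / 4 + dx / 4, b + s * dy / 4 + dy / 4)"
    unfolding box by (intro closure_box) auto
  then have "z \<in> closure R" using mono[OF X mesh(1)] mono[OF Y mesh(2)] by (auto simp: z_def cbox_Pair_eq)
  moreover have "open R" by (simp add: box open_box)
  ultimately have "z islimpt R" using interior_limit_point[of z R] by (auto simp: closure_def interior_open)
  then show "\<not> trivial_limit (at z within rect (dx / 2) (dy / 2) (a + m * dx / 4, b + s * dy / 4))"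
    by (simp add: trivial_limit_within R_def)
  have "(P m s \<longlongrightarrow> P m s z) (at z within R)"
    using P_cont[OF ms, of z] continuous_at_imp_continuous_at_within continuous_within by blast
  moreover have "\<forall>\<^sub>F w in at z within R. P m s w = V w"
    unfolding eventually_at_filter using VP[OF ms] quarter_subset[OF ms] by (auto simp: R_def intro!: always_eventually)
  ultimately show "(V \<longlongrightarrow> P m s z) (at z within rect (dx / 2) (dy / 2) (a + m * dx / 4, b + s * dy / 4))"
    unfolding R_def[symmetric] by (rule Lim_transform_eventually)
qed

lemma \<xi>_range: "\<mu> \<in> {1..k + 1} \<Longrightarrow> \<xi> \<mu> \<in> {-1..1}"
  using gauss_node_weight(2,3)[OF gauss, of \<mu>] by auto

text \<open>The arguments of \<open>P m s\<close> are written as images of reference nodes: \<open>n = m\<close> is the side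
  on the boundary of the cell, \<open>n = -m\<close> the one on its center line.\<close>

lemma node_x:
  assumes "m \<in> {-1, 1}" "s \<in> {-1, 1}" "n \<in> {-1, 1}" "\<mu> \<in> {1..k + 1}"
  shows "P m s (a + m * dx / 4 + dx / 4 * n, b + s * dy / 4 + dy / 4 * \<xi> \<mu>) \<in> admissible e"
proof -
  have z: "(a + m * dx / 4 + n * dx / 4, b + s * dy / 4 + dy / 4 * \<xi> \<mu>)
      \<in> quarter_nodes (k + 1) \<xi> S xt yt dx dy (a + m * dx / 4, b + s * dy / 4)"
    using assms(3,4) unfolding quarter_nodes_def by blast
  have "n \<in> {-1..1}" using assms by auto
  from quarter_limit[OF assms(1,2) this \<xi>_range[OF assms(4)]] nodes[OF assms(1,2) z]
  show ?thesis by (simp add: mult.commute)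
qed

lemma node_y:
  assumes "m \<in> {-1, 1}" "s \<in> {-1, 1}" "n \<in> {-1, 1}" "\<mu> \<in> {1..k + 1}"
  shows "P m s (a + m * dx / 4 + dx / 4 * \<xi> \<mu>, b + s * dy / 4 + dy / 4 * n) \<in> admissible e"
proof -
  have z: "(a + m * dx / 4 + dx / 4 * \<xi> \<mu>, b + s * dy / 4 + n * dy / 4)
      \<in> quarter_nodes (k + 1) \<xi> S xt yt dx dy (a + m * dx / 4, b + s * dy / 4)"
    using assms(3,4) unfolding quarter_nodes_def by blast
  have "n \<in> {-1..1}" using assms by auto
  from quarter_limit[OF assms(1,2) \<xi>_range[OF assms(4)] this] nodes[OF assms(1,2) z]
  show ?thesis by (simp add: mult.commute)
qed

lemma node_interior:
  assumes "m \<in> {-1, 1}" "s \<in> {-1, 1}" "j \<in> {1..S}"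
  shows "P m s (a + m * dx / 4 + dx / 4 * xt j, b + s * dy / 4 + dy / 4 * yt j) \<in> admissible e"
proof -
  have z: "(a + m * dx / 4 + xt j * dx / 4, b + s * dy / 4 + yt j * dy / 4)
      \<in> quarter_nodes (k + 1) \<xi> S xt yt dx dy (a + m * dx / 4, b + s * dy / 4)"
    using assms(3) unfolding quarter_nodes_def by blast
  from quarter_limit[OF assms(1,2), of "xt j" "yt j"] cad_nodes[OF assms(3)] nodes[OF assms(1,2) z]
  show ?thesis by (simp add: mult.commute)
qed

text \<open>Points on an edge of this cell where fluxes are evaluated lie inside open cells of the
  other mesh, so \<open>V\<close> is a single polynomial near them.\<close>

lemma qnode_range:
  assumes "s \<in> {-1, 1}" "\<mu> \<in> {1..k + 1}" "0 < h"
  shows "c + s * h / 2 - h / 2 < qnode \<xi> h c s \<mu>" "qnode \<xi> h c s \<mu> < c + s * h / 2 + h / 2"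
proof -
  define t where "t = h * \<xi> \<mu>"
  have "h * (-1) < t" "t < h * 1"
    unfolding t_def using gauss_node_weight(2,3)[OF gauss assms(2)] assms(3) by (intro mult_strict_left_mono; simp)+
  moreover have "qnode \<xi> h c s \<mu> = c + s * h / 4 + t / 4" by (simp add: qnode_def t_def)
  ultimately show "c + s * h / 2 - h / 2 < qnode \<xi> h c s \<mu>" "qnode \<xi> h c s \<mu> < c + s * h / 2 + h / 2"
    using assms(1,3) by auto
qed

lemma V_edge_x:
  assumes "m \<in> {-1, 1}" "s \<in> {-1, 1}" "\<mu> \<in> {1..k + 1}"
  shows "V (a + m * dx / 2, qnode \<xi> dy b s \<mu>) = P m s (a + m * dx / 2, qnode \<xi> dy b s \<mu>)"
  using qnode_range[OF assms(2,3) mesh(2), of b] mesh by (intro VP[OF assms(1,2)]) (simp add: rect_def)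

lemma V_edge_y:
  assumes "m \<in> {-1, 1}" "s \<in> {-1, 1}" "\<mu> \<in> {1..k + 1}"
  shows "V (qnode \<xi> dx a m \<mu>, b + s * dy / 2) = P m s (qnode \<xi> dx a m \<mu>, b + s * dy / 2)"
  using qnode_range[OF assms(1,3) mesh(1), of a] mesh by (intro VP[OF assms(1,2)]) (simp add: rect_def)

lemma tendsto_x:
  fixes f :: "state \<Rightarrow> 'c::t2_space"
  assumes "s \<in> {-1, 1}" "\<mu> \<in> {1..k + 1}" and f: "continuous_on UNIV f"
  shows "xplus (\<lambda>z. f (V z)) a (qnode \<xi> dy b s \<mu>) = f (P 1 s (a, qnode \<xi> dy b s \<mu>))"
    and "xminus (\<lambda>z. f (V z)) a (qnode \<xi> dy b s \<mu>) = f (P (-1) s (a, qnode \<xi> dy b s \<mu>))"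
proof -
  define y where "y = qnode \<xi> dy b s \<mu>"
  have lim: "((\<lambda>t. f (P m s (t, y))) \<longlongrightarrow> f (P m s (a, y))) (at a within A)" if "m \<in> {-1, 1}" for m A
  proof -
    have "continuous_on UNIV (\<lambda>t. f (P m s (t, y)))"
      by (intro continuous_on_compose2[OF f] continuous_on_compose2[OF poly2_continuous[OF P[OF that assms(1)], of UNIV]] continuous_intros) auto
    then show ?thesis using continuous_on_eq_continuous_at continuous_at_imp_continuous_at_within continuous_within
      by (metis UNIV_I open_UNIV)
  qed
  note y = qnode_range[OF assms(1,2) mesh(2), of b, folded y_def]
  have "\<forall>\<^sub>F t in at_right a. t \<in> {a<..<a + dx}" using mesh by (intro eventually_at_right_real) simp
  then have "\<forall>\<^sub>F t in at_right a. f (P 1 s (t, y)) = f (V (t, y))"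
    by eventually_elim (use y assms(1) in \<open>auto intro!: arg_cong[where f=f] VP[symmetric] simp: rect_def\<close>)
  from Lim_transform_eventually[OF lim this]
  show "xplus (\<lambda>z. f (V z)) a y = f (P 1 s (a, y))"
    unfolding xplus_def by (intro tendsto_Lim) auto
  have "\<forall>\<^sub>F t in at_left a. t \<in> {a - dx<..<a}" using mesh by (intro eventually_at_left_real) simp
  then have "\<forall>\<^sub>F t in at_left a. f (P (-1) s (t, y)) = f (V (t, y))"
    by eventually_elim (use y assms(1) in \<open>auto intro!: arg_cong[where f=f] VP[symmetric] simp: rect_def\<close>)
  from Lim_transform_eventually[OF lim this]
  show "xminus (\<lambda>z. f (V z)) a y = f (P (-1) s (a, y))"
    unfolding xminus_def by (intro tendsto_Lim) auto
qed

lemma tendsto_y: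
  fixes f :: "state \<Rightarrow> 'c::t2_space"
  assumes "m \<in> {-1, 1}" "\<mu> \<in> {1..k + 1}" and f: "continuous_on UNIV f"
  shows "yplus (\<lambda>z. f (V z)) (qnode \<xi> dx a m \<mu>) b = f (P m 1 (qnode \<xi> dx a m \<mu>, b))"
    and "yminus (\<lambda>z. f (V z)) (qnode \<xi> dx a m \<mu>) b = f (P m (-1) (qnode \<xi> dx a m \<mu>, b))"
proof -
  define x where "x = qnode \<xi> dx a m \<mu>"
  have lim: "((\<lambda>t. f (P m s (x, t))) \<longlongrightarrow> f (P m s (x, b))) (at b within A)" if "s \<in> {-1, 1}" for s A
  proof -
    have "continuous_on UNIV (\<lambda>t. f (P m s (x, t)))"
      by (intro continuous_on_compose2[OF f] continuous_on_compose2[OF poly2_continuous[OF P[OF assms(1) that], of UNIV]] continuous_intros) auto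
    then show ?thesis using continuous_on_eq_continuous_at continuous_at_imp_continuous_at_within continuous_within
      by (metis UNIV_I open_UNIV)
  qed
  note x = qnode_range[OF assms(1,2) mesh(1), of a, folded x_def]
  have "\<forall>\<^sub>F t in at_right b. t \<in> {b<..<b + dy}" using mesh by (intro eventually_at_right_real) simp
  then have "\<forall>\<^sub>F t in at_right b. f (P m 1 (x, t)) = f (V (x, t))"
    by eventually_elim (use x assms(1) in \<open>auto intro!: arg_cong[where f=f] VP[symmetric] simp: rect_def\<close>)
  from Lim_transform_eventually[OF lim this]
  show "yplus (\<lambda>z. f (V z)) x b = f (P m 1 (x, b))"
    unfolding yplus_def by (intro tendsto_Lim) auto
  have "\<forall>\<^sub>F t in at_left b. t \<in> {b - dy<..<b}" using mesh by (intro eventually_at_left_real) simp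
  then have "\<forall>\<^sub>F t in at_left b. f (P m (-1) (x, t)) = f (V (x, t))"
    by eventually_elim (use x assms(1) in \<open>auto intro!: arg_cong[where f=f] VP[symmetric] simp: rect_def\<close>)
  from Lim_transform_eventually[OF lim this]
  show "yminus (\<lambda>z. f (V z)) x b = f (P m (-1) (x, b))"
    unfolding yminus_def by (intro tendsto_Lim) auto
qed

end

lemma sum_pm1: "(\<Sum>m\<in>{-1, 1}. f m) = f (-1) + f (1::real)" for f :: "real \<Rightarrow> 'a::comm_monoid_add"
  by simp

section \<open>Edge states, discrete divergence and cell averages\<close>

context mesh_cell begin

text \<open>\<open>o\<close> is the outer side, on the boundary of the cell, \<open>i\<close> the
  inner one, on a center line; \<open>x\<close> and \<open>y\<close> give the normal direction. In
  all four, \<open>(m, s)\<close> names the quarter cell.\<close>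

definition xo :: "real \<Rightarrow> real \<Rightarrow> nat \<Rightarrow> state" where "xo m s \<mu> = P m s (a + m * dx / 2, qnode \<xi> dy b s \<mu>)"
definition xi :: "real \<Rightarrow> real \<Rightarrow> nat \<Rightarrow> state" where "xi m s \<mu> = P m s (a, qnode \<xi> dy b s \<mu>)"
definition yo :: "real \<Rightarrow> real \<Rightarrow> nat \<Rightarrow> state" where "yo m s \<mu> = P m s (qnode \<xi> dx a m \<mu>, b + s * dy / 2)"
definition yi :: "real \<Rightarrow> real \<Rightarrow> nat \<Rightarrow> state" where "yi m s \<mu> = P m s (qnode \<xi> dx a m \<mu>, b)"

lemma side_x: "c + m * h / 4 + h / 4 * m = c + m * h / 2" and center_x: "c + m * h / 4 + h / 4 * (- m) = c"
  for c m h :: real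
  by (simp_all add: field_simps)

lemma xo_eq: "xo m s \<mu> = P m s (a + m * dx / 4 + dx / 4 * m, b + s * dy / 4 + dy / 4 * \<xi> \<mu>)"
  and xi_eq: "xi m s \<mu> = P m s (a + m * dx / 4 + dx / 4 * (- m), b + s * dy / 4 + dy / 4 * \<xi> \<mu>)"
  and yo_eq: "yo m s \<mu> = P m s (a + m * dx / 4 + dx / 4 * \<xi> \<mu>, b + s * dy / 4 + dy / 4 * s)"
  and yi_eq: "yi m s \<mu> = P m s (a + m * dx / 4 + dx / 4 * \<xi> \<mu>, b + s * dy / 4 + dy / 4 * (- s))"
  unfolding side_x center_x by (simp_all add: xo_def xi_def yo_def yi_def qnode_def)

lemma edge_admissible:
  assumes "m \<in> {-1, 1}" "s \<in> {-1, 1}" "\<mu> \<in> {1..k + 1}"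
  shows "xo m s \<mu> \<in> admissible e" "xi m s \<mu> \<in> admissible e" "yo m s \<mu> \<in> admissible e" "yi m s \<mu> \<in> admissible e"
proof -
  have neg: "- m \<in> {-1, 1}" "- s \<in> {-1, 1}" using assms by auto
  show "xo m s \<mu> \<in> admissible e" "xi m s \<mu> \<in> admissible e" "yo m s \<mu> \<in> admissible e" "yi m s \<mu> \<in> admissible e"
    unfolding xo_eq xi_eq yo_eq yi_eq
    by (fact node_x[OF assms(1,2,1,3)] node_x[OF assms(1,2) neg(1) assms(3)]
        node_y[OF assms(1,2,2,3)] node_y[OF assms(1,2) neg(2) assms(3)])+
qed

text \<open>A quarter cell lies in one cell of the other mesh, where the field is a divergence-free
  polynomial. The factors \<open>m\<close> and \<open>s\<close> orient the sides: the outer side is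
  the right or upper one only for the sign \<open>1\<close>.\<close>

lemma edge_divergence:
  assumes ms: "m \<in> {-1, 1}" "s \<in> {-1, 1}"
  shows "m * ((\<Sum>\<mu>=1..k+1. \<omega> \<mu> * mag (xo m s \<mu>) $ 1) - (\<Sum>\<mu>=1..k+1. \<omega> \<mu> * mag (xi m s \<mu>) $ 1)) / dx
       + s * ((\<Sum>\<mu>=1..k+1. \<omega> \<mu> * mag (yo m s \<mu>) $ 2) - (\<Sum>\<mu>=1..k+1. \<omega> \<mu> * mag (yi m s \<mu>) $ 2)) / dy = 0"
proof -
  define f where "f i = (\<lambda>z. mag (P m s z) $ i)" for i :: 3
  have lin: "linear (\<lambda>U. mag U $ i)" for i :: 3
    by (rule linearI) (simp_all add: mag_add mag_scale)
  have f: "poly2 k (f i)" for i unfolding f_def by (rule poly2_linear[OF lin P[OF ms]])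
  define cx where "cx = a + m * dx / 4"
  define cy where "cy = b + s * dy / 4"
  define R where "R = rect dx dy (a + m * dx / 2, b + s * dy / 2)"
  have "(\<Sum>\<mu>=1..k+1. \<omega> \<mu> * (f 1 (cx + dx / 4, cy + dy / 4 * \<xi> \<mu>) - f 1 (cx - dx / 4, cy + dy / 4 * \<xi> \<mu>))) / (dx / 4)
      + (\<Sum>\<mu>=1..k+1. \<omega> \<mu> * (f 2 (cx + dx / 4 * \<xi> \<mu>, cy + dy / 4) - f 2 (cx + dx / 4 * \<xi> \<mu>, cy - dy / 4))) / (dy / 4) = 0"
  proof (rule gauss_divergence[OF gauss f f])
    fix x y assume "cx - dx / 4 < x" "x < cx + dx / 4" "cy - dy / 4 < y" "y < cy + dy / 4"
    then have xy: "(x, y) \<in> R" using ms mesh by (auto simp: R_def rect_def cx_def cy_def)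
    have op: "open R" by (simp add: R_def rect_box open_box)
    have nx: "\<forall>\<^sub>F t in nhds x. (t, y) \<in> R"
    proof -
      have "open ((\<lambda>t. (t, y)) -` R)" by (intro open_vimage op continuous_intros)
      then show ?thesis using eventually_nhds_in_open[of "(\<lambda>t. (t, y)) -` R" x] xy by simp
    qed
    have ny: "\<forall>\<^sub>F t in nhds y. (x, t) \<in> R"
    proof -
      have "open ((\<lambda>t. (x, t)) -` R)" by (intro open_vimage op continuous_intros)
      then show ?thesis using eventually_nhds_in_open[of "(\<lambda>t. (x, t)) -` R" y] xy by simp
    qed
    have "deriv (\<lambda>t. f 1 (t, y)) x = deriv (\<lambda>t. mag (V (t, y)) $ 1) x"
      by (rule deriv_cong_ev[OF eventually_mono[OF nx] refl]) (simp add: f_def VP[OF ms] R_def)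
    moreover have "deriv (\<lambda>t. f 2 (x, t)) y = deriv (\<lambda>t. mag (V (x, t)) $ 2) y"
      by (rule deriv_cong_ev[OF eventually_mono[OF ny] refl]) (simp add: f_def VP[OF ms] R_def)
    ultimately show "deriv (\<lambda>t. f 1 (t, y)) x + deriv (\<lambda>t. f 2 (x, t)) y = 0"
      using div[OF ms] xy by (simp add: R_def)
  qed (use mesh in auto)
  then have main: "(\<Sum>\<mu>=1..k+1. \<omega> \<mu> * (f 1 (cx + dx / 4, cy + dy / 4 * \<xi> \<mu>) - f 1 (cx - dx / 4, cy + dy / 4 * \<xi> \<mu>))) / dx
      + (\<Sum>\<mu>=1..k+1. \<omega> \<mu> * (f 2 (cx + dx / 4 * \<xi> \<mu>, cy + dy / 4) - f 2 (cx + dx / 4 * \<xi> \<mu>, cy - dy / 4))) / dy = 0"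
  proof (rule rev_mp)
    have "X / (dx / 4) + Y / (dy / 4) = 4 * (X / dx + Y / dy)" for X Y by (simp add: algebra_simps)
    then show "X / (dx / 4) + Y / (dy / 4) = 0 \<longrightarrow> X / dx + Y / dy = 0" for X Y by simp
  qed
  have "f 1 (cx + dx / 4, cy + dy / 4 * \<xi> \<mu>) - f 1 (cx - dx / 4, cy + dy / 4 * \<xi> \<mu>) = m * (mag (xo m s \<mu>) $ 1 - mag (xi m s \<mu>) $ 1)" for \<mu>
    using ms unfolding xo_eq xi_eq by (auto simp: f_def cx_def cy_def)
  moreover have "f 2 (cx + dx / 4 * \<xi> \<mu>, cy + dy / 4) - f 2 (cx + dx / 4 * \<xi> \<mu>, cy - dy / 4) = s * (mag (yo m s \<mu>) $ 2 - mag (yi m s \<mu>) $ 2)" for \<mu>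
    using ms unfolding yo_eq yi_eq by (auto simp: f_def cx_def cy_def)
  ultimately show ?thesis using main
    by (simp add: sum_subtractf[symmetric] sum_distrib_left right_diff_distrib mult.left_commute del: sum.cl_ivl_Suc)
qed

lemma cell_avg_cad:
  assumes cad: "feasible_cad k (k + 1) \<xi> \<omega> lam1 lam2 \<omega>bar S \<omega>t xt yt" and l: "linear l"
  shows "l (cell_avg dx dy V (a, b)) = (1 / 4) * (\<Sum>m\<in>{-1, 1}. \<Sum>s\<in>{-1, 1}.
    \<omega>bar * (\<Sum>\<mu>=1..k+1. \<omega> \<mu> * (lam1 / (lam1 + lam2) * (l (xo m s \<mu>) + l (xi m s \<mu>))
        + lam2 / (lam1 + lam2) * (l (yo m s \<mu>) + l (yi m s \<mu>))))
      + (\<Sum>j=1..S. \<omega>t j * l (P m s (a + m * dx / 4 + dx / 4 * xt j, b + s * dy / 4 + dy / 4 * yt j))))"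
proof -
  have bl: "bounded_linear l" using l linear_conv_bounded_linear by blast
  define g where "g m s = (\<lambda>(x, y). l (P m s (a + m * dx / 4 + dx / 4 * x, b + s * dy / 4 + dy / 4 * y)))" for m s
  define I where "I m s = \<omega>bar * (\<Sum>\<mu>=1..k+1. \<omega> \<mu> * (lam1 / (lam1 + lam2) * (l (xo m s \<mu>) + l (xi m s \<mu>))
        + lam2 / (lam1 + lam2) * (l (yo m s \<mu>) + l (yi m s \<mu>))))
      + (\<Sum>j=1..S. \<omega>t j * l (P m s (a + m * dx / 4 + dx / 4 * xt j, b + s * dy / 4 + dy / 4 * yt j)))" for m s
  have box: "cbox (a + m * (dx / 4) - dx / 4, b + s * (dy / 4) - dy / 4) (a + m * (dx / 4) + dx / 4, b + s * (dy / 4) + dy / 4)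
      = cbox (a + m * dx / 4 - dx / 4, b + s * dy / 4 - dy / 4) (a + m * dx / 4 + dx / 4, b + s * dy / 4 + dy / 4)" for m s
    by simp
  have VPq: "V z = P m s z"
    if "m \<in> {-1, 1}" "s \<in> {-1, 1}"
      "z \<in> box (a + m * dx / 4 - dx / 4, b + s * dy / 4 - dy / 4) (a + m * dx / 4 + dx / 4, b + s * dy / 4 + dy / 4)" for m s z
  proof (rule VP[OF that(1,2) subsetD[OF quarter_subset[OF that(1,2)]]])
    show "z \<in> rect (dx / 2) (dy / 2) (a + m * dx / 4, b + s * dy / 4)" using that(3) by (simp add: rect_box)
  qed
  \<comment> \<open>Integrability of the vector-valued \<open>V\<close> is recorded first, in order
    to move \<open>l\<close> through the integral; the value is then computed for
    \<open>l \<circ> V\<close>.\<close>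
  have "(V has_integral (\<Sum>m\<in>{-1, 1}. \<Sum>s\<in>{-1, 1}. integral (cbox (a + m * dx / 4 - dx / 4, b + s * dy / 4 - dy / 4) (a + m * dx / 4 + dx / 4, b + s * dy / 4 + dy / 4)) (P m s)))
      (cbox (a - 2 * (dx / 4), b - 2 * (dy / 4)) (a + 2 * (dx / 4), b + 2 * (dy / 4)))"
  proof (rule has_integral_quarters)
    fix m s :: real assume ms: "m \<in> {-1, 1}" "s \<in> {-1, 1}"
    show "(V has_integral integral (cbox (a + m * dx / 4 - dx / 4, b + s * dy / 4 - dy / 4) (a + m * dx / 4 + dx / 4, b + s * dy / 4 + dy / 4)) (P m s))
      (cbox (a + m * (dx / 4) - dx / 4, b + s * (dy / 4) - dy / 4) (a + m * (dx / 4) + dx / 4, b + s * (dy / 4) + dy / 4))"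
      unfolding box
      by (rule has_integral_spike_interior[OF integrable_integral[OF integrable_continuous[OF poly2_continuous[OF P[OF ms]]]] VPq[OF ms]])
  qed (use mesh in auto)
  then have V_int: "V integrable_on rect dx dy (a, b)"
    unfolding rect_box integrable_on_open_interval by (auto simp: integrable_on_def)
  have "(l \<circ> V has_integral (\<Sum>m\<in>{-1, 1}. \<Sum>s\<in>{-1, 1}. dx / 4 * (dy / 4) * (4 * I m s)))
      (cbox (a - 2 * (dx / 4), b - 2 * (dy / 4)) (a + 2 * (dx / 4), b + 2 * (dy / 4)))"
  proof (rule has_integral_quarters)
    fix m s :: real assume ms: "m \<in> {-1, 1}" "s \<in> {-1, 1}"
    have plP: "poly2 k (\<lambda>z. l (P m s z))" by (rule poly2_linear[OF l P[OF ms]])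
    have "poly2 k (g m s)" unfolding g_def by (rule poly2_affine[OF plP])
    then have "integral ({-1..1} \<times> {-1..1}) (g m s) / 4 =
          \<omega>bar * (\<Sum>\<mu>=1..k+1. \<omega> \<mu> *
            (lam1 / (lam1 + lam2) * (g m s (-1, \<xi> \<mu>) + g m s (1, \<xi> \<mu>)) +
             lam2 / (lam1 + lam2) * (g m s (\<xi> \<mu>, -1) + g m s (\<xi> \<mu>, 1))))
          + (\<Sum>j=1..S. \<omega>t j * g m s (xt j, yt j))"
      using cad unfolding feasible_cad_def by blast
    moreover have "g m s (-1, \<xi> \<mu>) + g m s (1, \<xi> \<mu>) = l (xo m s \<mu>) + l (xi m s \<mu>)" for \<mu>
      using ms unfolding xo_eq xi_eq g_def by auto
    moreover have "g m s (\<xi> \<mu>, -1) + g m s (\<xi> \<mu>, 1) = l (yo m s \<mu>) + l (yi m s \<mu>)" for \<mu>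
      using ms unfolding yo_eq yi_eq g_def by auto
    ultimately have "integral ({-1..1} \<times> {-1..1}) (g m s) = 4 * I m s"
      by (simp add: I_def g_def)
    moreover have "((\<lambda>z. l (P m s z)) has_integral dx / 4 * (dy / 4) * integral ({-1..1} \<times> {-1..1}) (g m s))
        (cbox (a + m * dx / 4 - dx / 4, b + s * dy / 4 - dy / 4) (a + m * dx / 4 + dx / 4, b + s * dy / 4 + dy / 4))"
      unfolding g_def using mesh by (intro has_integral_rect_affine poly2_continuous[OF plP]) auto
    ultimately have "((\<lambda>z. l (P m s z)) has_integral dx / 4 * (dy / 4) * (4 * I m s))
        (cbox (a + m * dx / 4 - dx / 4, b + s * dy / 4 - dy / 4) (a + m * dx / 4 + dx / 4, b + s * dy / 4 + dy / 4))" by simp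
    then show "(l \<circ> V has_integral dx / 4 * (dy / 4) * (4 * I m s))
      (cbox (a + m * (dx / 4) - dx / 4, b + s * (dy / 4) - dy / 4) (a + m * (dx / 4) + dx / 4, b + s * (dy / 4) + dy / 4))"
      unfolding box by (rule has_integral_spike_interior) (simp add: VPq[OF ms])
  qed (use mesh in auto)
  then have "integral (rect dx dy (a, b)) (l \<circ> V) = (\<Sum>m\<in>{-1, 1}. \<Sum>s\<in>{-1, 1}. dx / 4 * (dy / 4) * (4 * I m s))"
    unfolding rect_box integral_open_interval by (simp add: integral_unique)
  then have "l (integral (rect dx dy (a, b)) V) = dx * dy * ((1 / 4) * (\<Sum>m\<in>{-1, 1}. \<Sum>s\<in>{-1, 1}. I m s))"
    using integral_linear[OF V_int bl] by (simp add: field_simps)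
  then show ?thesis
    using mesh unfolding cell_avg_def I_def[symmetric] by (simp add: linear_scale[OF l])
qed

text \<open>The interior nodes contribute nonnegatively and are dropped. The constant
  \<open>c\<close> can be spread over all nodes because the Gauss weights, and the weights of the
  decomposition, sum to \<open>1\<close>.\<close>

lemma cell_avg_lower:
  assumes cad: "feasible_cad k (k + 1) \<xi> \<omega> lam1 lam2 \<omega>bar S \<omega>t xt yt" and ga: "gauge e l c w \<kappa>"
  shows "\<omega>bar / 4 * (\<Sum>m\<in>{-1, 1}. \<Sum>s\<in>{-1, 1}. \<Sum>\<mu>=1..k+1. \<omega> \<mu> *
      (lam1 / (lam1 + lam2) * ((l (xo m s \<mu>) + c) + (l (xi m s \<mu>) + c))
        + lam2 / (lam1 + lam2) * ((l (yo m s \<mu>) + c) + (l (yi m s \<mu>) + c))))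
    \<le> l (cell_avg dx dy V (a, b)) + c"
proof -
  have l: "linear l" using ga by (simp add: gauge_def)
  define r1 where "r1 = lam1 / (lam1 + lam2)"
  define r2 where "r2 = lam2 / (lam1 + lam2)"
  have "0 < lam1 + lam2" and cw: "2 * \<omega>bar + (\<Sum>j=1..S. \<omega>t j) = 1" and wt: "\<And>j. j \<in> {1..S} \<Longrightarrow> 0 \<le> \<omega>t j"
    using cad by (auto simp: feasible_cad_def)
  then have r: "r1 + r2 = 1" by (simp add: r1_def r2_def add_divide_distrib[symmetric])
  define N where "N m s j = P m s (a + m * dx / 4 + dx / 4 * xt j, b + s * dy / 4 + dy / 4 * yt j)" for m s j
  have each: "\<omega>bar * (\<Sum>\<mu>=1..k+1. \<omega> \<mu> * (r1 * ((l (xo m s \<mu>) + c) + (l (xi m s \<mu>) + c))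
        + r2 * ((l (yo m s \<mu>) + c) + (l (yi m s \<mu>) + c))))
    \<le> \<omega>bar * (\<Sum>\<mu>=1..k+1. \<omega> \<mu> * (r1 * (l (xo m s \<mu>) + l (xi m s \<mu>)) + r2 * (l (yo m s \<mu>) + l (yi m s \<mu>))))
      + (\<Sum>j=1..S. \<omega>t j * l (N m s j)) + c" if ms: "m \<in> {-1, 1}" "s \<in> {-1, 1}" for m s
  proof -
    have "\<omega> \<mu> * (r1 * ((l (xo m s \<mu>) + c) + (l (xi m s \<mu>) + c)) + r2 * ((l (yo m s \<mu>) + c) + (l (yi m s \<mu>) + c)))
      = \<omega> \<mu> * (r1 * (l (xo m s \<mu>) + l (xi m s \<mu>)) + r2 * (l (yo m s \<mu>) + l (yi m s \<mu>))) + \<omega> \<mu> * (2 * c)" for \<mu>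
    proof -
      have "r1 * ((A + c) + (B + c)) + r2 * ((C + c) + (D + c)) = (r1 * (A + B) + r2 * (C + D)) + (r1 + r2) * (2 * c)"
        for A B C D by (simp add: algebra_simps)
      then show ?thesis by (simp only: r mult_1_left distrib_left[of "\<omega> \<mu>"])
    qed
    then have "(\<Sum>\<mu>=1..k+1. \<omega> \<mu> * (r1 * ((l (xo m s \<mu>) + c) + (l (xi m s \<mu>) + c)) + r2 * ((l (yo m s \<mu>) + c) + (l (yi m s \<mu>) + c))))
      = (\<Sum>\<mu>=1..k+1. \<omega> \<mu> * (r1 * (l (xo m s \<mu>) + l (xi m s \<mu>)) + r2 * (l (yo m s \<mu>) + l (yi m s \<mu>))))
        + (\<Sum>\<mu>=1..k+1. \<omega> \<mu>) * (2 * c)"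
      by (simp only: sum.distrib sum_distrib_right)
    moreover have "0 \<le> (\<Sum>j=1..S. \<omega>t j * (l (N m s j) + c))"
    proof (intro sum_nonneg mult_nonneg_nonneg wt)
      fix j assume "j \<in> {1..S}"
      then have "N m s j \<in> admissible e" unfolding N_def by (rule node_interior[OF ms])
      then show "0 \<le> l (N m s j) + c" using ga by (auto simp: gauge_def less_imp_le)
    qed
    moreover have "(\<Sum>j=1..S. \<omega>t j * (l (N m s j) + c)) = (\<Sum>j=1..S. \<omega>t j * l (N m s j)) + (1 - 2 * \<omega>bar) * c"
    proof -
      have "(\<Sum>j=1..S. \<omega>t j) = 1 - 2 * \<omega>bar" using cw by simp
      then show ?thesis by (simp only: distrib_left sum.distrib sum_distrib_right[symmetric])
    qed
    ultimately show ?thesis using gauss_weight_sum[OF gauss] by (simp add: algebra_simps del: sum.cl_ivl_Suc)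
  qed
  show ?thesis
    unfolding cell_avg_cad[OF cad l] r1_def[symmetric] r2_def[symmetric] N_def[symmetric] sum_pm1
    using each[of "-1" "-1"] each[of "-1" 1] each[of 1 "-1"] each[of 1 1]
    by (simp add: algebra_simps del: sum.cl_ivl_Suc)
qed

section \<open>The updated cell average\<close>

lemma V_values:
  assumes "s \<in> {-1, 1}" "\<mu> \<in> {1..k + 1}"
  shows "V (a + dx / 2, qnode \<xi> dy b s \<mu>) = xo 1 s \<mu>" "V (a - dx / 2, qnode \<xi> dy b s \<mu>) = xo (-1) s \<mu>"
    and "V (qnode \<xi> dx a s \<mu>, b + dy / 2) = yo s 1 \<mu>" "V (qnode \<xi> dx a s \<mu>, b - dy / 2) = yo s (-1) \<mu>"
  using V_edge_x[of 1 s \<mu>] V_edge_x[of "-1" s \<mu>] V_edge_y[of s 1 \<mu>] V_edge_y[of s "-1" \<mu>] assms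
  by (simp_all add: xo_def yo_def)

lemma jump_values:
  assumes s: "s \<in> {-1, 1}" and \<mu>: "\<mu> \<in> {1..k + 1}"
  shows "xjump (\<lambda>z. mag (V z) $ 1) a (qnode \<xi> dy b s \<mu>) = mag (xi 1 s \<mu>) $ 1 - mag (xi (-1) s \<mu>) $ 1"
    and "xmean V a (qnode \<xi> dy b s \<mu>) = (1 / 2) *\<^sub>R (xi 1 s \<mu> + xi (-1) s \<mu>)"
    and "yjump (\<lambda>z. mag (V z) $ 2) (qnode \<xi> dx a s \<mu>) b = mag (yi s 1 \<mu>) $ 2 - mag (yi s (-1) \<mu>) $ 2"
    and "ymean V (qnode \<xi> dx a s \<mu>) b = (1 / 2) *\<^sub>R (yi s 1 \<mu> + yi s (-1) \<mu>)"
    and "xratio e V a (qnode \<xi> dy b s \<mu>) = \<bar>mag (xi 1 s \<mu>) $ 1 - mag (xi (-1) s \<mu>) $ 1\<bar> /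
      (2 * sqrt ((rhoh e (xi 1 s \<mu>) + rhoh e (xi (-1) s \<mu>)) / 2))"
    and "yratio e V (qnode \<xi> dx a s \<mu>) b = \<bar>mag (yi s 1 \<mu>) $ 2 - mag (yi s (-1) \<mu>) $ 2\<bar> /
      (2 * sqrt ((rhoh e (yi s 1 \<mu>) + rhoh e (yi s (-1) \<mu>)) / 2))"
proof -
  have cont: "continuous_on UNIV (\<lambda>U. mag U $ i)" for i :: 3
    by (intro linear_continuous_on linear_conv_bounded_linear[THEN iffD1] linearI)
      (simp_all add: mag_add mag_scale)
  note x = tendsto_x[OF s \<mu> cont[of 1]] tendsto_x[OF s \<mu> continuous_on_id]
  note y = tendsto_y[OF s \<mu> cont[of 2]] tendsto_y[OF s \<mu> continuous_on_id]
  show "xjump (\<lambda>z. mag (V z) $ 1) a (qnode \<xi> dy b s \<mu>) = mag (xi 1 s \<mu>) $ 1 - mag (xi (-1) s \<mu>) $ 1"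
    "xmean V a (qnode \<xi> dy b s \<mu>) = (1 / 2) *\<^sub>R (xi 1 s \<mu> + xi (-1) s \<mu>)"
    "yjump (\<lambda>z. mag (V z) $ 2) (qnode \<xi> dx a s \<mu>) b = mag (yi s 1 \<mu>) $ 2 - mag (yi s (-1) \<mu>) $ 2"
    "ymean V (qnode \<xi> dx a s \<mu>) b = (1 / 2) *\<^sub>R (yi s 1 \<mu> + yi s (-1) \<mu>)"
    "xratio e V a (qnode \<xi> dy b s \<mu>) = \<bar>mag (xi 1 s \<mu>) $ 1 - mag (xi (-1) s \<mu>) $ 1\<bar> /
      (2 * sqrt ((rhoh e (xi 1 s \<mu>) + rhoh e (xi (-1) s \<mu>)) / 2))"
    "yratio e V (qnode \<xi> dx a s \<mu>) b = \<bar>mag (yi s 1 \<mu>) $ 2 - mag (yi s (-1) \<mu>) $ 2\<bar> /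
      (2 * sqrt ((rhoh e (yi s 1 \<mu>) + rhoh e (yi s (-1) \<mu>)) / 2))"
    using x y by (simp_all add: xjump_def xmean_def yjump_def ymean_def xratio_def yratio_def xi_def yi_def)
qed

lemma update_functional:
  assumes l: "linear l"
  shows "l (cell_avg dx dy U (a, b) + dt *\<^sub>R L_op e (k + 1) \<xi> \<omega> dx dy \<tau> U V (a, b))
    = l (cell_avg dx dy U (a, b)) + dt * ((l (cell_avg dx dy V (a, b)) - l (cell_avg dx dy U (a, b))) / \<tau>
      - (\<Sum>s\<in>{-1, 1}. \<Sum>\<mu>=1..k+1. \<omega> \<mu> * (l (flux e 1 (xo 1 s \<mu>)) - l (flux e 1 (xo (-1) s \<mu>)))) / (2 * dx)
      - (\<Sum>m\<in>{-1, 1}. \<Sum>\<mu>=1..k+1. \<omega> \<mu> * (l (flux e 2 (yo m 1 \<mu>)) - l (flux e 2 (yo m (-1) \<mu>)))) / (2 * dy)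
      - (\<Sum>s\<in>{-1, 1}. \<Sum>\<mu>=1..k+1. \<omega> \<mu> * ((mag (xi 1 s \<mu>) $ 1 - mag (xi (-1) s \<mu>) $ 1)
          * l (source e ((1 / 2) *\<^sub>R (xi 1 s \<mu> + xi (-1) s \<mu>))))) / (2 * dx)
      - (\<Sum>m\<in>{-1, 1}. \<Sum>\<mu>=1..k+1. \<omega> \<mu> * ((mag (yi m 1 \<mu>) $ 2 - mag (yi m (-1) \<mu>) $ 2)
          * l (source e ((1 / 2) *\<^sub>R (yi m 1 \<mu> + yi m (-1) \<mu>))))) / (2 * dy))"
proof -
  have F1: "(\<Sum>m\<in>{-1, 1}. \<Sum>\<mu>=1..k+1. (\<omega> \<mu> / 2) *\<^sub>R
         (flux e 1 (V (a + dx / 2, qnode \<xi> dy b m \<mu>)) - flux e 1 (V (a - dx / 2, qnode \<xi> dy b m \<mu>))))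
      = (\<Sum>m\<in>{-1, 1}. \<Sum>\<mu>=1..k+1. (\<omega> \<mu> / 2) *\<^sub>R (flux e 1 (xo 1 m \<mu>) - flux e 1 (xo (-1) m \<mu>)))"
    by (intro sum.cong refl) (simp only: V_values)
  have F2: "(\<Sum>m\<in>{-1, 1}. \<Sum>\<mu>=1..k+1. (\<omega> \<mu> / 2) *\<^sub>R
         (flux e 2 (V (qnode \<xi> dx a m \<mu>, b + dy / 2)) - flux e 2 (V (qnode \<xi> dx a m \<mu>, b - dy / 2))))
      = (\<Sum>m\<in>{-1, 1}. \<Sum>\<mu>=1..k+1. (\<omega> \<mu> / 2) *\<^sub>R (flux e 2 (yo m 1 \<mu>) - flux e 2 (yo m (-1) \<mu>)))"
    by (intro sum.cong refl) (simp only: V_values)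
  have S1: "(\<Sum>m\<in>{-1, 1}. \<Sum>\<mu>=1..k+1.
          (\<omega> \<mu> / 2 * xjump (\<lambda>z. mag (V z) $ 1) a (qnode \<xi> dy b m \<mu>)) *\<^sub>R
          source e (xmean V a (qnode \<xi> dy b m \<mu>)))
      = (\<Sum>m\<in>{-1, 1}. \<Sum>\<mu>=1..k+1. (\<omega> \<mu> / 2 * (mag (xi 1 m \<mu>) $ 1 - mag (xi (-1) m \<mu>) $ 1)) *\<^sub>R
          source e ((1 / 2) *\<^sub>R (xi 1 m \<mu> + xi (-1) m \<mu>)))"
    by (intro sum.cong refl) (simp only: jump_values)
  have S2: "(\<Sum>m\<in>{-1, 1}. \<Sum>\<mu>=1..k+1.
          (\<omega> \<mu> / 2 * yjump (\<lambda>z. mag (V z) $ 2) (qnode \<xi> dx a m \<mu>) b) *\<^sub>R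
          source e (ymean V (qnode \<xi> dx a m \<mu>) b))
      = (\<Sum>m\<in>{-1, 1}. \<Sum>\<mu>=1..k+1. (\<omega> \<mu> / 2 * (mag (yi m 1 \<mu>) $ 2 - mag (yi m (-1) \<mu>) $ 2)) *\<^sub>R
          source e ((1 / 2) *\<^sub>R (yi m 1 \<mu> + yi m (-1) \<mu>)))"
    by (intro sum.cong refl) (simp only: jump_values)
  have half: "(\<Sum>m\<in>{-1, 1::real}. \<Sum>\<mu>=1..k+1. \<omega> \<mu> / 2 * f m \<mu>) = (\<Sum>m\<in>{-1, 1}. \<Sum>\<mu>=1..k+1. \<omega> \<mu> * f m \<mu>) / 2" for f
    by (simp only: sum_divide_distrib times_divide_eq_left)
  note lin = linear_add[OF l] linear_diff[OF l] linear_scale[OF l] linear_sum[OF l] linear_neg[OF l]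
  have arith: "x + dt * (1 / \<tau> * (v - x) - 1 / dx * (A / 2) - 1 / dy * (B / 2) + (- (1 / dx * (C / 2)) - 1 / dy * (D / 2)))
      = x + dt * ((v - x) / \<tau> - A / (2 * dx) - B / (2 * dy) - C / (2 * dx) - D / (2 * dy))" for x v A B C D
    by simp
  show ?thesis
    unfolding L_op_def H_op_def S_op_def prod.case F1 F2 S1 S2 lin real_scaleR_def mult.assoc half
    by (rule arith)
qed

text \<open>The old average keeps the weight \<open>1 - \<theta>\<close>. The average of
  \<open>V\<close>, with weight \<open>\<theta>\<close>, pays for fluxes and sources by its values
  on the sides of the quarter cells.\<close>

lemma update_admissible:
  assumes cad: "feasible_cad k (k + 1) \<xi> \<omega> (\<alpha>1 / dx) (\<alpha>2 / dy) \<omega>bar S \<omega>t xt yt"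
    and U: "cell_avg dx dy U (a, b) \<in> admissible e"
    and \<alpha>: "1 \<le> \<alpha>1" "1 \<le> \<alpha>2"
    and ratio1: "\<And>s \<mu>. s \<in> {-1, 1} \<Longrightarrow> \<mu> \<in> {1..k + 1} \<Longrightarrow> xratio e V a (qnode \<xi> dy b s \<mu>) \<le> \<alpha>1"
    and ratio2: "\<And>m \<mu>. m \<in> {-1, 1} \<Longrightarrow> \<mu> \<in> {1..k + 1} \<Longrightarrow> yratio e V (qnode \<xi> dx a m \<mu>) b \<le> \<alpha>2"
    and \<tau>: "0 < \<tau>"
    and cfl: "0 < dt * (\<alpha>1 / dx + \<alpha>2 / dy)" "dt * (\<alpha>1 / dx + \<alpha>2 / dy) \<le> \<theta> * \<omega>bar / 2"
    and \<theta>: "\<theta> = dt / \<tau>" "0 < \<theta>" "\<theta> \<le> 1"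
  shows "cell_avg dx dy U (a, b) + dt *\<^sub>R L_op e (k + 1) \<xi> \<omega> dx dy \<tau> U V (a, b) \<in> admissible e"
proof (rule admissible_gauge[OF eos])
  fix l c w \<kappa> assume ga: "gauge e l c w \<kappa>"
  have l: "linear l" using ga by (simp add: gauge_def)
  define lam where "lam = \<alpha>1 / dx + \<alpha>2 / dy"
  \<comment> \<open>\<open>\<eta> * \<alpha>1 / dx\<close> is the weight of a vertical side in
    \<open>\<theta>\<close> times the bound of \<open>cell_avg_lower\<close>. Fluxes and sources
    carry \<open>dt / 2\<close> because of the factor \<open>\<omega> \<mu> / 2\<close> in the
    operators. So the CFL condition is exactly \<open>t \<le> \<eta>\<close>.\<close>
  define \<eta> where "\<eta> = \<theta> * \<omega>bar / (4 * lam)"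
  define t where "t = dt / 2"
  have lam: "0 < lam" using \<alpha> mesh by (simp add: lam_def add_pos_pos)
  then have dt: "0 < dt" using cfl(1) by (simp add: lam_def[symmetric] zero_less_mult_iff)
  have t: "0 < t" "t \<le> \<eta>"
    using dt cfl(2) lam by (auto simp: t_def \<eta>_def lam_def[symmetric] field_simps)
  define W where "W f = (\<Sum>\<mu>=1..k+1. \<omega> \<mu> * f \<mu>)" for f :: "nat \<Rightarrow> real"
  have W_add: "W (\<lambda>\<mu>. f \<mu> + g \<mu>) = W f + W g" and W_diff: "W (\<lambda>\<mu>. f \<mu> - g \<mu>) = W f - W g"
    and W_scale: "W (\<lambda>\<mu>. r * f \<mu>) = r * W f" for f g r
    unfolding W_def
    by (simp_all only: distrib_left right_diff_distrib sum.distrib sum_subtractf sum_distrib_left mult.left_commute)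
  have W_less: "W f < W g" if "\<And>\<mu>. \<mu> \<in> {1..k+1} \<Longrightarrow> f \<mu> < g \<mu>" for f g
    unfolding W_def
    by (intro sum_strict_mono mult_strict_left_mono that gauss_node_weight(1)[OF gauss]) auto
  define X where "X m s = W (\<lambda>\<mu>. (l (xo m s \<mu>) + c) + (l (xi m s \<mu>) + c))" for m s
  define Y where "Y m s = W (\<lambda>\<mu>. (l (yo m s \<mu>) + c) + (l (yi m s \<mu>) + c))" for m s
  define FX where "FX s = W (\<lambda>\<mu>. l (flux e 1 (xo 1 s \<mu>)) - l (flux e 1 (xo (-1) s \<mu>)))" for s
  define FY where "FY m = W (\<lambda>\<mu>. l (flux e 2 (yo m 1 \<mu>)) - l (flux e 2 (yo m (-1) \<mu>)))" for m
  define SX where "SX s = W (\<lambda>\<mu>. (mag (xi 1 s \<mu>) $ 1 - mag (xi (-1) s \<mu>) $ 1)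
          * l (source e ((1 / 2) *\<^sub>R (xi 1 s \<mu> + xi (-1) s \<mu>))))" for s
  define SY where "SY m = W (\<lambda>\<mu>. (mag (yi m 1 \<mu>) $ 2 - mag (yi m (-1) \<mu>) $ 2)
          * l (source e ((1 / 2) *\<^sub>R (yi m 1 \<mu> + yi m (-1) \<mu>))))" for m
  define ox where "ox m s = W (\<lambda>\<mu>. mag (xo m s \<mu>) $ 1)" for m s
  define ix where "ix m s = W (\<lambda>\<mu>. mag (xi m s \<mu>) $ 1)" for m s
  define oy where "oy m s = W (\<lambda>\<mu>. mag (yo m s \<mu>) $ 2)" for m s
  define iy where "iy m s = W (\<lambda>\<mu>. mag (yi m s \<mu>) $ 2)" for m s
  have pm: "(1::real) \<in> {-1, 1}" "(-1::real) \<in> {-1, 1}" by auto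
  have IX: "t * \<kappa> * ((ix 1 s - ix (-1) s) - (ox 1 s - ox (-1) s))
      < \<eta> * \<alpha>1 * (X 1 s + X (-1) s) - t * FX s - t * SX s" if s: "s \<in> {-1, 1}" for s
  proof -
    have "W (\<lambda>\<mu>. t * \<kappa> * ((mag (xi 1 s \<mu>) $ 1 - mag (xi (-1) s \<mu>) $ 1) - (mag (xo 1 s \<mu>) $ 1 - mag (xo (-1) s \<mu>) $ 1)))
      < W (\<lambda>\<mu>. \<eta> * \<alpha>1 * ((l (xo 1 s \<mu>) + c) + (l (xo (-1) s \<mu>) + c) + (l (xi 1 s \<mu>) + c) + (l (xi (-1) s \<mu>) + c))
        - t * (l (flux e 1 (xo 1 s \<mu>)) - l (flux e 1 (xo (-1) s \<mu>)))
        - t * ((mag (xi 1 s \<mu>) $ 1 - mag (xi (-1) s \<mu>) $ 1) * l (source e ((1 / 2) *\<^sub>R (xi 1 s \<mu> + xi (-1) s \<mu>)))))"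
    proof (rule W_less)
      fix \<mu> assume \<mu>: "\<mu> \<in> {1..k+1}"
      show "t * \<kappa> * ((mag (xi 1 s \<mu>) $ 1 - mag (xi (-1) s \<mu>) $ 1) - (mag (xo 1 s \<mu>) $ 1 - mag (xo (-1) s \<mu>) $ 1))
        < \<eta> * \<alpha>1 * ((l (xo 1 s \<mu>) + c) + (l (xo (-1) s \<mu>) + c) + (l (xi 1 s \<mu>) + c) + (l (xi (-1) s \<mu>) + c))
        - t * (l (flux e 1 (xo 1 s \<mu>)) - l (flux e 1 (xo (-1) s \<mu>)))
        - t * ((mag (xi 1 s \<mu>) $ 1 - mag (xi (-1) s \<mu>) $ 1) * l (source e ((1 / 2) *\<^sub>R (xi 1 s \<mu> + xi (-1) s \<mu>))))"
        using ratio1[OF s \<mu>] unfolding jump_values(5)[OF s \<mu>]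
        by (intro interface_estimate[OF ga] edge_admissible[OF pm(1) s \<mu>] edge_admissible[OF pm(2) s \<mu>] \<alpha> t)
    qed
    then show ?thesis
      unfolding W_add W_diff W_scale ix_def ox_def X_def FX_def SX_def by (simp only: add_ac)
  qed
  have IY: "t * \<kappa> * ((iy m 1 - iy m (-1)) - (oy m 1 - oy m (-1)))
      < \<eta> * \<alpha>2 * (Y m 1 + Y m (-1)) - t * FY m - t * SY m" if m: "m \<in> {-1, 1}" for m
  proof -
    have "W (\<lambda>\<mu>. t * \<kappa> * ((mag (yi m 1 \<mu>) $ 2 - mag (yi m (-1) \<mu>) $ 2) - (mag (yo m 1 \<mu>) $ 2 - mag (yo m (-1) \<mu>) $ 2)))
      < W (\<lambda>\<mu>. \<eta> * \<alpha>2 * ((l (yo m 1 \<mu>) + c) + (l (yo m (-1) \<mu>) + c) + (l (yi m 1 \<mu>) + c) + (l (yi m (-1) \<mu>) + c))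
        - t * (l (flux e 2 (yo m 1 \<mu>)) - l (flux e 2 (yo m (-1) \<mu>)))
        - t * ((mag (yi m 1 \<mu>) $ 2 - mag (yi m (-1) \<mu>) $ 2) * l (source e ((1 / 2) *\<^sub>R (yi m 1 \<mu> + yi m (-1) \<mu>)))))"
    proof (rule W_less)
      fix \<mu> assume \<mu>: "\<mu> \<in> {1..k+1}"
      show "t * \<kappa> * ((mag (yi m 1 \<mu>) $ 2 - mag (yi m (-1) \<mu>) $ 2) - (mag (yo m 1 \<mu>) $ 2 - mag (yo m (-1) \<mu>) $ 2))
        < \<eta> * \<alpha>2 * ((l (yo m 1 \<mu>) + c) + (l (yo m (-1) \<mu>) + c) + (l (yi m 1 \<mu>) + c) + (l (yi m (-1) \<mu>) + c))
        - t * (l (flux e 2 (yo m 1 \<mu>)) - l (flux e 2 (yo m (-1) \<mu>)))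
        - t * ((mag (yi m 1 \<mu>) $ 2 - mag (yi m (-1) \<mu>) $ 2) * l (source e ((1 / 2) *\<^sub>R (yi m 1 \<mu> + yi m (-1) \<mu>))))"
        using ratio2[OF m \<mu>] unfolding jump_values(6)[OF m \<mu>]
        by (intro interface_estimate[OF ga] edge_admissible[OF m pm(1) \<mu>] edge_admissible[OF m pm(2) \<mu>] \<alpha> t)
    qed
    then show ?thesis
      unfolding W_add W_diff W_scale iy_def oy_def Y_def FY_def SY_def by (simp only: add_ac)
  qed
  have DIV: "m * (ox m s - ix m s) / dx + s * (oy m s - iy m s) / dy = 0" if "m \<in> {-1, 1}" "s \<in> {-1, 1}" for m s
    using edge_divergence[OF that] unfolding W_def ox_def ix_def oy_def iy_def .
  define Vb where "Vb = l (cell_avg dx dy V (a, b)) + c"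
  define Ub where "Ub = l (cell_avg dx dy U (a, b)) + c"
  have Ub: "0 < Ub" using ga U by (auto simp: gauge_def Ub_def)
  have "\<omega>bar / 4 * (\<Sum>m\<in>{-1, 1}. \<Sum>s\<in>{-1, 1}. \<alpha>1 / dx / lam * X m s + \<alpha>2 / dy / lam * Y m s) \<le> Vb"
    using cell_avg_lower[OF cad ga] unfolding Vb_def X_def Y_def lam_def[symmetric] W_def[symmetric] W_add W_scale .
  then have "\<theta> * (\<omega>bar / 4 * (\<Sum>m\<in>{-1, 1}. \<Sum>s\<in>{-1, 1}. \<alpha>1 / dx / lam * X m s + \<alpha>2 / dy / lam * Y m s)) \<le> \<theta> * Vb"
    using \<theta>(2) by (intro mult_left_mono) auto
  moreover have "\<theta> * (\<omega>bar / 4 * (\<Sum>m\<in>{-1, 1}. \<Sum>s\<in>{-1, 1}. \<alpha>1 / dx / lam * X m s + \<alpha>2 / dy / lam * Y m s))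
     = (\<Sum>s\<in>{-1, 1}. \<eta> * \<alpha>1 * (X 1 s + X (-1) s) / dx) + (\<Sum>m\<in>{-1, 1}. \<eta> * \<alpha>2 * (Y m 1 + Y m (-1)) / dy)"
    unfolding sum_pm1 \<eta>_def by (simp add: algebra_simps add_divide_distrib)
  ultimately have LOW: "(\<Sum>s\<in>{-1, 1}. \<eta> * \<alpha>1 * (X 1 s + X (-1) s) / dx) + (\<Sum>m\<in>{-1, 1}. \<eta> * \<alpha>2 * (Y m 1 + Y m (-1)) / dy)
    \<le> \<theta> * Vb" by linarith
  have "l (cell_avg dx dy U (a, b) + dt *\<^sub>R L_op e (k + 1) \<xi> \<omega> dx dy \<tau> U V (a, b)) + c
    = (1 - \<theta>) * Ub + \<theta> * Vb - (\<Sum>s\<in>{-1, 1}. (t * FX s + t * SX s) / dx) - (\<Sum>m\<in>{-1, 1}. (t * FY m + t * SY m) / dy)"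
    unfolding update_functional[OF l] W_def[symmetric] FX_def[symmetric] FY_def[symmetric] SX_def[symmetric] SY_def[symmetric]
      sum_pm1 \<theta>(1) t_def Ub_def Vb_def
    by (simp add: algebra_simps add_divide_distrib diff_divide_distrib)
  moreover have "(\<Sum>s\<in>{-1, 1}. t * \<kappa> * ((ix 1 s - ix (-1) s) - (ox 1 s - ox (-1) s)) / dx)
      + (\<Sum>m\<in>{-1, 1}. t * \<kappa> * ((iy m 1 - iy m (-1)) - (oy m 1 - oy m (-1))) / dy)
    < (\<Sum>s\<in>{-1, 1}. (\<eta> * \<alpha>1 * (X 1 s + X (-1) s) - t * FX s - t * SX s) / dx)
      + (\<Sum>m\<in>{-1, 1}. (\<eta> * \<alpha>2 * (Y m 1 + Y m (-1)) - t * FY m - t * SY m) / dy)"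
    using mesh by (intro add_strict_mono sum_strict_mono divide_strict_right_mono IX IY) auto
  \<comment> \<open>Regrouped by quarter cells, outer differences and inner jumps combine into the
    four discrete divergences.\<close>
  moreover have "(\<Sum>s\<in>{-1, 1}. t * \<kappa> * ((ix 1 s - ix (-1) s) - (ox 1 s - ox (-1) s)) / dx)
      + (\<Sum>m\<in>{-1, 1}. t * \<kappa> * ((iy m 1 - iy m (-1)) - (oy m 1 - oy m (-1))) / dy)
    = - t * \<kappa> * (\<Sum>m\<in>{-1, 1}. \<Sum>s\<in>{-1, 1}. m * (ox m s - ix m s) / dx + s * (oy m s - iy m s) / dy)"
    unfolding sum_pm1 by (simp add: algebra_simps add_divide_distrib diff_divide_distrib)
  moreover have "(\<Sum>m\<in>{-1, 1}. \<Sum>s\<in>{-1, 1}. m * (ox m s - ix m s) / dx + s * (oy m s - iy m s) / dy) = 0"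
    by (intro sum.neutral ballI DIV)
  moreover have "(\<Sum>s\<in>{-1, 1}. (\<eta> * \<alpha>1 * (X 1 s + X (-1) s) - t * FX s - t * SX s) / dx)
      = (\<Sum>s\<in>{-1, 1}. \<eta> * \<alpha>1 * (X 1 s + X (-1) s) / dx) - (\<Sum>s\<in>{-1, 1}. (t * FX s + t * SX s) / dx)"
    "(\<Sum>m\<in>{-1, 1}. (\<eta> * \<alpha>2 * (Y m 1 + Y m (-1)) - t * FY m - t * SY m) / dy)
      = (\<Sum>m\<in>{-1, 1}. \<eta> * \<alpha>2 * (Y m 1 + Y m (-1)) / dy) - (\<Sum>m\<in>{-1, 1}. (t * FY m + t * SY m) / dy)"
    by (simp_all only: sum_subtractf[symmetric] diff_divide_distrib[symmetric] diff_diff_eq)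
  moreover have "0 \<le> (1 - \<theta>) * Ub" using Ub \<theta>(3) by simp
  ultimately show "0 < l (cell_avg dx dy U (a, b) + dt *\<^sub>R L_op e (k + 1) \<xi> \<omega> dx dy \<tau> U V (a, b)) + c"
    using LOW by simp
qed

end

section \<open>From one cell to the two overlapping meshes\<close>

lemma half_shift:
  fixes m :: real
  assumes "m \<in> {-1, 1}"
  shows "\<exists>j::int. x + of_int i * h + m * h / 2 = x + h / 2 + of_int j * h"
    and "\<exists>j::int. x + h / 2 + of_int i * h + m * h / 2 = x + of_int j * h"
proof -
  have "x + of_int i * h + m * h / 2 = x + h / 2 + of_int (if m = 1 then i else i - 1) * h"
    "x + h / 2 + of_int i * h + m * h / 2 = x + of_int (if m = 1 then i + 1 else i) * h"
    using assms by (auto simp: algebra_simps)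
  then show "\<exists>j::int. x + of_int i * h + m * h / 2 = x + h / 2 + of_int j * h"
    "\<exists>j::int. x + h / 2 + of_int i * h + m * h / 2 = x + of_int j * h" by blast+
qed

lemma corner_centers:
  assumes "m \<in> {-1, 1}" "s \<in> {-1, 1}"
  shows "(a, b) \<in> primal_centers x0 y0 dx dy \<Longrightarrow> (a + m * dx / 2, b + s * dy / 2) \<in> dual_centers x0 y0 dx dy"
    and "(a, b) \<in> dual_centers x0 y0 dx dy \<Longrightarrow> (a + m * dx / 2, b + s * dy / 2) \<in> primal_centers x0 y0 dx dy"
  using half_shift[OF assms(1)] half_shift[OF assms(2)]
  unfolding primal_centers_def dual_centers_def by blast+

lemma mesh_cellI:
  assumes "eos e" "cold_limit e" "0 < dx" "0 < dy" "gauss_rule (k + 1) \<xi> \<omega>"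
    and cad: "feasible_cad k (k + 1) \<xi> \<omega> lam1 lam2 \<omega>bar S \<omega>t xt yt"
    and V: "V \<in> ldf_space k dx dy C"
    and C: "\<And>m s. m \<in> {-1, 1} \<Longrightarrow> s \<in> {-1, 1} \<Longrightarrow> (a + m * dx / 2, b + s * dy / 2) \<in> C"
    and nodes: "\<And>m s z. m \<in> {-1, 1} \<Longrightarrow> s \<in> {-1, 1} \<Longrightarrow>
      z \<in> quarter_nodes (k + 1) \<xi> S xt yt dx dy (a + m * dx / 4, b + s * dy / 4) \<Longrightarrow>
      Lim (at z within rect (dx / 2) (dy / 2) (a + m * dx / 4, b + s * dy / 4)) V \<in> admissible e"
  shows "\<exists>P. mesh_cell e k S \<xi> \<omega> xt yt dx dy a b V P"
proof -
  have "\<exists>p. poly2 k p \<and> (\<forall>w\<in>rect dx dy z. V w = p w)" if "z \<in> C" for z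
    using V that by (auto simp: ldf_space_def)
  then obtain p where p: "\<And>z. z \<in> C \<Longrightarrow> poly2 k (p z)" "\<And>z w. z \<in> C \<Longrightarrow> w \<in> rect dx dy z \<Longrightarrow> V w = p z w"
    by metis
  have "mesh_cell e k S \<xi> \<omega> xt yt dx dy a b V (\<lambda>m s. p (a + m * dx / 2, b + s * dy / 2))"
  proof
    show "xt j \<in> {-1..1} \<and> yt j \<in> {-1..1}" if "j \<in> {1..S}" for j
      using cad that by (auto simp: feasible_cad_def)
    show "deriv (\<lambda>t. mag (V (t, y)) $ 1) x + deriv (\<lambda>t. mag (V (x, t)) $ 2) y = 0"
      if "m \<in> {-1, 1}" "s \<in> {-1, 1}" "(x, y) \<in> rect dx dy (a + m * dx / 2, b + s * dy / 2)" for m s x y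
      using V C[OF that(1,2)] that(3) by (auto simp: ldf_space_def)
    show "poly2 k (p (a + m * dx / 2, b + s * dy / 2))" if "m \<in> {-1, 1}" "s \<in> {-1, 1}" for m s
      using p(1)[OF C[OF that]] .
    show "V z = p (a + m * dx / 2, b + s * dy / 2) z"
      if "m \<in> {-1, 1}" "s \<in> {-1, 1}" "z \<in> rect dx dy (a + m * dx / 2, b + s * dy / 2)" for m s z
      using p(2)[OF C[OF that(1,2)] that(3)] .
    show "Lim (at z within rect (dx / 2) (dy / 2) (a + m * dx / 4, b + s * dy / 4)) V \<in> admissible e"
      if "m \<in> {-1, 1}" "s \<in> {-1, 1}" "z \<in> quarter_nodes (k + 1) \<xi> S xt yt dx dy (a + m * dx / 4, b + s * dy / 4)" for m s z
      using nodes[OF that] .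
  qed (fact assms)+
  then show ?thesis by blast
qed

lemma is_sup_upper: "is_sup A s \<Longrightarrow> x \<in> A \<Longrightarrow> x \<le> s"
  by (auto simp: is_sup_def intro: cSup_upper)

theorem theorem4p1:
  fixes e :: "real \<Rightarrow> real \<Rightarrow> real"
    and k S :: nat
    and x0 y0 dx dy dt \<tau>max \<theta> \<alpha>1 \<alpha>2 \<beta>1 \<beta>2 \<omega>bar :: real
    and \<xi> \<omega> \<omega>t xt yt :: "nat \<Rightarrow> real"
    and UI UJ :: "real \<times> real \<Rightarrow> state"
  defines "I \<equiv> primal_centers x0 y0 dx dy"
    and "J \<equiv> dual_centers x0 y0 dx dy"
    and "G \<equiv> admissible e"
    and "Q \<equiv> k + 1"
  assumes eos: "eos e" "cold_limit e"
    and mesh: "dx > 0" "dy > 0"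
    and gauss: "gauss_rule Q \<xi> \<omega>"
    and UI: "UI \<in> ldf_space k dx dy I"
    and UJ: "UJ \<in> ldf_space k dx dy J"
    and avg_I: "\<forall>z\<in>I. cell_avg dx dy UI z \<in> G"
    and avg_J: "\<forall>z\<in>J. cell_avg dx dy UJ z \<in> G"
    and beta1: "is_sup (ratios1 e Q \<xi> dy UJ I \<union> ratios1 e Q \<xi> dy UI J) \<beta>1"
    and beta2: "is_sup (ratios2 e Q \<xi> dx UJ I \<union> ratios2 e Q \<xi> dx UI J) \<beta>2"
    and alpha: "\<alpha>1 = max 1 \<beta>1" "\<alpha>2 = max 1 \<beta>2"
    and cad: "feasible_cad k Q \<xi> \<omega> (\<alpha>1 / dx) (\<alpha>2 / dy) \<omega>bar S \<omega>t xt yt"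
    and nodes_I: "\<forall>z\<in>I. node_values_in Q \<xi> S xt yt dx dy G UI z"
    and nodes_J: "\<forall>z\<in>I. node_values_in Q \<xi> S xt yt dx dy G UJ z"
    and tau: "\<tau>max > 0"
    and cfl: "0 < dt * (\<alpha>1 / dx + \<alpha>2 / dy)" "dt * (\<alpha>1 / dx + \<alpha>2 / dy) \<le> \<theta> * \<omega>bar / 2"
    and theta: "\<theta> = dt / \<tau>max" "0 < \<theta>" "\<theta> \<le> 1"
  shows "(\<forall>z\<in>I. cell_avg dx dy UI z + dt *\<^sub>R L_op e Q \<xi> \<omega> dx dy \<tau>max UI UJ z \<in> G) \<and>
         (\<forall>z\<in>J. cell_avg dx dy UJ z + dt *\<^sub>R L_op e Q \<xi> \<omega> dx dy \<tau>max UJ UI z \<in> G)"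
proof -
  have update: "cell_avg dx dy U (a, b) + dt *\<^sub>R L_op e Q \<xi> \<omega> dx dy \<tau>max U V (a, b) \<in> G"
    if V: "V \<in> ldf_space k dx dy C'" and U: "cell_avg dx dy U (a, b) \<in> G"
      and C': "\<And>m s. m \<in> {-1, 1} \<Longrightarrow> s \<in> {-1, 1} \<Longrightarrow> (a + m * dx / 2, b + s * dy / 2) \<in> C'"
      and nodes: "\<And>m s z. m \<in> {-1, 1} \<Longrightarrow> s \<in> {-1, 1} \<Longrightarrow>
        z \<in> quarter_nodes Q \<xi> S xt yt dx dy (a + m * dx / 4, b + s * dy / 4) \<Longrightarrow>
        Lim (at z within rect (dx / 2) (dy / 2) (a + m * dx / 4, b + s * dy / 4)) V \<in> G"
      and r: "(a, b) \<in> C" "ratios1 e Q \<xi> dy V C \<subseteq> {..\<beta>1}" "ratios2 e Q \<xi> dx V C \<subseteq> {..\<beta>2}"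
    for U V C C' a b
  proof -
    obtain P where "mesh_cell e k S \<xi> \<omega> xt yt dx dy a b V P"
      using mesh_cellI[OF eos mesh gauss[unfolded Q_def] cad[unfolded Q_def] V C' nodes[unfolded Q_def G_def]] by blast
    then interpret mesh_cell e k S \<xi> \<omega> xt yt dx dy a b V P .
    have "xratio e V a (qnode \<xi> dy b s \<mu>) \<le> \<alpha>1" if "s \<in> {-1, 1}" "\<mu> \<in> {1..k + 1}" for s \<mu>
    proof -
      have "xratio e V a (qnode \<xi> dy b s \<mu>) \<in> ratios1 e Q \<xi> dy V C"
        unfolding ratios1_def Q_def using that r(1) by blast
      then show ?thesis using r(2) by (auto simp: alpha)
    qed
    moreover have "yratio e V (qnode \<xi> dx a m \<mu>) b \<le> \<alpha>2" if "m \<in> {-1, 1}" "\<mu> \<in> {1..k + 1}" for m \<mu>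
    proof -
      have "yratio e V (qnode \<xi> dx a m \<mu>) b \<in> ratios2 e Q \<xi> dx V C"
        unfolding ratios2_def Q_def using that r(1) by blast
      then show ?thesis using r(3) by (auto simp: alpha)
    qed
    ultimately show ?thesis
      unfolding G_def Q_def
      by (intro update_admissible[OF cad[unfolded Q_def] U[unfolded G_def] _ _ _ _ tau cfl theta]) (auto simp: alpha)
  qed
  have ratios: "ratios1 e Q \<xi> dy UJ I \<subseteq> {..\<beta>1}" "ratios1 e Q \<xi> dy UI J \<subseteq> {..\<beta>1}"
    "ratios2 e Q \<xi> dx UJ I \<subseteq> {..\<beta>2}" "ratios2 e Q \<xi> dx UI J \<subseteq> {..\<beta>2}"
    using is_sup_upper[OF beta1] is_sup_upper[OF beta2] by auto
  show ?thesis
  proof (intro conjI ballI)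
    fix z assume z: "z \<in> I"
    obtain a b where ab: "z = (a, b)" by fastforce
    show "cell_avg dx dy UI z + dt *\<^sub>R L_op e Q \<xi> \<omega> dx dy \<tau>max UI UJ z \<in> G"
      unfolding ab
    proof (rule update[OF UJ _ _ _ _ ratios(1,3)])
      show "(a + m * dx / 2, b + s * dy / 2) \<in> J" if "m \<in> {-1, 1}" "s \<in> {-1, 1}" for m s
        using corner_centers(1)[OF that] z unfolding ab I_def J_def .
      show "Lim (at w within rect (dx / 2) (dy / 2) (a + m * dx / 4, b + s * dy / 4)) UJ \<in> G"
        if "m \<in> {-1, 1}" "s \<in> {-1, 1}" "w \<in> quarter_nodes Q \<xi> S xt yt dx dy (a + m * dx / 4, b + s * dy / 4)" for m s w
        using nodes_J z that unfolding ab node_values_in_def Let_def prod.case by blast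
    qed (use avg_I z ab in auto)
  next
    fix z assume z: "z \<in> J"
    obtain a b where ab: "z = (a, b)" by fastforce
    have corner: "(a + m * dx / 2, b + s * dy / 2) \<in> I" if "m \<in> {-1, 1}" "s \<in> {-1, 1}" for m s
      using corner_centers(2)[OF that] z unfolding ab I_def J_def .
    show "cell_avg dx dy UJ z + dt *\<^sub>R L_op e Q \<xi> \<omega> dx dy \<tau>max UJ UI z \<in> G"
      unfolding ab
    proof (rule update[OF UI _ corner _ _ ratios(2,4)])
      show "Lim (at w within rect (dx / 2) (dy / 2) (a + m * dx / 4, b + s * dy / 4)) UI \<in> G"
        if ms: "m \<in> {-1, 1}" "s \<in> {-1, 1}" and w: "w \<in> quarter_nodes Q \<xi> S xt yt dx dy (a + m * dx / 4, b + s * dy / 4)" for m s w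
      proof -
        \<comment> \<open>The node hypotheses are indexed by primal cells. The quarter of a dual
          cell towards its corner \<open>(m, s)\<close> is the quarter \<open>(- m, - s)\<close> of
          the primal cell centered at that corner.\<close>
        have neg: "- m \<in> {-1, 1}" "- s \<in> {-1, 1}" using ms by auto
        have q: "(a + m * dx / 2 + - m * dx / 4, b + s * dy / 2 + - s * dy / 4) = (a + m * dx / 4, b + s * dy / 4)"
          by simp
        have "node_values_in Q \<xi> S xt yt dx dy G UI (a + m * dx / 2, b + s * dy / 2)"
          using nodes_I corner[OF ms] by blast
        then have "\<forall>w\<in>quarter_nodes Q \<xi> S xt yt dx dy (a + m * dx / 2 + - m * dx / 4, b + s * dy / 2 + - s * dy / 4).
            Lim (at w within rect (dx / 2) (dy / 2) (a + m * dx / 2 + - m * dx / 4, b + s * dy / 2 + - s * dy / 4)) UI \<in> G"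
          using neg unfolding node_values_in_def Let_def prod.case by blast
        then show ?thesis using w unfolding q by blast
      qed
    qed (use avg_J z ab in auto)
  qed
qed

end
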